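(* Let $\Omega\subset\mathbb{R}^n$ be a domain, let $1\le K<\infty$, and let $f\colon\Omega\to\mathbb{R}^n$ be a $K$-quasiconformal field of bounded variation on $C^1$-curves. Let $a\in\Omega$ with $f(a)\ne0$, and suppose we are given two local solutions (defined on open intervals containing $0$) of the Cauchy problem $$\dot{x}(t)=f(x(t)),\quad x(0)=a,\qquad\qquad \dot{y}(t)=f(y(t)),\quad y(0)=a.$$ Then there exists $\epsilon>0$ such that $x(t)=y(t)$ for $-\epsilon<t<\epsilon$.
   Context: A sense preserving homeomorphism $f\colon\Omega\to\mathbb{R}^n$ (onto its image) is $K$-quasiconformal if $$\limsup_{\epsilon\to0}\frac{\max_{|x-a|=\epsilon}|f(x)-f(a)|}{\min_{|y-a|=\epsilon}|f(y)-f(a)|}\le K\qquad\text{for every }a\in\Omega.$$ A $C^1$-arc is the image of an injective $C^1$ map $x\colon[\alpha,\beta]\to\mathbb{R}^n$ with nonvanishing derivative. The map $f$ is of bounded variation on $C^1$-curves if for every compact $C^1$-arc $\Gamma\subset\Omega$, $$|f(\Gamma)|_1=\sup\sum_{\nu=1}^N\operatorname{diam}f(\gamma_\nu)<\infty,$$ where the supremum is over all finite partitions of $\Gamma$ into consecutive subarcs $\gamma_1,\dots,\gamma_N$. *)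

theory Defs
  imports "HOL-Analysis.Analysis" "HOL-Homology.Brouwer_Degree"
begin

text \<open>The library's \<^const>\<open>nsphere\<close> and \<^const>\<open>Brouwer_degree2\<close> represent points as functions
  from \<^typ>\<open>nat\<close> to \<^typ>\<open>real\<close>, supported on an initial segment. An enumeration \<open>e\<close> of the index
  type transfers self-maps of the unit sphere of \<open>real ^ 'n\<close> to this representation.\<close>

definition vec_to_seq :: "('n::finite \<Rightarrow> nat) \<Rightarrow> real ^ 'n \<Rightarrow> nat \<Rightarrow> real" where
  "vec_to_seq e v = (\<lambda>k. if k < CARD('n) then v $ inv_into UNIV e k else 0)"

definition seq_to_vec :: "('n::finite \<Rightarrow> nat) \<Rightarrow> (nat \<Rightarrow> real) \<Rightarrow> real ^ 'n" where
  "seq_to_vec e u = (\<chi> i. u (e i))"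

text \<open>A homeomorphism is sense preserving if its local degree is 1 at every point \<open>a\<close>, i.e. if the
  map \<open>u \<mapsto> (f (a + r u) - f a) / norm (f (a + r u) - f a)\<close> of the unit sphere has degree 1.
  The degree does not depend on the enumeration \<open>e\<close>: changing it conjugates the map by a
  permutation of the coordinates.\<close>

definition sense_preserving_on :: "(real ^ 'n) set \<Rightarrow> (real ^ 'n \<Rightarrow> real ^ 'n) \<Rightarrow> bool" where
  "sense_preserving_on \<Omega> f \<longleftrightarrow>
     (\<forall>e :: 'n::finite \<Rightarrow> nat. bij_betw e UNIV {..<CARD('n)} \<longrightarrow>
       (\<forall>a\<in>\<Omega>. \<forall>r>0. cball a r \<subseteq> \<Omega> \<longrightarrow>
          Brouwer_degree2 (CARD('n) - 1)
            (vec_to_seq e \<circ> (\<lambda>u. sgn (f (a + r *\<^sub>R u) - f a)) \<circ> seq_to_vec e) = 1))"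

text \<open>For small \<open>\<epsilon>\<close> the sphere lies in \<open>\<Omega>\<close> and is compact, so for continuous \<open>f\<close> the supremum and
  the infimum are the maximum and the minimum, and the latter is positive if \<open>f\<close> is injective.\<close>

definition linear_dilatation :: "(real ^ 'n \<Rightarrow> real ^ 'n) \<Rightarrow> real ^ 'n::finite \<Rightarrow> ereal" where
  "linear_dilatation f a =
     Limsup (at_right 0)
       (\<lambda>\<epsilon>. ereal ((SUP x\<in>sphere a \<epsilon>. norm (f x - f a)) / (INF y\<in>sphere a \<epsilon>. norm (f y - f a))))"

definition quasiconformal_on ::
    "real \<Rightarrow> (real ^ 'n) set \<Rightarrow> (real ^ 'n \<Rightarrow> real ^ 'n::finite) \<Rightarrow> bool" where
  "quasiconformal_on K \<Omega> f \<longleftrightarrow>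
     (\<exists>g. homeomorphism \<Omega> (f ` \<Omega>) f g) \<and>
     sense_preserving_on \<Omega> f \<and>
     (\<forall>a\<in>\<Omega>. linear_dilatation f a \<le> ereal K)"

definition C1_arc_param :: "(real \<Rightarrow> real ^ 'n::finite) \<Rightarrow> real \<Rightarrow> real \<Rightarrow> bool" where
  "C1_arc_param x \<alpha> \<beta> \<longleftrightarrow>
     \<alpha> < \<beta> \<and> inj_on x {\<alpha>..\<beta>} \<and>
     (\<exists>D. continuous_on {\<alpha>..\<beta>} D \<and>
          (\<forall>t\<in>{\<alpha>..\<beta>}. (x has_vector_derivative D t) (at t within {\<alpha>..\<beta>}) \<and> D t \<noteq> 0))"

definition C1_arc :: "(real ^ 'n::finite) set \<Rightarrow> bool" where
  "C1_arc \<Gamma> \<longleftrightarrow> (\<exists>x \<alpha> \<beta>. C1_arc_param x \<alpha> \<beta> \<and> \<Gamma> = x ` {\<alpha>..\<beta>})"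

text \<open>The partitions of an arc do not depend on the parametrization, since two injective
  parametrizations differ by a homeomorphism of the parameter intervals.\<close>

definition arc_partition :: "(real ^ 'n::finite) set \<Rightarrow> (real ^ 'n) set list \<Rightarrow> bool" where
  "arc_partition \<Gamma> \<gamma>s \<longleftrightarrow>
     (\<exists>x \<alpha> \<beta> t. C1_arc_param x \<alpha> \<beta> \<and> \<Gamma> = x ` {\<alpha>..\<beta>} \<and>
        t 0 = \<alpha> \<and> t (length \<gamma>s) = \<beta> \<and>
        (\<forall>\<nu><length \<gamma>s. t \<nu> < t (Suc \<nu>) \<and> \<gamma>s ! \<nu> = x ` {t \<nu>..t (Suc \<nu>)}))"

definition arc_variation :: "(real ^ 'n \<Rightarrow> real ^ 'n) \<Rightarrow> (real ^ 'n::finite) set \<Rightarrow> ereal" where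
  "arc_variation f \<Gamma> = (SUP \<gamma>s\<in>{\<gamma>s. arc_partition \<Gamma> \<gamma>s}. ereal (\<Sum>\<gamma>\<leftarrow>\<gamma>s. diameter (f ` \<gamma>)))"

definition bv_on_C1_curves :: "(real ^ 'n) set \<Rightarrow> (real ^ 'n \<Rightarrow> real ^ 'n::finite) \<Rightarrow> bool" where
  "bv_on_C1_curves \<Omega> f \<longleftrightarrow> (\<forall>\<Gamma>. C1_arc \<Gamma> \<and> \<Gamma> \<subseteq> \<Omega> \<longrightarrow> arc_variation f \<Gamma> < \<infinity>)"

definition local_solution ::
    "(real ^ 'n) set \<Rightarrow> (real ^ 'n \<Rightarrow> real ^ 'n::finite) \<Rightarrow> real ^ 'n \<Rightarrow> real set \<Rightarrow> (real \<Rightarrow> real ^ 'n) \<Rightarrow> bool"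
  where
  "local_solution \<Omega> f a I x \<longleftrightarrow>
     open I \<and> is_interval I \<and> 0 \<in> I \<and> x 0 = a \<and>
     (\<forall>t\<in>I. x t \<in> \<Omega> \<and> (x has_vector_derivative f (x t)) (at t))"

end

theory Submission
  imports Defs
begin

text \<open>A quasiconformal map is locally quasisymmetric in dimension at least 2, so
  \<open>f (x t) - f (y t)\<close> is at most a constant times the diameter of the image under \<open>f\<close> of the arc of
  the trajectory \<open>x\<close> around \<open>x t\<close> of length comparable to the distance \<open>d t\<close> of \<open>x t\<close> and \<open>y t\<close>
  (in dimension 1 the point \<open>y t\<close> lies on this arc). Summing over steps in time of length
  comparable to \<open>D\<close>, the maximum of \<open>d\<close>, bounds the growth of \<open>d\<close> up to \<open>D\<close> by \<open>D\<close> times the variation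
  of \<open>f\<close> along a short piece of the trajectory that stays away from time 0. This variation is as
  small as we like, which forces \<open>D = 0\<close>.

  The distortion estimate needs only the infinitesimal condition on the linear dilatation. If it
  failed, the arc and the preimage of a ray would be continua on which \<open>ln (norm f)\<close>, suitably
  normalized and truncated, takes values that differ by \<open>m\<close> times \<open>ln 2\<close>. Cover the domain by cubes
  from finitely many grids on which the distortion is controlled. The sum of the \<open>n\<close>-th powers of the
  oscillations over the cubes is at most of order \<open>m\<close>, since each dyadic annulus in the image
  contributes a bounded amount. It is at least of order \<open>m ^ n\<close> by a discrete form of the Loewner
  estimate, obtained by joining the two continua inside parallel hyperplanes.\<close>

text \<open>The bound on the linear dilatation holds at each point only for radii below a threshold
  that depends on the point, and neither differentiability nor absolute continuity of
  \<open>f\<close> is at hand. The energy is therefore a finite sum over cubes, each taken at a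
  scale that is good for one point in it: there the oscillation of \<open>f\<close> on the cube is
  bounded by the volumes of a small ball inside the cube and of its image. These balls overlap
  boundedly, and so do their images since \<open>f\<close> is injective, so volumes alone control
  the energy. In dimension n the two bounds on the energy leave \<open>m ^ (n - 1)\<close> bounded,
  which says nothing for n = 1; there the intermediate value theorem takes over. Because
  \<open>f a\<close> is not 0, trajectories near \<open>a\<close> are almost straight and have
  almost constant speed, so lengths are measured by time. The solutions separate at a rate that is a
  small fraction of this speed. Hence their distance at time \<open>2 * h\<close> is at most
  \<open>D / 2\<close>, and only the growth from then on, away from time 0, has to be paid for by
  the variation.\<close>

section \<open>Averaging and overlap\<close>

lemma integrable_indicator_lmeasurable:
  "A \<in> lmeasurable \<Longrightarrow> integrable lebesgue (indicat_real A)"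
  by (rule integrable_real_indicator) (auto simp: fmeasurable_def less_top)

text \<open>Both averages of the Loewner estimate have this form: over the endpoint \<open>w\<close>
  of a path in \<open>path_bound\<close> and over the hyperplane \<open>s\<close> in
  \<open>discrete_loewner\<close>.\<close>

lemma weighted_indicator_average:
  fixes A :: "'i \<Rightarrow> 'a::euclidean_space set"
  assumes "finite I" "\<And>i. i \<in> I \<Longrightarrow> A i \<in> lmeasurable" "W \<in> lmeasurable"
    and "\<And>i. i \<in> I \<Longrightarrow> 0 \<le> a i"
    and "\<And>w. w \<in> W \<Longrightarrow> U \<le> (\<Sum>i | i \<in> I \<and> w \<in> A i. a i)"
  shows "U * measure lebesgue W \<le> (\<Sum>i\<in>I. a i * measure lebesgue (A i))"
proof -
  have S: "(\<Sum>i | i \<in> I \<and> w \<in> A i. a i) = (\<Sum>i\<in>I. a i * indicat_real (A i) w)" for w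
    using assms(1) by (subst sum.mono_neutral_cong_right[of I "{i. i \<in> I \<and> w \<in> A i}"]) auto
  have "integral\<^sup>L lebesgue (\<lambda>w. U * indicat_real W w)
      \<le> integral\<^sup>L lebesgue (\<lambda>w. \<Sum>i\<in>I. a i * indicat_real (A i) w)"
  proof (rule integral_mono)
    show "integrable lebesgue (\<lambda>w. U * indicat_real W w)"
      using assms(3) by (simp add: integrable_indicator_lmeasurable)
    show "integrable lebesgue (\<lambda>w. \<Sum>i\<in>I. a i * indicat_real (A i) w)"
      using assms(2) by (intro Bochner_Integration.integrable_sum) (simp add: integrable_indicator_lmeasurable)
    fix w
    show "U * indicat_real W w \<le> (\<Sum>i\<in>I. a i * indicat_real (A i) w)"
    proof (cases "w \<in> W")
      case True
      then show ?thesis using assms(5)[OF True] S[of w] by simp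
    next
      case False
      then show ?thesis using assms(4) by (auto intro!: sum_nonneg)
    qed
  qed
  moreover have "integral\<^sup>L lebesgue (\<lambda>w. U * indicat_real W w) = U * measure lebesgue W"
    by simp
  moreover have "integral\<^sup>L lebesgue (\<lambda>w. \<Sum>i\<in>I. a i * indicat_real (A i) w)
      = (\<Sum>i\<in>I. a i * measure lebesgue (A i))"
    using assms(2) by (subst Bochner_Integration.integral_sum) (auto simp: integrable_indicator_lmeasurable)
  ultimately show ?thesis by simp
qed

lemma sum_measure_le_overlap:
  fixes A :: "'i \<Rightarrow> 'a::euclidean_space set"
  assumes "finite I" "\<And>i. i \<in> I \<Longrightarrow> A i \<in> lmeasurable" "B \<in> lmeasurable"
    and "\<And>i. i \<in> I \<Longrightarrow> A i \<subseteq> B"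
    and "\<And>y. card {i \<in> I. y \<in> A i} \<le> N"
  shows "(\<Sum>i\<in>I. measure lebesgue (A i)) \<le> real N * measure lebesgue B"
proof -
  have "(\<Sum>i\<in>I. measure lebesgue (A i)) = integral\<^sup>L lebesgue (\<lambda>w. \<Sum>i\<in>I. indicat_real (A i) w)"
    using assms(2) by (subst Bochner_Integration.integral_sum) (auto simp: integrable_indicator_lmeasurable)
  also have "\<dots> \<le> integral\<^sup>L lebesgue (\<lambda>w. real N * indicat_real B w)"
  proof (rule integral_mono)
    show "integrable lebesgue (\<lambda>w. real N * indicat_real B w)"
      using assms(3) by (simp add: integrable_indicator_lmeasurable)
    show "integrable lebesgue (\<lambda>w. \<Sum>i\<in>I. indicat_real (A i) w)"
      using assms(2) by (intro Bochner_Integration.integrable_sum) (simp add: integrable_indicator_lmeasurable)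
    fix w
    have eq: "(\<Sum>i\<in>I. indicat_real (A i) w) = real (card {i \<in> I. w \<in> A i})"
      using assms(1) by (simp add: indicator_def sum.If_cases Int_def)
    show "(\<Sum>i\<in>I. indicat_real (A i) w) \<le> real N * indicat_real B w"
    proof (cases "w \<in> B")
      case True
      then show ?thesis using assms(5)[of w] eq by simp
    next
      case False
      then have "{i \<in> I. w \<in> A i} = {}" using assms(4) by blast
      then show ?thesis using eq False by simp
    qed
  qed
  also have "\<dots> = real N * measure lebesgue B" by simp
  finally show ?thesis .
qed

text \<open>No order of the sets along \<open>S\<close> is needed. The interval between
  \<open>u p\<close> and \<open>u q\<close> lies in the image of \<open>S\<close>, which is covered
  by one interval of length \<open>2 * a i\<close> for each \<open>Q i\<close> that meets
  \<open>S\<close>; comparing lengths gives the factor 2.\<close>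

lemma oscillation_chain:
  fixes u :: "'a::topological_space \<Rightarrow> real"
  assumes "finite I" "connected S" "continuous_on S u" "S \<subseteq> (\<Union>i\<in>I. Q i)"
    and osc: "\<And>i z z'. i \<in> I \<Longrightarrow> z \<in> Q i \<inter> S \<Longrightarrow> z' \<in> Q i \<inter> S \<Longrightarrow> \<bar>u z - u z'\<bar> \<le> a i"
    and "p \<in> S" "q \<in> S"
  shows "\<bar>u p - u q\<bar> \<le> 2 * (\<Sum>i | i \<in> I \<and> Q i \<inter> S \<noteq> {}. a i)"
proof -
  have *: "u q - u p \<le> 2 * (\<Sum>i | i \<in> I \<and> Q i \<inter> S \<noteq> {}. a i)" if "p \<in> S" "q \<in> S" "u p \<le> u q" for p q
  proof -
    define J where "J = {i \<in> I. Q i \<inter> S \<noteq> {}}"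
    define y where "y = (\<lambda>i. SOME z. z \<in> Q i \<inter> S)"
    have y: "y i \<in> Q i \<inter> S" if "i \<in> J" for i
      proof -
    have "\<exists>z. z \<in> Q i \<inter> S" using that by (auto simp: J_def)
    then show ?thesis unfolding y_def by (rule someI_ex)
  qed
    define T where "T = (\<lambda>i. {u (y i) - a i..u (y i) + a i})"
    have fJ: "finite J" using assms(1) by (simp add: J_def)
    have a0: "0 \<le> a i" if "i \<in> J" for i
      using osc[of i "y i" "y i"] y[OF that] that by (auto simp: J_def)
    have "{u p..u q} \<subseteq> u ` S"
      using connected_continuous_image[OF assms(3,2)] that
      by (meson connected_contains_Icc imageI)
    also have "\<dots> \<subseteq> (\<Union>i\<in>J. T i)"
    proof
      fix v assume "v \<in> u ` S"
      then obtain z where z: "z \<in> S" "v = u z" by blast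
      then obtain i where i: "i \<in> I" "z \<in> Q i" using assms(4) by blast
      then have "i \<in> J" using z by (auto simp: J_def)
      then have "\<bar>u z - u (y i)\<bar> \<le> a i" using osc[of i z "y i"] y i z by blast
      then have "v \<in> T i" using z by (auto simp: T_def abs_le_iff)
      then show "v \<in> (\<Union>i\<in>J. T i)" using \<open>i \<in> J\<close> by blast
    qed
    finally have sub: "{u p..u q} \<subseteq> (\<Union>i\<in>J. T i)" .
    have "u q - u p = measure lebesgue {u p..u q}" using that by simp
    also have "\<dots> \<le> measure lebesgue (\<Union>i\<in>J. T i)"
      by (rule measure_mono_fmeasurable[OF sub]) (auto simp: T_def fJ intro!: fmeasurable.finite_UN)
    also have "\<dots> \<le> (\<Sum>i\<in>J. measure lebesgue (T i))"
      by (rule measure_UNION_le) (auto simp: fJ T_def)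
    also have "\<dots> = (\<Sum>i\<in>J. 2 * a i)"
      using a0 by (intro sum.cong) (auto simp: T_def)
    finally show ?thesis by (simp add: J_def sum_distrib_left)
  qed
  show ?thesis
  proof (cases "u p \<le> u q")
    case True then show ?thesis using *[OF assms(6,7)] by simp
  next
    case False then show ?thesis using *[OF assms(7,6)] by simp
  qed
qed

section \<open>Covers by cubes from shifted grids\<close>

text \<open>Half-open, so that the cells of one grid partition the space.\<close>

definition half_open_cube :: "real ^ 'n \<Rightarrow> real \<Rightarrow> (real ^ 'n) set" where
  "half_open_cube c r = {y. \<forall>j. c $ j \<le> y $ j \<and> y $ j < c $ j + r}"

text \<open>Equality of floors makes the cells of one grid equivalence classes, as
  \<open>grid_cell_cong\<close> exploits. The flag \<open>\<sigma> j\<close> shifts the grid by half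
  a cell in direction \<open>j\<close>.\<close>

definition grid_cell :: "('n \<Rightarrow> bool) \<Rightarrow> nat \<Rightarrow> real ^ 'n \<Rightarrow> (real ^ 'n) set" where
  "grid_cell \<sigma> k x =
     {y. \<forall>j. \<lfloor>3 ^ k * y $ j - of_bool (\<sigma> j) / 2\<rfloor> = \<lfloor>3 ^ k * x $ j - of_bool (\<sigma> j) / 2\<rfloor>}"

definition grid_corner :: "('n \<Rightarrow> bool) \<Rightarrow> nat \<Rightarrow> real ^ 'n::finite \<Rightarrow> real ^ 'n" where
  "grid_corner \<sigma> k x = (\<chi> j. (\<lfloor>3 ^ k * x $ j - of_bool (\<sigma> j) / 2\<rfloor> + of_bool (\<sigma> j) / 2) / 3 ^ k)"

lemma grid_cell_eq_cube: "grid_cell \<sigma> k x = half_open_cube (grid_corner \<sigma> k x) (1 / 3 ^ k)"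
proof -
  have "\<lfloor>3 ^ k * y - s\<rfloor> = m \<longleftrightarrow> (of_int m + s) / 3 ^ k \<le> y \<and> y < (of_int m + s) / 3 ^ k + 1 / 3 ^ k"
    for y s :: real and m :: int
  proof -
    have "(of_int m + s) / 3 ^ k \<le> y \<longleftrightarrow> of_int m + s \<le> 3 ^ k * y"
      by (simp add: pos_divide_le_eq mult.commute)
    moreover have "y < (of_int m + s) / 3 ^ k + 1 / 3 ^ k \<longleftrightarrow> 3 ^ k * y < of_int m + s + 1"
      unfolding add_divide_distrib[symmetric] by (simp add: pos_less_divide_eq mult.commute)
    ultimately show ?thesis unfolding floor_eq_iff by linarith
  qed
  then show ?thesis
    by (auto simp: grid_cell_def half_open_cube_def grid_corner_def)
qed

text \<open>Ternary grids stay nested when shifted by half a cell, which fails for dyadic grids.\<close>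

lemma grid_cell_Suc_subset: "grid_cell \<sigma> (Suc k) x \<subseteq> grid_cell \<sigma> k x"
proof
  fix y assume y: "y \<in> grid_cell \<sigma> (Suc k) x"
  \<comment> \<open>Half a cell of level \<open>k\<close> is one and a half cells of level
    \<open>Suc k\<close>, so up to a shift by a whole cell the coarse index is the fine one divided
    by 3.\<close>
  have *: "\<lfloor>3 ^ k * t - of_bool b / 2\<rfloor> = (\<lfloor>3 ^ Suc k * t - of_bool b / 2\<rfloor> - of_bool b) div 3"
    for t :: real and b :: bool
  proof -
    have "3 * (3 ^ k * t - of_bool b / 2) = (3 ^ Suc k * t - of_bool b / 2) - of_int (of_bool b)"
      by (cases b) simp_all
    then have "\<lfloor>3 ^ Suc k * t - of_bool b / 2\<rfloor> - of_bool b = \<lfloor>3 * (3 ^ k * t - of_bool b / 2)\<rfloor>"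
      by (simp only: floor_diff_of_int)
    moreover have "\<lfloor>v\<rfloor> = \<lfloor>3 * v\<rfloor> div 3" for v :: real
      using floor_divide_real_eq_div[of 3 "3 * v"] by simp
    ultimately show ?thesis by metis
  qed
  show "y \<in> grid_cell \<sigma> k x"
    using y unfolding grid_cell_def * by simp
qed

lemma grid_cell_antimono: "k \<le> l \<Longrightarrow> grid_cell \<sigma> l x \<subseteq> grid_cell \<sigma> k x"
proof (induction rule: dec_induct)
  case (step m)
  then show ?case using grid_cell_Suc_subset[of \<sigma> m x] by blast
qed simp

lemma grid_cell_cong: "y \<in> grid_cell \<sigma> k x \<Longrightarrow> grid_cell \<sigma> k y = grid_cell \<sigma> k x"
  by (simp only: grid_cell_def mem_Collect_eq)

text \<open>In each coordinate the faces of the unshifted and of the shifted grid alternate at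
  distance half a cell, so every point is at least a quarter of a cell away from one of the two
  kinds of faces.\<close>

lemma ex_grid_cell_contains_cball:
  fixes x :: "real ^ 'n::finite"
  shows "\<exists>\<sigma>. cball x (1 / 3 ^ k / 4) \<subseteq> grid_cell \<sigma> k x"
proof -
  define \<sigma> where "\<sigma> = (\<lambda>j. \<not> (1/4 \<le> frac (3 ^ k * x $ j) \<and> frac (3 ^ k * x $ j) < 3/4))"
  have "y \<in> grid_cell \<sigma> k x" if y: "y \<in> cball x (1 / 3 ^ k / 4)" for y
    unfolding grid_cell_def
  proof (clarify)
    fix j
    have "\<bar>(x - y) $ j\<bar> \<le> 1 / 3 ^ k / 4"
      using y component_le_norm_cart[of "x - y" j] by (simp add: dist_norm)
    then have "\<bar>x $ j - y $ j\<bar> \<le> (1 / 4) / 3 ^ k"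
      by simp
    then have "3 ^ k * \<bar>x $ j - y $ j\<bar> \<le> 1 / 4"
      by (simp only: pos_le_divide_eq[of "3 ^ k :: real"] zero_less_power zero_less_numeral mult.commute)
    then have d: "\<bar>3 ^ k * x $ j - 3 ^ k * y $ j\<bar> \<le> 1 / 4"
      unfolding right_diff_distrib[symmetric] abs_mult by simp
    have f: "3 ^ k * x $ j = of_int \<lfloor>3 ^ k * x $ j\<rfloor> + frac (3 ^ k * x $ j)"
      by (simp add: frac_def)
    have f': "0 \<le> frac (3 ^ k * x $ j)" "frac (3 ^ k * x $ j) < 1"
      by (rule frac_ge_0, rule frac_lt_1)
    have floors: "\<lfloor>v\<rfloor> = \<lfloor>w\<rfloor>" if "of_int m \<le> v" "v < of_int m + 1" "of_int m \<le> w" "w < of_int m + 1"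
      for m :: int and v w :: real
      using floor_unique[OF that(1,2)] floor_unique[OF that(3,4)] by (rule trans[OF _ sym])
    consider "\<not> \<sigma> j" | "\<sigma> j" "frac (3 ^ k * x $ j) < 1/4" | "\<sigma> j" "frac (3 ^ k * x $ j) \<ge> 3/4"
      unfolding \<sigma>_def by linarith
    then show "\<lfloor>3 ^ k * y $ j - of_bool (\<sigma> j) / 2\<rfloor> = \<lfloor>3 ^ k * x $ j - of_bool (\<sigma> j) / 2\<rfloor>"
    proof cases
      case 1
      then have fr: "1/4 \<le> frac (3 ^ k * x $ j)" "frac (3 ^ k * x $ j) < 3/4"
        by (auto simp: \<sigma>_def)
      from 1 have ob: "of_bool (\<sigma> j) = (0 :: real)" by simp
      show ?thesis
        unfolding ob
        by (rule floors[of "\<lfloor>3 ^ k * x $ j\<rfloor>"]; use fr f f' d in linarith)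
    next
      case 2
      from 2(1) have ob: "of_bool (\<sigma> j) = (1 :: real)" by simp
      show ?thesis
        unfolding ob
        by (rule floors[of "\<lfloor>3 ^ k * x $ j\<rfloor> - 1"]; unfold of_int_diff of_int_1; use 2(2) f f' d in linarith)
    next
      case 3
      from 3(1) have ob: "of_bool (\<sigma> j) = (1 :: real)" by simp
      show ?thesis
        unfolding ob
        by (rule floors[of "\<lfloor>3 ^ k * x $ j\<rfloor>"]; use 3(2) f f' d in linarith)
    qed
  qed
  then have "cball x (1 / 3 ^ k / 4) \<subseteq> grid_cell \<sigma> k x" by (rule subsetI)
  then show ?thesis by (rule exI[of _ \<sigma>])
qed

text \<open>Cells of one grid with a common point are nested. An irredundant cover thus has at most
  one cell through a given point for each of the \<open>2 ^ CARD('n)\<close> shifts, however the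
  scales prescribed by \<open>P\<close> vary. This does the work of a Besicovitch covering
  theorem.\<close>

lemma bounded_overlap_cube_cover:
  fixes X :: "(real ^ 'n::finite) set" and P :: "real ^ 'n \<Rightarrow> nat \<Rightarrow> bool"
  assumes "compact X" and "\<And>x. x \<in> X \<Longrightarrow> \<exists>k. P x k"
  obtains D and c :: "(real ^ 'n) \<times> nat \<Rightarrow> real ^ 'n" where
    "finite D" "\<And>i. i \<in> D \<Longrightarrow> fst i \<in> X \<and> P (fst i) (snd i)"
    "\<And>i. i \<in> D \<Longrightarrow> cball (fst i) (1 / 3 ^ snd i / 4) \<subseteq> half_open_cube (c i) (1 / 3 ^ snd i)"
    "X \<subseteq> (\<Union>i\<in>D. half_open_cube (c i) (1 / 3 ^ snd i))"
    "\<And>y. card {i \<in> D. y \<in> half_open_cube (c i) (1 / 3 ^ snd i)} \<le> 2 ^ CARD('n)"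
proof -
  define \<sigma> :: "(real ^ 'n) \<times> nat \<Rightarrow> 'n \<Rightarrow> bool" where
    "\<sigma> = (\<lambda>i. SOME s. cball (fst i) (1 / 3 ^ snd i / 4) \<subseteq> grid_cell s (snd i) (fst i))"
  have \<sigma>: "cball (fst i) (1 / 3 ^ snd i / 4) \<subseteq> grid_cell (\<sigma> i) (snd i) (fst i)" for i
    unfolding \<sigma>_def by (rule someI_ex[OF ex_grid_cell_contains_cball])
  define Q where "Q = (\<lambda>i. grid_cell (\<sigma> i) (snd i) (fst i))"
  define \<kappa> where "\<kappa> = (\<lambda>x. SOME k. P x k)"
  have \<kappa>: "P x (\<kappa> x)" if "x \<in> X" for x
    unfolding \<kappa>_def using assms(2)[OF that] by (rule someI_ex)
  have "X \<subseteq> (\<Union>x\<in>X. ball x (1 / 3 ^ \<kappa> x / 4))"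
  proof
    fix x assume "x \<in> X"
    then show "x \<in> (\<Union>x\<in>X. ball x (1 / 3 ^ \<kappa> x / 4))" by (intro UN_I[of x]) auto
  qed
  then obtain T where T: "T \<subseteq> X" "finite T" "X \<subseteq> (\<Union>x\<in>T. ball x (1 / 3 ^ \<kappa> x / 4))"
    by (rule compactE_image[OF assms(1) open_ball])
  define D0 where "D0 = (\<lambda>x. (x, \<kappa> x)) ` T"
  have D0: "finite D0" "X \<subseteq> (\<Union>i\<in>D0. Q i)"
  proof -
    show "finite D0" using T by (simp add: D0_def)
    have "ball x (1 / 3 ^ \<kappa> x / 4) \<subseteq> Q (x, \<kappa> x)" for x
      using order_trans[OF ball_subset_cball \<sigma>[of "(x, \<kappa> x)", unfolded fst_conv snd_conv]]
      by (simp add: Q_def)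
    then have "(\<Union>x\<in>T. ball x (1 / 3 ^ \<kappa> x / 4)) \<subseteq> (\<Union>x\<in>T. Q (x, \<kappa> x))" by (intro UN_mono) auto
    then show "X \<subseteq> (\<Union>i\<in>D0. Q i)" using T(3) by (simp add: D0_def)
  qed
  \<comment> \<open>In a subcover of least cardinality no cell of one grid contains another cell of that grid.\<close>
  define \<D> where "\<D> = {D. D \<subseteq> D0 \<and> X \<subseteq> (\<Union>i\<in>D. Q i)}"
  have "D0 \<in> \<D>" using D0 by (auto simp: \<D>_def)
  then obtain D where D: "D \<in> \<D>" and min: "\<And>D'. D' \<in> \<D> \<Longrightarrow> card D \<le> card D'"
    using ex_has_least_nat[of "\<lambda>D. D \<in> \<D>" D0 card] that by metis
  have fD: "finite D" using D D0(1) by (auto simp: \<D>_def intro: finite_subset)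
  have overlap: "card {i \<in> D. y \<in> Q i} \<le> 2 ^ CARD('n)" for y
  proof -
    have "inj_on \<sigma> {i \<in> D. y \<in> Q i}"
    proof (rule inj_onI, rule ccontr)
      fix i j assume ij: "i \<in> {i \<in> D. y \<in> Q i}" "j \<in> {i \<in> D. y \<in> Q i}" "\<sigma> i = \<sigma> j" "i \<noteq> j"
      have key: False if "i \<in> D" "j \<in> D" "y \<in> Q i" "y \<in> Q j" "\<sigma> i = \<sigma> j" "i \<noteq> j" "snd i \<le> snd j" for i j
      proof -
        have "Q j = grid_cell (\<sigma> i) (snd j) y" "Q i = grid_cell (\<sigma> i) (snd i) y"
          using grid_cell_cong[of y "\<sigma> j" "snd j" "fst j"] grid_cell_cong[of y "\<sigma> i" "snd i" "fst i"] that
          by (simp_all add: Q_def)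
        then have sub: "Q j \<subseteq> Q i" using grid_cell_antimono[OF that(7)] by simp
        have "X \<subseteq> (\<Union>i\<in>D - {j}. Q i)"
        proof
          fix z assume "z \<in> X"
          then obtain l where l: "l \<in> D" "z \<in> Q l" using D by (auto simp: \<D>_def)
          then show "z \<in> (\<Union>i\<in>D - {j}. Q i)" using sub that by (cases "l = j") auto
        qed
        then have "D - {j} \<in> \<D>" using D by (auto simp: \<D>_def)
        moreover have "card (D - {j}) < card D"
          using fD that(2) by (rule card_Diff1_less)
        ultimately show False using min[of "D - {j}"] by simp
      qed
      show False
      proof (cases "snd i \<le> snd j")
        case True
        then show False using key[of i j] ij by simp
      next
        case False
        then show False using key[of j i] ij by simp
      qed
    qed
    then have "card {i \<in> D. y \<in> Q i} \<le> card (UNIV :: ('n \<Rightarrow> bool) set)"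
      by (rule card_inj_on_le) auto
    also have "\<dots> = 2 ^ CARD('n)" by (simp add: card_fun)
    finally show ?thesis .
  qed
  define c where "c = (\<lambda>i. grid_corner (\<sigma> i) (snd i) (fst i))"
  have Q: "half_open_cube (c i) (1 / 3 ^ snd i) = Q i" for i
    by (simp add: Q_def c_def grid_cell_eq_cube)
  show ?thesis
  proof (rule that[of D c, unfolded Q])
    show "fst i \<in> X \<and> P (fst i) (snd i)" if "i \<in> D" for i
    proof -
      from that D have "i \<in> D0" by (auto simp: \<D>_def)
      then obtain x where "x \<in> T" "i = (x, \<kappa> x)" by (auto simp: D0_def)
      then show ?thesis using T(1) \<kappa>[of x] by auto
    qed
    show "cball (fst i) (1 / 3 ^ snd i / 4) \<subseteq> Q i" for i
      using \<sigma>[of i] by (simp add: Q_def)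
    show "X \<subseteq> (\<Union>i\<in>D. Q i)"
      using D by (simp add: \<D>_def)
    show "card {i \<in> D. y \<in> Q i} \<le> 2 ^ CARD('n)" for y
      by (rule overlap)
  qed (rule fD)
qed

section \<open>A discrete Loewner estimate\<close>

text \<open>The segment from \<open>p\<close> to the point with coordinate 3 in direction \<open>i2\<close> and \<open>w j\<close> in direction \<open>j\<close>
  enters the slab \<open>c $ i2 \<le> y $ i2\<close> at the point of parameter \<open>(c $ i2 - p $ i2) / (3 - p $ i2)\<close>. It
  passes there through the corner \<open>c\<close> if \<open>w j\<close> is the value below. For cubes near \<open>p\<close> the junk value 0
  is good enough, since the bound on \<open>w\<close> then is trivial.\<close>

definition cone_center :: "'n \<Rightarrow> real ^ 'n \<Rightarrow> real ^ 'n \<Rightarrow> real \<Rightarrow> 'n::finite \<Rightarrow> real" where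
  "cone_center i2 p c r j =
     (if c $ i2 - p $ i2 \<le> r then 0 else p $ j + (3 - p $ i2) * (c $ j - p $ j) / (c $ i2 - p $ i2))"

text \<open>The endpoint has height 3 in direction \<open>i2\<close> and \<open>p\<close> has height
  at most 1, so the displacement in that direction lies between 2 and 4 and dominates that in any
  other. A cube at height \<open>h\<close> above \<open>p\<close> is therefore at distance of order
  \<open>h\<close>, and meeting it determines each free coordinate of \<open>w\<close> up to order
  \<open>r / h\<close>.\<close>

lemma segment_meets_cube:
  fixes p c w :: "real ^ 'n::finite"
  assumes "i1 \<noteq> i2" "\<And>j. \<bar>p $ j\<bar> \<le> 1" "\<And>j. \<bar>w $ j\<bar> \<le> 1" "0 < r"
    and "y \<in> closed_segment p (\<chi> j. if j = i1 then p $ i1 else if j = i2 then 3 else w $ j)"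
    and "y \<in> half_open_cube c r"
  defines "h \<equiv> max r (c $ i2 - p $ i2)"
  shows "\<bar>c $ j - p $ j\<bar> \<le> 3 * h"
    and "j \<noteq> i1 \<Longrightarrow> j \<noteq> i2 \<Longrightarrow> \<bar>w $ j - cone_center i2 p c r j\<bar> \<le> 6 * r / h"
proof -
  define z where "z = (\<chi> j. if j = i1 then p $ i1 else if j = i2 then 3 else w $ j)"
  obtain t where t: "0 \<le> t" "t \<le> 1" "y = (1 - t) *\<^sub>R p + t *\<^sub>R z"
    using assms(5) unfolding z_def[symmetric] closed_segment_def by blast
  have y: "y $ j = p $ j + t * (z $ j - p $ j)" for j
    unfolding t(3) by (simp add: algebra_simps)
  have Q: "c $ j \<le> y $ j" "y $ j < c $ j + r" for j
    using assms(6) by (auto simp: half_open_cube_def)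
  define D where "D = 3 - p $ i2"
  have D: "2 \<le> D" "D \<le> 4" using assms(2)[of i2] by (auto simp: D_def)
  have yi2: "y $ i2 = p $ i2 + t * D" using y[of i2] assms(1) by (simp add: z_def D_def)
  have h: "r \<le> h" "c $ i2 - p $ i2 \<le> h" by (auto simp: h_def)
  have tD: "t * D < 2 * h" using yi2 Q[of i2] h by linarith
  have "2 * t \<le> t * D" using mult_left_mono[OF D(1) t(1)] by (simp add: mult.commute)
  have "\<bar>y $ j - p $ j\<bar> \<le> 2 * h" for j
  proof -
    have "\<bar>z $ j - p $ j\<bar> \<le> D"
    proof (cases "j = i1 \<or> j = i2")
      case True
      then show ?thesis using D by (auto simp: z_def D_def)
    next
      case False
      then have "z $ j = w $ j" by (simp add: z_def)
      then show ?thesis using assms(2)[of j] assms(3)[of j] D by linarith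
    qed
    then have "t * \<bar>z $ j - p $ j\<bar> \<le> t * D" using t by (simp add: mult_left_mono)
    then show ?thesis using y[of j] t tD by (simp add: abs_mult)
  qed
  from this[of j] show "\<bar>c $ j - p $ j\<bar> \<le> 3 * h" using Q[of j] h by linarith
  assume j: "j \<noteq> i1" "j \<noteq> i2"
  show "\<bar>w $ j - cone_center i2 p c r j\<bar> \<le> 6 * r / h"
  proof (cases "c $ i2 - p $ i2 \<le> r")
    case True
    then have "h = r" by (simp add: h_def)
    then show ?thesis using True assms(3)[of j] assms(4) by (simp add: cone_center_def)
  next
    case False
    then have hh: "h = c $ i2 - p $ i2" by (simp add: h_def)
    have h0: "0 < h" using assms(4) h by linarith
    define v where "v = w $ j - p $ j"
    have v: "\<bar>v\<bar> \<le> 2" using assms(2)[of j] assms(3)[of j] by (simp add: v_def)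
    have yj: "y $ j = p $ j + t * v" using y[of j] j by (simp add: z_def v_def)
    define \<delta> where "\<delta> = y $ j - c $ j"
    have \<delta>: "0 \<le> \<delta>" "\<delta> < r" using Q[of j] by (auto simp: \<delta>_def)
    have td: "0 \<le> t * D - h" "t * D - h \<le> r" using Q[of i2] yi2 hh by auto
    \<comment> \<open>Both sides vanish for the segment through the corner \<open>c\<close>. The
      deviations \<open>\<delta>\<close> and \<open>t * D - h\<close> within the cube are at most
      \<open>r\<close>, and the bounds 4 on \<open>D\<close> and 2 on \<open>v\<close> add up to
      6.\<close>
    have e: "h * v - D * (c $ j - p $ j) = D * \<delta> - (t * D - h) * v"
      using yj by (simp add: \<delta>_def algebra_simps)
    have "\<bar>D * \<delta>\<bar> \<le> 4 * r" using D \<delta> by (simp add: abs_mult mult_mono)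
    moreover have "\<bar>(t * D - h) * v\<bar> \<le> r * 2"
      unfolding abs_mult using td v by (intro mult_mono) auto
    ultimately have "\<bar>h * v - D * (c $ j - p $ j)\<bar> \<le> 6 * r" unfolding e by linarith
    moreover have "w $ j - cone_center i2 p c r j = (h * v - D * (c $ j - p $ j)) / h"
      using False h0 by (simp add: cone_center_def v_def D_def hh[symmetric] diff_divide_distrib)
    ultimately show ?thesis using h0 by (simp add: abs_divide divide_right_mono)
  qed
qed

text \<open>A box containing all endpoints \<open>w\<close> in \<open>cbox (-1) 1\<close> whose
  segment from \<open>p\<close> meets the cube. The coordinates \<open>i1\<close> and
  \<open>i2\<close> of \<open>w\<close> do not enter the endpoint of the segment, so only
  \<open>CARD('n) - 2\<close> coordinates are restricted.\<close>

definition cone_box :: "'n \<Rightarrow> 'n \<Rightarrow> real ^ 'n \<Rightarrow> real ^ 'n \<Rightarrow> real \<Rightarrow> (real ^ 'n::finite) set" where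
  "cone_box i1 i2 p c r = (let \<eta> = 6 * r / max r (c $ i2 - p $ i2) in
     cbox (\<chi> j. if j = i1 \<or> j = i2 then -1 else cone_center i2 p c r j - \<eta>)
          (\<chi> j. if j = i1 \<or> j = i2 then 1 else cone_center i2 p c r j + \<eta>))"

lemma lmeasurable_cone_box: "cone_box i1 i2 p c r \<in> lmeasurable"
  by (simp add: cone_box_def Let_def)

lemma measure_cone_box:
  fixes i1 i2 :: "'n::finite"
  assumes "i1 \<noteq> i2" "0 < r"
  shows "measure lebesgue (cone_box i1 i2 p c r)
    = 4 * (12 * r / max r (c $ i2 - p $ i2)) ^ (CARD('n) - 2)"
proof -
  define \<eta> where "\<eta> = 6 * r / max r (c $ i2 - p $ i2)"
  define lo where "lo = (\<chi> j::'n. if j = i1 \<or> j = i2 then -1 else cone_center i2 p c r j - \<eta>)"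
  define hi where "hi = (\<chi> j::'n. if j = i1 \<or> j = i2 then 1 else cone_center i2 p c r j + \<eta>)"
  have \<eta>: "0 \<le> \<eta>" using assms(2) by (simp add: \<eta>_def)
  have ne: "cbox lo hi \<noteq> {}"
    using \<eta> by (auto simp: interval_ne_empty_cart lo_def hi_def)
  have "measure lebesgue (cone_box i1 i2 p c r) = measure lebesgue (cbox lo hi)"
    by (simp only: cone_box_def Let_def lo_def hi_def \<eta>_def)
  also have "\<dots> = (\<Prod>j\<in>UNIV. hi $ j - lo $ j)"
    using content_cbox_cart[OF ne] by simp
  also have "\<dots> = (\<Prod>j\<in>UNIV. if j \<in> {i1, i2} then 2 else 2 * \<eta>)"
    by (intro prod.cong) (auto simp: lo_def hi_def)
  also have "\<dots> = (\<Prod>j\<in>UNIV - {i1, i2}. if j \<in> {i1, i2} then 2 else 2 * \<eta>)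
      * (\<Prod>j\<in>{i1, i2}. if j \<in> {i1, i2} then 2 else 2 * \<eta>)"
    by (rule prod.subset_diff) auto
  also have "(\<Prod>j\<in>UNIV - {i1, i2}. if j \<in> {i1, i2} then 2 else 2 * \<eta>) = (\<Prod>j\<in>UNIV - {i1, i2}. 2 * \<eta>)"
    by (intro prod.cong) auto
  also have "\<dots> = (2 * \<eta>) ^ (CARD('n) - 2)"
    using assms(1) by (simp add: card_Diff_subset numeral_2_eq_2 del: Diff_insert)
  also have "(\<Prod>j\<in>{i1, i2}. if j \<in> {i1, i2} then 2 else 2 * \<eta>) = 4"
    using assms(1) by simp
  finally show ?thesis by (simp add: \<eta>_def)
qed

text \<open>By the last hypothesis the height dominates every coordinate of \<open>c - p\<close>, so
  \<open>r + norm (c - p)\<close> is at most \<open>4 * CARD('n)\<close> times the height. This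
  trades the height for an isotropic distance.\<close>

lemma measure_cone_box_le:
  fixes p c :: "real ^ 'n::finite"
  assumes "i1 \<noteq> i2" "0 < r" and "\<And>j. \<bar>c $ j - p $ j\<bar> \<le> 3 * max r (c $ i2 - p $ i2)"
  shows "measure lebesgue (cone_box i1 i2 p c r)
    \<le> 4 * (48 * CARD('n)) ^ (CARD('n) - 2) * (r / (r + norm (c - p))) ^ (CARD('n) - 2)"
proof -
  define h where "h = max r (c $ i2 - p $ i2)"
  define \<rho> where "\<rho> = r + norm (c - p)"
  have h: "0 < h" "r \<le> h" using assms(2) by (auto simp: h_def)
  have n: "1 \<le> real CARD('n)" by (simp add: Suc_leI)
  have "norm (c - p) \<le> (\<Sum>j\<in>UNIV. \<bar>(c - p) $ j\<bar>)" by (rule norm_le_l1_cart)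
  also have "\<dots> \<le> (\<Sum>j\<in>(UNIV::'n set). 3 * h)"
    using assms(3) by (intro sum_mono) (simp add: h_def)
  finally have "norm (c - p) \<le> 3 * real CARD('n) * h" by (simp add: mult_ac)
  moreover have "h \<le> real CARD('n) * h" using n h by simp
  ultimately have "\<rho> \<le> 4 * real CARD('n) * h" using h unfolding \<rho>_def by linarith
  moreover have \<rho>: "0 < \<rho>" using assms(2) by (simp add: \<rho>_def add_pos_nonneg)
  ultimately have "r * \<rho> \<le> r * (4 * real CARD('n) * h)" using assms(2) by simp
  then have "12 * r / h \<le> 48 * real CARD('n) * (r / \<rho>)"
    using h \<rho> by (simp add: divide_simps mult.commute mult.left_commute)
  then have "(12 * r / h) ^ (CARD('n) - 2) \<le> (48 * real CARD('n) * (r / \<rho>)) ^ (CARD('n) - 2)"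
    using h assms(2) by (intro power_mono) auto
  then show ?thesis
    unfolding measure_cone_box[OF assms(1,2)] h_def[symmetric] \<rho>_def[symmetric] power_mult_distrib
    by (simp add: mult.assoc)
qed

text \<open>Twice \<open>8 * (48 * n) ^ (n - 2)\<close>, where 8 is the product of the 2 of
  \<open>oscillation_chain\<close> and the 4 of \<open>measure_cone_box_le\<close>.\<close>

definition path_const :: "nat \<Rightarrow> real" where
  "path_const n = 16 * (48 * n) ^ (n - 2)"

text \<open>A geometric series with ratio \<open>1 / root (n - 1) 2\<close> over dyadic shells, the
  outermost of radius \<open>6 * n\<close>; see \<open>sum_shells\<close>.\<close>

definition shell_const :: "nat \<Rightarrow> nat \<Rightarrow> real" where
  "shell_const n N = N * 8 ^ (n - 1) * root (n - 1) (6 * n) / (1 - 1 / root (n - 1) 2)"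

text \<open>What remains in \<open>slice_energy\<close> after the first part of Young's inequality
  is absorbed into the left-hand side. The \<open>+ 1\<close> makes the shell constant safe to
  divide by.\<close>

definition loewner_const :: "nat \<Rightarrow> nat \<Rightarrow> real" where
  "loewner_const n N =
     4 * path_const n * (4 * path_const n * (shell_const n N + 1)) ^ (n - 1)"

text \<open>The cube \<open>cbox (-3) 3\<close> leaves room for the endpoints at height 3 of
  segments that start in \<open>cbox (-1) 1\<close>. By \<open>meets\<close> and the bound on the
  sides, no cube is far from such segments.\<close>

locale cube_cover =
  fixes I :: "'i set" and c :: "'i \<Rightarrow> real ^ 'n::finite" and r :: "'i \<Rightarrow> real" and N :: nat
    and i1 i2 :: 'n
  assumes axes: "i1 \<noteq> i2"
    and finite_index: "finite I"
    and side: "\<And>i. i \<in> I \<Longrightarrow> 0 < r i \<and> r i \<le> 1"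
    and meets: "\<And>i. i \<in> I \<Longrightarrow> half_open_cube (c i) (r i) \<inter> cbox (-3) 3 \<noteq> {}"
    and cover: "cbox (-3) 3 \<subseteq> (\<Union>i\<in>I. half_open_cube (c i) (r i))"
    and overlap: "\<And>y. card {i \<in> I. y \<in> half_open_cube (c i) (r i)} \<le> N"
begin

section \<open>Sums over the cubes that meet one hyperplane\<close>

definition slice :: "real \<Rightarrow> 'i set" where
  "slice s = {i \<in> I. c i $ i1 \<le> s \<and> s < c i $ i1 + r i}"

text \<open>A distance from \<open>p\<close> that is never below the side, so that
  \<open>r i / \<rho> p i\<close> is at most 1 even for a cube that contains
  \<open>p\<close>.\<close>

definition \<rho> :: "real ^ 'n \<Rightarrow> 'i \<Rightarrow> real" where
  "\<rho> p i = r i + norm (c i - p)"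

lemma finite_slice: "finite (slice s)"
  using finite_index by (simp add: slice_def)

lemma \<rho>_bounds:
  assumes "i \<in> I" "p \<in> cbox (-1) 1"
  shows "0 < \<rho> p i" "r i \<le> \<rho> p i" "norm (c i - p) \<le> \<rho> p i" "\<rho> p i \<le> 6 * CARD('n)"
proof -
  show "0 < \<rho> p i" "r i \<le> \<rho> p i" "norm (c i - p) \<le> \<rho> p i"
    using side[OF assms(1)] by (auto simp: \<rho>_def add_pos_nonneg)
  obtain y where y: "y \<in> half_open_cube (c i) (r i)" "y \<in> cbox (-3) 3"
    using meets[OF assms(1)] by blast
  have "\<bar>(c i - p) $ j\<bar> \<le> 5" for j
  proof -
    have "c i $ j \<le> y $ j" "y $ j < c i $ j + r i" "\<bar>y $ j\<bar> \<le> 3"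
      using y by (auto simp: half_open_cube_def mem_box_cart abs_le_iff minus_le_iff)
    moreover have "\<bar>p $ j\<bar> \<le> 1"
      using assms(2) by (auto simp: mem_box_cart abs_le_iff minus_le_iff)
    ultimately show ?thesis using side[OF assms(1)] by (simp add: abs_le_iff)
  qed
  then have "(\<Sum>j\<in>UNIV. \<bar>(c i - p) $ j\<bar>) \<le> (\<Sum>j\<in>(UNIV::'n set). 5)"
    by (intro sum_mono) auto
  then have "norm (c i - p) \<le> 5 * CARD('n)"
    using norm_le_l1_cart[of "c i - p"] by simp
  moreover have "1 \<le> real CARD('n)" by (simp add: Suc_leI)
  ultimately show "\<rho> p i \<le> 6 * CARD('n)"
    using side[OF assms(1)] unfolding \<rho>_def by linarith
qed

text \<open>The hyperplane cuts each cube in a cube of one dimension less and the same side. These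
  sections overlap at most \<open>N\<close> times and lie in a cube of side \<open>4 * t\<close>
  around \<open>p\<close>.\<close>

lemma sum_volume_slice:
  fixes t :: real
  assumes "p \<in> cbox (-1) 1" "0 < t"
  shows "(\<Sum>i | i \<in> slice (p $ i1) \<and> \<rho> p i \<le> t. r i ^ (CARD('n) - 1)) \<le> N * (4 * t) ^ (CARD('n) - 1)"
proof -
  define J where "J = {i. i \<in> slice (p $ i1) \<and> \<rho> p i \<le> t}"
  have JI: "J \<subseteq> I" by (auto simp: J_def slice_def)
  then have "finite J" using finite_index by (rule finite_subset)
  \<comment> \<open>Direction \<open>i1\<close> is replaced by a unit interval, so that the
    full-dimensional measure of the box is the measure of the section.\<close>
  define lo where "lo = (\<lambda>i. \<chi> j. if j = i1 then 0 else c i $ j)"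
  define hi where "hi = (\<lambda>i. \<chi> j. if j = i1 then 1 else c i $ j + r i)"
  define LO where "LO = (\<chi> j. if j = i1 then 0 else p $ j - 2 * t)"
  define HI where "HI = (\<chi> j. if j = i1 then 1 else p $ j + 2 * t)"
  have prod_if: "(\<Prod>j\<in>UNIV. if j = i1 then 1 else v) = v ^ (CARD('n) - 1)" for v :: real
  proof -
    have "(\<Prod>j\<in>UNIV. if j = i1 then 1 else v) = (\<Prod>j\<in>UNIV - {i1}. if j = i1 then 1 else v)"
      by (subst prod.remove[of UNIV i1]) auto
    also have "\<dots> = (\<Prod>j\<in>UNIV - {i1}. v)" by (intro prod.cong) auto
    finally show ?thesis by simp
  qed
  have vol: "measure lebesgue (box (lo i) (hi i)) = r i ^ (CARD('n) - 1)" if "i \<in> J" for i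
  proof -
    have r: "0 < r i" using side[of i] that JI by auto
    then have ne: "cbox (lo i) (hi i) \<noteq> {}"
      by (auto simp: interval_ne_empty_cart lo_def hi_def)
    have "measure lebesgue (box (lo i) (hi i)) = measure lebesgue (cbox (lo i) (hi i))"
      by (simp add: measure_lborel_box_eq measure_lborel_cbox_eq)
    also have "\<dots> = (\<Prod>j\<in>UNIV. hi i $ j - lo i $ j)"
      using content_cbox_cart[OF ne] by simp
    also have "\<dots> = (\<Prod>j\<in>UNIV. if j = i1 then 1 else r i)"
      by (intro prod.cong) (auto simp: lo_def hi_def)
    finally show ?thesis by (simp only: prod_if)
  qed
  have VOL: "measure lebesgue (cbox LO HI) = (4 * t) ^ (CARD('n) - 1)"
  proof -
    have ne: "cbox LO HI \<noteq> {}"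
      using assms(2) by (auto simp: interval_ne_empty_cart LO_def HI_def)
    have "measure lebesgue (cbox LO HI) = (\<Prod>j\<in>UNIV. HI $ j - LO $ j)"
      using content_cbox_cart[OF ne] by simp
    also have "\<dots> = (\<Prod>j\<in>UNIV. if j = i1 then 1 else 4 * t)"
      by (intro prod.cong) (auto simp: LO_def HI_def)
    finally show ?thesis by (simp only: prod_if)
  qed
  have "(\<Sum>i\<in>J. measure lebesgue (box (lo i) (hi i))) \<le> real N * measure lebesgue (cbox LO HI)"
  proof (rule sum_measure_le_overlap)
    show "box (lo i) (hi i) \<subseteq> cbox LO HI" if "i \<in> J" for i
    proof
      fix y assume y: "y \<in> box (lo i) (hi i)"
      have b: "r i \<le> t" "norm (c i - p) \<le> t"
        using that \<rho>_bounds[of i p] assms(1) JI by (auto simp: J_def)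
      have "LO $ j \<le> y $ j \<and> y $ j \<le> HI $ j" for j
      proof -
        have "lo i $ j < y $ j" "y $ j < hi i $ j" using y by (auto simp: mem_box_cart)
        moreover have "\<bar>c i $ j - p $ j\<bar> \<le> t"
          using component_le_norm_cart[of "c i - p" j] b by simp
        ultimately show ?thesis using b by (cases "j = i1") (auto simp: LO_def HI_def lo_def hi_def)
      qed
      then show "y \<in> cbox LO HI" by (simp add: mem_box_cart)
    qed
    show "card {i \<in> J. y \<in> box (lo i) (hi i)} \<le> N" for y
    proof -
      \<comment> \<open>Moving the point back into the hyperplane reduces the overlap of the boxes
        to that of the cubes.\<close>
      define y' where "y' = (\<chi> j. if j = i1 then p $ i1 else y $ j)"
      have "{i \<in> J. y \<in> box (lo i) (hi i)} \<subseteq> {i \<in> I. y' \<in> half_open_cube (c i) (r i)}"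
      proof
        fix i assume "i \<in> {i \<in> J. y \<in> box (lo i) (hi i)}"
        then have i: "i \<in> J" "\<And>j. lo i $ j < y $ j" "\<And>j. y $ j < hi i $ j"
          by (auto simp: mem_box_cart)
        have "c i $ j \<le> y' $ j \<and> y' $ j < c i $ j + r i" for j
          using i(2,3)[of j] i(1) by (cases "j = i1") (auto simp: y'_def lo_def hi_def J_def slice_def)
        then show "i \<in> {i \<in> I. y' \<in> half_open_cube (c i) (r i)}"
          using i(1) JI by (auto simp: half_open_cube_def)
      qed
      from card_mono[OF _ this] have "card {i \<in> J. y \<in> box (lo i) (hi i)}
          \<le> card {i \<in> I. y' \<in> half_open_cube (c i) (r i)}"
        using finite_index by simp
      then show ?thesis using overlap[of y'] by linarith
    qed
  qed (use \<open>finite J\<close> in auto)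
  then show ?thesis using vol VOL by (simp add: J_def)
qed

text \<open>Without the root, each dyadic shell of \<open>\<rho>\<close> would contribute a bounded
  amount by \<open>sum_volume_slice\<close>. The root makes the contributions geometric, so the sum
  is bounded however small the cubes are.\<close>

lemma sum_shells:
  assumes "p \<in> cbox (-1) 1"
  shows "(\<Sum>i\<in>slice (p $ i1). (r i / \<rho> p i) ^ (CARD('n) - 1) * root (CARD('n) - 1) (\<rho> p i))
    \<le> shell_const (CARD('n)) N"
proof -
  define m where "m = CARD('n) - 1"
  have "card {i1, i2} \<le> CARD('n)" by (intro card_mono) auto
  then have m: "0 < m" using axes by (simp add: m_def)
  define T where "T = 6 * real CARD('n)"
  have T: "0 < T" by (simp add: T_def)
  define S where "S = slice (p $ i1)"
  have S: "finite S" "S \<subseteq> I" using finite_slice by (auto simp: S_def slice_def)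
  have rho: "0 < \<rho> p i" "\<rho> p i \<le> T" "0 < r i" if "i \<in> S" for i
    using \<rho>_bounds[of i p] that S assms side[of i] by (auto simp: T_def)
  have "\<exists>k. T / 2 ^ Suc k < \<rho> p i \<and> \<rho> p i \<le> T / 2 ^ k" if "i \<in> S" for i
  proof -
    obtain k0 :: nat where "T / \<rho> p i < 2 ^ k0"
      using real_arch_pow[of 2 "T / \<rho> p i"] by auto
    then have ex: "\<exists>k. T / 2 ^ k < \<rho> p i"
      using rho[OF that] by (auto simp: field_simps)
    define k where "k = (LEAST k. T / 2 ^ k < \<rho> p i)"
    have k: "T / 2 ^ k < \<rho> p i" unfolding k_def using ex by (rule LeastI_ex)
    moreover have "k \<noteq> 0" using k rho[OF that] by (cases k) auto
    ultimately obtain l where l: "k = Suc l" by (cases k) auto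
    have "\<not> T / 2 ^ l < \<rho> p i"
      using not_less_Least[of l "\<lambda>k. T / 2 ^ k < \<rho> p i"] l by (simp add: k_def[symmetric])
    then show ?thesis using k l by auto
  qed
  then obtain \<kappa> where \<kappa>: "\<And>i. i \<in> S \<Longrightarrow> T / 2 ^ Suc (\<kappa> i) < \<rho> p i \<and> \<rho> p i \<le> T / 2 ^ \<kappa> i"
    by metis
  define K where "K = Suc (Max (insert 0 (\<kappa> ` S)))"
  have K: "\<kappa> i < K" if "i \<in> S" for i
    using that S by (auto simp: K_def less_Suc_eq_le intro!: Max_ge)
  define g where "g = (\<lambda>k. (2 ^ Suc k / T) ^ m * root m (T / 2 ^ k))"
  have g0: "0 \<le> g k" for k unfolding g_def using T m by (intro mult_nonneg_nonneg) auto
  have "(\<Sum>i\<in>S. (r i / \<rho> p i) ^ m * root m (\<rho> p i))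
      \<le> (\<Sum>i\<in>S. \<Sum>k<K. if \<rho> p i \<le> T / 2 ^ k then g k * r i ^ m else 0)"
  proof (rule sum_mono)
    fix i assume i: "i \<in> S"
    have "r i / \<rho> p i \<le> r i * (2 ^ Suc (\<kappa> i) / T)"
      using \<kappa>[OF i] rho[OF i] T by (simp add: field_simps)
    then have "(r i / \<rho> p i) ^ m \<le> (r i * (2 ^ Suc (\<kappa> i) / T)) ^ m"
      using rho[OF i] by (intro power_mono) auto
    moreover have "root m (\<rho> p i) \<le> root m (T / 2 ^ \<kappa> i)"
      using \<kappa>[OF i] m by (simp add: real_root_le_mono)
    ultimately have "(r i / \<rho> p i) ^ m * root m (\<rho> p i)
        \<le> (r i * (2 ^ Suc (\<kappa> i) / T)) ^ m * root m (T / 2 ^ \<kappa> i)"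
      using rho[OF i] T m by (intro mult_mono) auto
    also have "\<dots> = (if \<rho> p i \<le> T / 2 ^ \<kappa> i then g (\<kappa> i) * r i ^ m else 0)"
    proof -
      have "(r i * (2 ^ Suc (\<kappa> i) / T)) ^ m = (2 ^ Suc (\<kappa> i) / T) ^ m * r i ^ m"
        by (simp only: power_mult_distrib mult.commute)
      then show ?thesis using \<kappa>[OF i] by (simp add: g_def)
    qed
    also have "\<dots> \<le> (\<Sum>k<K. if \<rho> p i \<le> T / 2 ^ k then g k * r i ^ m else 0)"
      using K[OF i] g0 rho[OF i] by (intro member_le_sum) auto
    finally show "(r i / \<rho> p i) ^ m * root m (\<rho> p i)
        \<le> (\<Sum>k<K. if \<rho> p i \<le> T / 2 ^ k then g k * r i ^ m else 0)" .
  qed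
  also have "\<dots> = (\<Sum>k<K. \<Sum>i\<in>S. if \<rho> p i \<le> T / 2 ^ k then g k * r i ^ m else 0)"
    by (rule sum.swap)
  also have "\<dots> = (\<Sum>k<K. g k * (\<Sum>i | i \<in> S \<and> \<rho> p i \<le> T / 2 ^ k. r i ^ m))"
    by (intro sum.cong refl, subst sum_distrib_left, subst sum.inter_filter[OF S(1)]) (rule refl)
  also have "\<dots> \<le> (\<Sum>k<K. g k * (N * (4 * (T / 2 ^ k)) ^ m))"
  proof (intro sum_mono mult_left_mono g0)
    fix k
    show "(\<Sum>i | i \<in> S \<and> \<rho> p i \<le> T / 2 ^ k. r i ^ m) \<le> N * (4 * (T / 2 ^ k)) ^ m"
      unfolding S_def m_def by (rule sum_volume_slice[OF assms]) (use T in simp)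
  qed
  also have "\<dots> = (\<Sum>k<K. real N * 8 ^ m * root m T * (1 / root m 2) ^ k)"
  proof (rule sum.cong)
    fix k
    have "(2 ^ Suc k / T) ^ m * (4 * (T / 2 ^ k)) ^ m = ((2 ^ Suc k / T) * (4 * (T / 2 ^ k))) ^ m"
      by (simp only: power_mult_distrib)
    also have "(2 ^ Suc k / T) * (4 * (T / 2 ^ k)) = 8" using T by simp
    finally have e: "(2 ^ Suc k / T) ^ m * (4 * (T / 2 ^ k)) ^ m = 8 ^ m" .
    have "root m (T / 2 ^ k) = root m T * (1 / root m 2) ^ k"
      using m by (simp add: real_root_divide real_root_power power_divide)
    then show "g k * (N * (4 * (T / 2 ^ k)) ^ m) = real N * 8 ^ m * root m T * (1 / root m 2) ^ k"
      unfolding g_def e[symmetric] by (simp only: mult_ac)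
  qed simp
  also have "\<dots> = real N * 8 ^ m * root m T * (\<Sum>k<K. (1 / root m 2) ^ k)"
    by (simp only: sum_distrib_left)
  also have "\<dots> \<le> real N * 8 ^ m * root m T * (1 / (1 - 1 / root m 2))"
  proof (rule mult_left_mono)
    have q: "0 < 1 / root m 2" "1 / root m 2 < 1" using m by auto
    then have "(\<Sum>k<K. (1 / root m 2) ^ k) = (1 - (1 / root m 2) ^ K) / (1 - 1 / root m 2)"
      using sum_gp_strict[of "1 / root m 2" K] by simp
    also have "\<dots> \<le> 1 / (1 - 1 / root m 2)"
      using q by (intro divide_right_mono) auto
    finally show "(\<Sum>k<K. (1 / root m 2) ^ k) \<le> 1 / (1 - 1 / root m 2)" .
    show "0 \<le> real N * 8 ^ m * root m T" using T m by simp
  qed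
  finally show ?thesis by (simp add: shell_const_def m_def T_def S_def)
qed

end

locale cube_cover_oscillation = cube_cover I c r N i1 i2
  for I :: "'i set" and c :: "'i \<Rightarrow> real ^ 'n::finite" and r :: "'i \<Rightarrow> real" and N :: nat
    and i1 i2 :: 'n +
  fixes u :: "real ^ 'n \<Rightarrow> real" and a :: "'i \<Rightarrow> real"
  assumes cont: "continuous_on (cbox (-3) 3) u"
    and osc: "\<And>i z z'. i \<in> I \<Longrightarrow> z \<in> half_open_cube (c i) (r i) \<inter> cbox (-3) 3 \<Longrightarrow>
      z' \<in> half_open_cube (c i) (r i) \<inter> cbox (-3) 3 \<Longrightarrow> \<bar>u z - u z'\<bar> \<le> a i"
begin

section \<open>Paths joining two points of a hyperplane\<close>

lemma osc_nonneg: "i \<in> I \<Longrightarrow> 0 \<le> a i"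
  using osc[of i] meets[of i] by fastforce

text \<open>Two segments join \<open>p\<close> and \<open>q\<close> through a common point
  \<open>z w\<close> of their hyperplane. On averaging over \<open>w\<close>, the oscillation of a
  cube is weighted by the share of the \<open>w\<close> whose segment meets it, which is of order
  \<open>(r / \<rho>) ^ (CARD('n) - 2)\<close>.\<close>

lemma path_bound:
  assumes "p \<in> cbox (-1) 1" "q \<in> cbox (-1) 1" "p $ i1 = q $ i1"
  shows "\<bar>u p - u q\<bar> \<le> path_const (CARD('n)) * (\<Sum>i\<in>slice (p $ i1).
    a i * (r i / \<rho> p i) ^ (CARD('n) - 2) + a i * (r i / \<rho> q i) ^ (CARD('n) - 2))"
proof -
  define S where "S = slice (p $ i1)"
  define P where "P = (\<lambda>b. if b then p else q)"
  have P: "P b \<in> cbox (-1) 1" "P b $ i1 = p $ i1" for b using assms by (auto simp: P_def)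
  have P1: "\<bar>P b $ j\<bar> \<le> 1" for b j
    using P(1)[of b] by (auto simp: mem_box_cart abs_le_iff minus_le_iff)
  define z where "z = (\<lambda>w::real ^ 'n. \<chi> j. if j = i1 then p $ i1 else if j = i2 then 3 else w $ j)"
  define hh where "hh = (\<lambda>b i. max (r i) (c i $ i2 - P b $ i2))"
  \<comment> \<open>The flag tells from which of the two points the segment starts. The condition
    holds for every cube met by such a segment and is what \<open>measure_cone_box_le\<close>
    requires.\<close>
  define J where "J = {(i, b). i \<in> S \<and> (\<forall>j. \<bar>c i $ j - P b $ j\<bar> \<le> 3 * hh b i)}"
  define W where "W = (cbox (-1) 1 :: (real ^ 'n) set)"
  have SI: "S \<subseteq> I" "finite S" using finite_slice by (auto simp: S_def slice_def)
  have JS: "J \<subseteq> S \<times> UNIV" by (auto simp: J_def)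
  have fJ: "finite J" using finite_subset[OF JS] SI(2) by simp
  have step: "\<bar>u (P b) - u (z w)\<bar> \<le> 2 * (\<Sum>i | (i, b) \<in> J \<and> w \<in> cone_box i1 i2 (P b) (c i) (r i). a i)"
    if w: "w \<in> W" for w b
  proof -
    define \<gamma> where "\<gamma> = closed_segment (P b) (z w)"
    have w1: "\<bar>w $ j\<bar> \<le> 1" for j
      using w by (auto simp: W_def mem_box_cart abs_le_iff minus_le_iff)
    have zw: "z w = (\<chi> j. if j = i1 then P b $ i1 else if j = i2 then 3 else w $ j)"
      by (simp only: z_def P(2))
    have "\<bar>z w $ j\<bar> \<le> 3" for j
      using w1[of j] P1[of b i1] by (auto simp: zw)
    then have "z w \<in> cbox (-3) 3" by (simp add: mem_box_cart abs_le_iff minus_le_iff)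
    moreover have "P b \<in> cbox (-3) 3"
      unfolding mem_box_cart
    proof
      fix j show "(- 3) $ j \<le> P b $ j \<and> P b $ j \<le> 3 $ j" using P1[of b j] by (simp add: abs_le_iff)
    qed
    ultimately have sub: "\<gamma> \<subseteq> cbox (-3) 3"
      unfolding \<gamma>_def by (intro closed_segment_subset convex_box) auto
    have "\<bar>u (P b) - u (z w)\<bar> \<le> 2 * (\<Sum>i | i \<in> I \<and> half_open_cube (c i) (r i) \<inter> \<gamma> \<noteq> {}. a i)"
    proof (rule oscillation_chain[OF finite_index])
      show "connected \<gamma>" "P b \<in> \<gamma>" "z w \<in> \<gamma>" by (auto simp: \<gamma>_def)
      show "continuous_on \<gamma> u" using cont sub by (rule continuous_on_subset)
      show "\<gamma> \<subseteq> (\<Union>i\<in>I. half_open_cube (c i) (r i))" using sub cover by (rule order_trans)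
      show "\<bar>u x - u y\<bar> \<le> a i" if "i \<in> I" "x \<in> half_open_cube (c i) (r i) \<inter> \<gamma>"
        "y \<in> half_open_cube (c i) (r i) \<inter> \<gamma>" for i x y
        using osc[of i x y] that sub by blast
    qed
    also have "(\<Sum>i | i \<in> I \<and> half_open_cube (c i) (r i) \<inter> \<gamma> \<noteq> {}. a i)
        \<le> (\<Sum>i | (i, b) \<in> J \<and> w \<in> cone_box i1 i2 (P b) (c i) (r i). a i)"
    proof (rule sum_mono2)
      show "finite {i. (i, b) \<in> J \<and> w \<in> cone_box i1 i2 (P b) (c i) (r i)}"
        by (rule finite_subset[OF _ SI(2)]) (auto simp: J_def)
      show "{i \<in> I. half_open_cube (c i) (r i) \<inter> \<gamma> \<noteq> {}}
          \<subseteq> {i. (i, b) \<in> J \<and> w \<in> cone_box i1 i2 (P b) (c i) (r i)}"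
      proof
        fix i assume "i \<in> {i \<in> I. half_open_cube (c i) (r i) \<inter> \<gamma> \<noteq> {}}"
        then obtain y where i: "i \<in> I" and y: "y \<in> half_open_cube (c i) (r i)" "y \<in> \<gamma>" by blast
        have ri: "0 < r i" using side[OF i] by simp
        note seg = segment_meets_cube[of i1 i2 "P b" w "r i" y "c i", OF axes P1 w1 ri y(2)[unfolded \<gamma>_def zw] y(1)]
        obtain t where "y = (1 - t) *\<^sub>R P b + t *\<^sub>R z w"
          using y(2) unfolding \<gamma>_def closed_segment_def by blast
        then have "y $ i1 = (1 - t) * P b $ i1 + t * z w $ i1" by simp
        also have "\<dots> = p $ i1" by (simp add: zw P(2) algebra_simps)
        finally have y1: "y $ i1 = p $ i1" .
        have "c i $ i1 \<le> y $ i1 \<and> y $ i1 < c i $ i1 + r i"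
          using y(1) by (simp add: half_open_cube_def)
        then have "i \<in> S"
          using i by (simp add: y1 S_def slice_def)
        then have "(i, b) \<in> J" using seg(1) by (simp add: J_def hh_def)
        moreover have "w \<in> cone_box i1 i2 (P b) (c i) (r i)"
          unfolding cone_box_def Let_def mem_box_cart
        proof
          fix j
          show "(\<chi> j. if j = i1 \<or> j = i2 then - 1
                 else cone_center i2 (P b) (c i) (r i) j - 6 * r i / max (r i) (c i $ i2 - P b $ i2)) $ j
              \<le> w $ j \<and>
              w $ j \<le> (\<chi> j. if j = i1 \<or> j = i2 then 1
                 else cone_center i2 (P b) (c i) (r i) j + 6 * r i / max (r i) (c i $ i2 - P b $ i2)) $ j"
            using w1[of j] seg(2)[of j] by (auto simp: abs_le_iff)
        qed
        ultimately show "i \<in> {i. (i, b) \<in> J \<and> w \<in> cone_box i1 i2 (P b) (c i) (r i)}" by simp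
      qed
      show "0 \<le> a i" if "i \<in> {i. (i, b) \<in> J \<and> w \<in> cone_box i1 i2 (P b) (c i) (r i)}
          - {i \<in> I. half_open_cube (c i) (r i) \<inter> \<gamma> \<noteq> {}}" for i
        using that SI osc_nonneg by (auto simp: J_def)
    qed
    finally show ?thesis by simp
  qed
  have "\<bar>u p - u q\<bar> * measure lebesgue W
      \<le> (\<Sum>k\<in>J. 2 * a (fst k) * measure lebesgue (cone_box i1 i2 (P (snd k)) (c (fst k)) (r (fst k))))"
  proof (rule weighted_indicator_average[OF fJ])
    show "\<bar>u p - u q\<bar> \<le> (\<Sum>k | k \<in> J \<and> w \<in> cone_box i1 i2 (P (snd k)) (c (fst k)) (r (fst k)). 2 * a (fst k))"
      if w: "w \<in> W" for w
    proof -
      define X where "X = (\<lambda>b. {i. (i, b) \<in> J \<and> w \<in> cone_box i1 i2 (P b) (c i) (r i)})"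
      have fX: "finite (X b)" for b
        by (rule finite_subset[OF _ SI(2)]) (auto simp: J_def X_def)
      have "k \<in> J \<and> w \<in> cone_box i1 i2 (P (snd k)) (c (fst k)) (r (fst k))
          \<longleftrightarrow> k \<in> (\<lambda>i. (i, True)) ` X True \<union> (\<lambda>i. (i, False)) ` X False" for k
        by (cases k; cases "snd k") (auto simp: X_def)
      then have "{k. k \<in> J \<and> w \<in> cone_box i1 i2 (P (snd k)) (c (fst k)) (r (fst k))}
          = (\<lambda>i. (i, True)) ` X True \<union> (\<lambda>i. (i, False)) ` X False"
        by (intro Set.set_eqI) (simp only: mem_Collect_eq)
      then have "(\<Sum>k | k \<in> J \<and> w \<in> cone_box i1 i2 (P (snd k)) (c (fst k)) (r (fst k)). 2 * a (fst k))
          = (\<Sum>k\<in>(\<lambda>i. (i, True)) ` X True \<union> (\<lambda>i. (i, False)) ` X False. 2 * a (fst k))"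
        by (simp only:)
      also have "\<dots> = (\<Sum>k\<in>(\<lambda>i. (i, True)) ` X True. 2 * a (fst k)) + (\<Sum>k\<in>(\<lambda>i. (i, False)) ` X False. 2 * a (fst k))"
        using fX by (intro sum.union_disjoint) auto
      also have "\<dots> = 2 * sum a (X True) + 2 * sum a (X False)"
        by (simp add: sum.reindex inj_on_def sum_distrib_left)
      also have "\<dots> \<ge> \<bar>u (P True) - u (z w)\<bar> + \<bar>u (P False) - u (z w)\<bar>"
        using step[OF w, of True] step[OF w, of False] by (simp add: X_def)
      finally show ?thesis by (simp add: P_def)
    qed
  qed (use osc_nonneg JS SI in \<open>auto simp: lmeasurable_cone_box W_def\<close>)
  also have "\<dots> \<le> (\<Sum>k\<in>J. path_const (CARD('n)) / 2 * a (fst k) * (r (fst k) / \<rho> (P (snd k)) (fst k)) ^ (CARD('n) - 2))"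
  proof (rule sum_mono)
    fix k assume "k \<in> J"
    then obtain i b where k: "k = (i, b)" "i \<in> I" "\<And>j. \<bar>c i $ j - P b $ j\<bar> \<le> 3 * max (r i) (c i $ i2 - P b $ i2)"
      using SI by (auto simp: J_def hh_def)
    have "measure lebesgue (cone_box i1 i2 (P b) (c i) (r i))
        \<le> 4 * (48 * CARD('n)) ^ (CARD('n) - 2) * (r i / \<rho> (P b) i) ^ (CARD('n) - 2)"
      unfolding \<rho>_def using side[OF k(2)] k(3) by (intro measure_cone_box_le axes) auto
    from mult_left_mono[OF this, of "2 * a i"]
    show "2 * a (fst k) * measure lebesgue (cone_box i1 i2 (P (snd k)) (c (fst k)) (r (fst k)))
        \<le> path_const (CARD('n)) / 2 * a (fst k) * (r (fst k) / \<rho> (P (snd k)) (fst k)) ^ (CARD('n) - 2)"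
      using osc_nonneg[OF k(2)] by (simp add: k(1) path_const_def mult_ac)
  qed
  also have "\<dots> \<le> (\<Sum>k\<in>S \<times> UNIV. path_const (CARD('n)) / 2 * a (fst k) * (r (fst k) / \<rho> (P (snd k)) (fst k)) ^ (CARD('n) - 2))"
  proof (rule sum_mono2[OF _ JS])
    fix k assume "k \<in> S \<times> UNIV - J"
    then have "fst k \<in> I" using SI by auto
    then show "0 \<le> path_const (CARD('n)) / 2 * a (fst k) * (r (fst k) / \<rho> (P (snd k)) (fst k)) ^ (CARD('n) - 2)"
      using osc_nonneg[of "fst k"] side[of "fst k"] \<rho>_bounds(1)[of "fst k" "P (snd k)"] P
      by (auto simp: path_const_def less_imp_le intro!: mult_nonneg_nonneg)
  qed (use SI in simp)
  also have "\<dots> = path_const (CARD('n)) / 2 * (\<Sum>i\<in>S.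
    a i * (r i / \<rho> p i) ^ (CARD('n) - 2) + a i * (r i / \<rho> q i) ^ (CARD('n) - 2))"
  proof -
    define g where "g = (\<lambda>i b. path_const (CARD('n)) / 2 * a i * (r i / \<rho> (P b) i) ^ (CARD('n) - 2))"
    have "(\<Sum>k\<in>S \<times> UNIV. path_const (CARD('n)) / 2 * a (fst k) * (r (fst k) / \<rho> (P (snd k)) (fst k)) ^ (CARD('n) - 2))
        = (\<Sum>(i, b)\<in>S \<times> UNIV. g i b)"
      by (simp add: g_def case_prod_beta)
    also have "\<dots> = (\<Sum>i\<in>S. \<Sum>b\<in>UNIV. g i b)" by (rule sum.cartesian_product[symmetric])
    also have "\<dots> = (\<Sum>i\<in>S. g i True + g i False)" by (simp add: UNIV_bool add.commute)
    also have "\<dots> = (\<Sum>i\<in>S. path_const (CARD('n)) / 2 *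
        (a i * (r i / \<rho> p i) ^ (CARD('n) - 2) + a i * (r i / \<rho> q i) ^ (CARD('n) - 2)))"
      by (simp only: g_def P_def if_True if_False distrib_left mult.assoc)
    finally show ?thesis by (simp only: sum_distrib_left)
  qed
  finally have "\<bar>u p - u q\<bar> * measure lebesgue W \<le> path_const (CARD('n)) / 2 * (\<Sum>i\<in>S.
    a i * (r i / \<rho> p i) ^ (CARD('n) - 2) + a i * (r i / \<rho> q i) ^ (CARD('n) - 2))" .
  moreover have "1 \<le> measure lebesgue W"
  proof -
    have "cbox (-1) (1::real ^ 'n) \<noteq> {}" by (simp add: interval_ne_empty_cart)
    from content_cbox_cart[OF this] have "measure lebesgue W = 2 ^ CARD('n)"
      by (simp add: W_def)
    then show ?thesis by simp
  qed
  then have "\<bar>u p - u q\<bar> * 1 \<le> \<bar>u p - u q\<bar> * measure lebesgue W" by (intro mult_left_mono) auto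
  moreover have "0 \<le> path_const (CARD('n)) / 2 * (\<Sum>i\<in>S.
    a i * (r i / \<rho> p i) ^ (CARD('n) - 2) + a i * (r i / \<rho> q i) ^ (CARD('n) - 2))" (is "0 \<le> ?X")
  proof -
    have "0 \<le> a i * (r i / \<rho> p i) ^ (CARD('n) - 2) + a i * (r i / \<rho> q i) ^ (CARD('n) - 2)" if "i \<in> S" for i
    proof -
      have "i \<in> I" using that SI by auto
      then show ?thesis
      using osc_nonneg[of i] side[of i] \<rho>_bounds(1)[of i] assms
      by (intro add_nonneg_nonneg mult_nonneg_nonneg zero_le_power divide_nonneg_nonneg) (auto simp: less_imp_le)
    qed
    then show ?thesis by (intro mult_nonneg_nonneg sum_nonneg) (auto simp: path_const_def)
  qed
  ultimately show ?thesis unfolding S_def by linarith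
qed

end

text \<open>Young's inequality with the threshold \<open>B * (r / \<rho>) * root (n - 1) \<rho>\<close> for \<open>a\<close>. This threshold makes
  the first terms summable over the cubes of a slice and turns the second into the energy density
  \<open>a ^ n / r\<close> of the slice.\<close>

lemma weighted_young:
  fixes a r \<rho> B :: real
  assumes "2 \<le> n" "0 \<le> a" "0 < r" "0 < \<rho>" "0 < B"
  shows "a * (r / \<rho>) ^ (n - 2) \<le> B * ((r / \<rho>) ^ (n - 1) * root (n - 1) \<rho>) + a ^ n / r / B ^ (n - 1)"
proof -
  obtain k where n: "n = Suc (Suc k)" using that[of "n - 2"] assms(1) by simp
  define q where "q = r / \<rho>"
  define \<tau> where "\<tau> = B * q * root (Suc k) \<rho>"
  have q: "0 < q" using assms by (simp add: q_def)
  have \<tau>: "0 < \<tau>" using assms q by (simp add: \<tau>_def)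
  show ?thesis
  proof (cases "a \<le> \<tau>")
    case True
    then have "a * q ^ k \<le> \<tau> * q ^ k" using q by (simp add: mult_right_mono)
    also have "\<dots> = B * (q ^ Suc k * root (Suc k) \<rho>)" by (simp only: \<tau>_def power_Suc mult_ac)
    also have "\<dots> \<le> \<dots> + a ^ n / r / B ^ (n - 1)" using assms by simp
    finally show ?thesis by (simp add: n q_def)
  next
    case False
    \<comment> \<open>The root is chosen for this identity: its power is \<open>\<rho>\<close>,
      which turns one factor \<open>q\<close> into \<open>r\<close>.\<close>
    have e: "\<tau> ^ Suc k = B ^ Suc k * q ^ k * r"
    proof -
      have "\<tau> ^ Suc k = B ^ Suc k * q ^ Suc k * root (Suc k) \<rho> ^ Suc k"
        by (simp only: \<tau>_def power_mult_distrib)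
      also have "root (Suc k) \<rho> ^ Suc k = \<rho>" using assms by (intro real_root_pow_pos2) auto
      also have "B ^ Suc k * q ^ Suc k * \<rho> = B ^ Suc k * q ^ k * (q * \<rho>)" by (simp only: power_Suc mult_ac)
      also have "q * \<rho> = r" using assms by (simp add: q_def)
      finally show ?thesis .
    qed
    have "\<tau> ^ Suc k \<le> a ^ Suc k" using False \<tau> by (intro power_mono) auto
    then have "a * q ^ k * \<tau> ^ Suc k \<le> a * q ^ k * a ^ Suc k"
      using assms q by (intro mult_left_mono) auto
    moreover have "a * q ^ k * \<tau> ^ Suc k = a * q ^ k * (B ^ Suc k * r) * q ^ k"
      by (simp only: e mult_ac)
    moreover have "a * q ^ k * a ^ Suc k = a ^ n * q ^ k"
      by (simp only: n power_Suc mult_ac)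
    ultimately have "a * q ^ k * (B ^ Suc k * r) * q ^ k \<le> a ^ n * q ^ k" by (simp only:)
    then have "a * q ^ k * (B ^ Suc k * r) \<le> a ^ n"
      by (rule mult_right_le_imp_le) (use q in simp)
    then have "a * q ^ k \<le> a ^ n / (B ^ Suc k * r)"
      using assms by (simp add: pos_le_divide_eq)
    also have "\<dots> = a ^ n / r / B ^ (n - 1)" by (simp add: n divide_divide_eq_left mult.commute)
    finally have "a * q ^ k \<le> a ^ n / r / B ^ (n - 1)" .
    moreover have "0 \<le> B * (q ^ Suc k * root (Suc k) \<rho>)" using assms q by simp
    ultimately have "a * q ^ k \<le> B * (q ^ Suc k * root (Suc k) \<rho>) + a ^ n / r / B ^ (n - 1)" by linarith
    then show ?thesis by (simp add: n q_def)
  qed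
qed

section \<open>From one hyperplane to the whole cover\<close>

context cube_cover_oscillation
begin

lemma path_const_nonneg: "0 \<le> path_const (CARD('n))"
  by (simp add: path_const_def)

lemma shell_const_nonneg: "0 \<le> shell_const (CARD('n)) N"
proof -
  have "card {i1, i2} \<le> CARD('n)" by (intro card_mono) auto
  then have "1 < root (CARD('n) - 1) 2" using axes by simp
  then have "0 \<le> 1 - 1 / root (CARD('n) - 1) 2" by simp
  then show ?thesis
    unfolding shell_const_def by (intro divide_nonneg_nonneg mult_nonneg_nonneg real_root_ge_zero) auto
qed

lemma slice_energy:
  assumes "p \<in> cbox (-1) 1" "q \<in> cbox (-1) 1" "p $ i1 = s" "q $ i1 = s"
  shows "\<bar>u p - u q\<bar> ^ CARD('n) \<le> loewner_const (CARD('n)) N * (\<Sum>i\<in>slice s. a i ^ CARD('n) / r i)"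
proof -
  define n where "n = CARD('n)"
  have "card {i1, i2} \<le> CARD('n)" by (intro card_mono) auto
  then have n2: "2 \<le> n" using axes by (simp add: n_def)
  define U where "U = \<bar>u p - u q\<bar>"
  define A where "A = path_const n"
  define C where "C = shell_const n N + 1"
  define E where "E = (\<Sum>i\<in>slice s. a i ^ n / r i)"
  have I: "i \<in> I" if "i \<in> slice s" for i using that by (simp add: slice_def)
  have E: "0 \<le> E" unfolding E_def
    using I osc_nonneg side by (intro sum_nonneg divide_nonneg_nonneg zero_le_power) (auto simp: less_imp_le)
  have A: "0 < A" using n2 by (simp add: A_def path_const_def)
  have C: "1 \<le> C"
  proof -
    have "0 \<le> shell_const n N" unfolding n_def by (rule shell_const_nonneg)
    then show ?thesis by (simp add: C_def)
  qed
  show ?thesis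
  proof (cases "U = 0")
    case True
    then have "U ^ n = 0" using n2 by simp
    moreover have "0 \<le> loewner_const n N * E"
      using E A C unfolding loewner_const_def A_def[symmetric] C_def[symmetric] by simp
    ultimately show ?thesis unfolding U_def E_def n_def by linarith
  next
    case False
    then have U: "0 < U" by (simp add: U_def)
    \<comment> \<open>With this choice the first terms of Young's inequality for \<open>p\<close>
      and for \<open>q\<close> add up to \<open>2 * A * B * C = U / 2\<close>, half of the left-hand
      side.\<close>
    define B where "B = U / (4 * A * C)"
    have B: "0 < B" using U A C by (simp add: B_def)
    have one: "(\<Sum>i\<in>slice s. a i * (r i / \<rho> x i) ^ (n - 2)) \<le> B * C + E / B ^ (n - 1)"
      if x: "x \<in> cbox (-1) 1" "x $ i1 = s" for x
    proof -
      have "(\<Sum>i\<in>slice s. a i * (r i / \<rho> x i) ^ (n - 2))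
          \<le> (\<Sum>i\<in>slice s. B * ((r i / \<rho> x i) ^ (n - 1) * root (n - 1) (\<rho> x i)) + a i ^ n / r i / B ^ (n - 1))"
        using I osc_nonneg side \<rho>_bounds(1)[OF _ x(1)] n2 B
        by (intro sum_mono weighted_young) auto
      also have "\<dots> = B * (\<Sum>i\<in>slice s. (r i / \<rho> x i) ^ (n - 1) * root (n - 1) (\<rho> x i)) + E / B ^ (n - 1)"
        by (simp add: sum.distrib sum_distrib_left sum_divide_distrib E_def)
      also have "\<dots> \<le> B * C + E / B ^ (n - 1)"
        using sum_shells[OF x(1)] B by (simp add: x(2) n_def C_def)
      finally show ?thesis .
    qed
    have "U \<le> A * (\<Sum>i\<in>slice s. a i * (r i / \<rho> p i) ^ (n - 2) + a i * (r i / \<rho> q i) ^ (n - 2))"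
      using path_bound[OF assms(1,2)] assms(3,4) by (simp add: U_def A_def n_def)
    also have "\<dots> \<le> A * ((B * C + E / B ^ (n - 1)) + (B * C + E / B ^ (n - 1)))"
      unfolding sum.distrib using one[OF assms(1,3)] one[OF assms(2,4)] A
      by (intro mult_left_mono add_mono) auto
    also have "\<dots> = 2 * (A * (B * C)) + 4 * A * E / B ^ (n - 1) / 2"
      by (simp add: distrib_left)
    also have "A * (B * C) = U / 4"
      using A C by (simp add: B_def)
    finally have "U \<le> 4 * A * E / B ^ (n - 1)" by simp
    then have "U * B ^ (n - 1) \<le> 4 * A * E"
      using B by (simp add: pos_le_divide_eq)
    then have "U * B ^ (n - 1) * (4 * A * C) ^ (n - 1) \<le> 4 * A * E * (4 * A * C) ^ (n - 1)"
      using A C by (intro mult_right_mono) auto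
    moreover have "U * B ^ (n - 1) * (4 * A * C) ^ (n - 1) = U ^ n"
    proof -
      have "U * B ^ (n - 1) * (4 * A * C) ^ (n - 1) = U * (B * (4 * A * C)) ^ (n - 1)"
        by (simp only: power_mult_distrib mult.assoc)
      also have "B * (4 * A * C) = U" using A C by (simp add: B_def)
      also have "U * U ^ (n - 1) = U ^ n" using n2 by (cases n) auto
      finally show ?thesis .
    qed
    moreover have "4 * A * E * (4 * A * C) ^ (n - 1) = 4 * A * (4 * A * C) ^ (n - 1) * E"
      by (simp only: mult_ac)
    ultimately have "U ^ n \<le> 4 * A * (4 * A * C) ^ (n - 1) * E" by (simp only:)
    then show ?thesis
      by (simp add: U_def E_def loewner_const_def A_def C_def n_def)
  qed
qed

text \<open>Cube \<open>i\<close> belongs to the slices \<open>s\<close> of an interval of length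
  \<open>r i\<close>. Integrating \<open>slice_energy\<close> over \<open>s\<close> thus cancels the
  factor \<open>1 / r i\<close>.\<close>

theorem discrete_loewner:
  assumes "s0 \<le> s1" "0 \<le> U"
    and "\<And>s. s0 \<le> s \<Longrightarrow> s \<le> s1 \<Longrightarrow> \<exists>p q. p \<in> cbox (-1) 1 \<and> q \<in> cbox (-1) 1 \<and>
      p $ i1 = s \<and> q $ i1 = s \<and> U \<le> \<bar>u p - u q\<bar>"
  shows "(s1 - s0) * U ^ CARD('n) \<le> loewner_const (CARD('n)) N * (\<Sum>i\<in>I. a i ^ CARD('n))"
proof -
  define L where "L = loewner_const (CARD('n)) N"
  have L: "0 \<le> L"
    unfolding L_def loewner_const_def
    by (intro mult_nonneg_nonneg zero_le_power add_nonneg_nonneg path_const_nonneg shell_const_nonneg) auto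
  have "U ^ CARD('n) * measure lebesgue {s0..s1}
      \<le> (\<Sum>i\<in>I. (L * (a i ^ CARD('n) / r i)) * measure lebesgue {c i $ i1..<c i $ i1 + r i})"
  proof (rule weighted_indicator_average[OF finite_index])
    show "U ^ CARD('n) \<le> (\<Sum>i | i \<in> I \<and> s \<in> {c i $ i1..<c i $ i1 + r i}. L * (a i ^ CARD('n) / r i))"
      if s: "s \<in> {s0..s1}" for s
    proof -
      obtain p q where pq: "p \<in> cbox (-1) 1" "q \<in> cbox (-1) 1" "p $ i1 = s" "q $ i1 = s" "U \<le> \<bar>u p - u q\<bar>"
        using assms(3)[of s] s by auto
      have "U ^ CARD('n) \<le> \<bar>u p - u q\<bar> ^ CARD('n)" using pq(5) assms(2) by (rule power_mono)
      also have "\<dots> \<le> L * (\<Sum>i\<in>slice s. a i ^ CARD('n) / r i)"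
        unfolding L_def by (rule slice_energy[OF pq(1-4)])
      finally show ?thesis by (simp add: slice_def sum_distrib_left)
    qed
    show "{c i $ i1..<c i $ i1 + r i} \<in> lmeasurable" for i
      by (rule bounded_set_imp_lmeasurable) auto
    show "0 \<le> L * (a i ^ CARD('n) / r i)" if "i \<in> I" for i
      using L osc_nonneg[OF that] side[OF that] by simp
  qed simp
  also have "\<dots> = (\<Sum>i\<in>I. L * a i ^ CARD('n))"
  proof (intro sum.cong refl)
    fix i assume "i \<in> I"
    then have "0 < r i" using side by blast
    then show "L * (a i ^ CARD('n) / r i) * measure lebesgue {c i $ i1..<c i $ i1 + r i} = L * a i ^ CARD('n)"
      by simp
  qed
  finally show ?thesis using assms(1) by (simp add: L_def sum_distrib_left mult.commute)
qed

end

section \<open>Scales of controlled distortion\<close>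

text \<open>By invariance of domain the frontier of the image of the open ball lies in the image of
  the sphere, which keeps distance \<open>t\<close> from \<open>g x\<close>. A connected set that
  meets the image and misses its frontier stays inside.\<close>

lemma ball_subset_image_cball:
  fixes g :: "'a::euclidean_space \<Rightarrow> 'a"
  assumes "continuous_on (cball x \<rho>) g" "inj_on g (cball x \<rho>)" "0 < \<rho>"
    and "\<And>y. dist x y = \<rho> \<Longrightarrow> t \<le> dist (g y) (g x)"
  shows "ball (g x) t \<subseteq> g ` cball x \<rho>"
proof (cases "0 < t")
  case True
  define V where "V = g ` ball x \<rho>"
  have V: "open V"
    unfolding V_def
    by (rule invariance_of_domain[OF continuous_on_subset[OF assms(1) ball_subset_cball] open_ball
          inj_on_subset[OF assms(2) ball_subset_cball]])
  have "closed (g ` cball x \<rho>)"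
    using compact_continuous_image[OF assms(1) compact_cball] by (rule compact_imp_closed)
  then have cl: "closure V \<subseteq> g ` cball x \<rho>"
    unfolding V_def by (intro closure_minimal image_mono ball_subset_cball)
  have "ball (g x) t \<subseteq> V"
  proof (rule ccontr)
    assume "\<not> ball (g x) t \<subseteq> V"
    moreover have "g x \<in> V" "g x \<in> ball (g x) t" using True assms(3) by (auto simp: V_def)
    ultimately have "ball (g x) t \<inter> V \<noteq> {}" "ball (g x) t - V \<noteq> {}" by blast+
    then have "ball (g x) t \<inter> frontier V \<noteq> {}"
      by (rule connected_Int_frontier[OF connected_ball])
    then obtain w where w: "w \<in> ball (g x) t" "w \<in> closure V" "w \<notin> V"
      using V by (auto simp: frontier_def interior_open)
    then obtain y where y: "y \<in> cball x \<rho>" "w = g y" using cl by blast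
    then have "dist x y = \<rho>" using w(3) by (auto simp: V_def order_le_less)
    then show False using assms(4)[of y] w(1) y(2) by (simp add: dist_commute)
  qed
  then show ?thesis using closure_subset[of V] cl by (rule order_trans[OF _ order_trans])
next
  case False
  then show ?thesis by (simp add: ball_empty)
qed

text \<open>By roundness on the sphere through \<open>z\<close>, the image contains the ball of
  radius \<open>dist (g z) (g x) / K\<close> around \<open>g x\<close>, so its volume controls this
  distance.\<close>

lemma dist_power_le_measure_image:
  fixes g :: "'a::euclidean_space \<Rightarrow> 'a"
  assumes g: "continuous_on (cball x \<rho>) g" "inj_on g (cball x \<rho>)" and K: "0 < K"
    and qc: "\<And>s y z. 0 < s \<Longrightarrow> s \<le> \<rho> \<Longrightarrow> dist x y = s \<Longrightarrow> dist x z = s \<Longrightarrow>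
      dist (g y) (g x) \<le> K * dist (g z) (g x)"
    and z: "z \<in> cball x \<rho>"
  shows "dist (g z) (g x) ^ DIM('a) * measure lebesgue (ball (0::'a) 1) \<le> K ^ DIM('a) * measure lebesgue (g ` cball x \<rho>)"
proof (cases "z = x")
  case True
  then show ?thesis using K by (simp add: zero_power)
next
  case False
  define s where "s = dist x z"
  define t where "t = dist (g z) (g x) / K"
  have s: "0 < s" "s \<le> \<rho>" using False z by (auto simp: s_def)
  have sub: "cball x s \<subseteq> cball x \<rho>" using s by auto
  have lm: "g ` cball x \<rho> \<in> lmeasurable"
    using compact_continuous_image[OF g(1) compact_cball] by (rule lmeasurable_compact)
  have "ball (g x) t \<subseteq> g ` cball x s"
  proof (rule ball_subset_image_cball)
    show "continuous_on (cball x s) g" "inj_on g (cball x s)"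
      by (rule continuous_on_subset[OF g(1) sub], rule inj_on_subset[OF g(2) sub])
    show "t \<le> dist (g y) (g x)" if "dist x y = s" for y
      using qc[OF s s_def[symmetric] that] unfolding t_def pos_divide_le_eq[OF K]
      by (simp only: mult.commute)
  qed (rule s)
  then have "measure lebesgue (ball (g x) t) \<le> measure lebesgue (g ` cball x \<rho>)"
    using sub lm by (intro measure_mono_fmeasurable) auto
  moreover have "measure lebesgue (ball (g x) t) = t ^ DIM('a) * measure lebesgue (ball (0::'a) 1)"
    using content_ball_conv_unit_ball[of t "g x"] K by (simp add: t_def)
  ultimately have "t ^ DIM('a) * measure lebesgue (ball (0::'a) 1) \<le> measure lebesgue (g ` cball x \<rho>)" by simp
  then have "K ^ DIM('a) * (t ^ DIM('a) * measure lebesgue (ball (0::'a) 1)) \<le> K ^ DIM('a) * measure lebesgue (g ` cball x \<rho>)"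
    using K by (intro mult_left_mono) auto
  moreover have "K ^ DIM('a) * (t ^ DIM('a) * measure lebesgue (ball (0::'a) 1)) = (K * t) ^ DIM('a) * measure lebesgue (ball (0::'a) 1)"
    by (simp only: power_mult_distrib mult.assoc)
  moreover have "K * t = dist (g z) (g x)" using K by (simp add: t_def)
  ultimately show ?thesis by (simp only:)
qed

text \<open>Otherwise \<open>b\<close> falls by more than the factor \<open>2 * D ^ j\<close> in
  every \<open>j\<close> steps from \<open>k0\<close> on, while the lower bound falls only by
  \<open>D ^ j\<close>.\<close>

lemma ex_doubling_index:
  fixes b :: "nat \<Rightarrow> real"
  assumes "0 < \<alpha>" "0 < D" "\<And>k. \<alpha> / D ^ k \<le> b k"
  shows "\<exists>k\<ge>k0. b k \<le> 2 * D ^ j * b (k + j)"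
proof (rule ccontr)
  assume "\<not> ?thesis"
  then have *: "2 * D ^ j * b (k + j) \<le> b k" if "k0 \<le> k" for k
    using that by (meson linear)
  have ind: "2 ^ i * D ^ (i * j) * b (k0 + i * j) \<le> b k0" for i
  proof (induction i)
    case (Suc i)
    have "2 ^ Suc i * D ^ (Suc i * j) * b (k0 + Suc i * j)
        = 2 ^ i * D ^ (i * j) * (2 * D ^ j * b (k0 + i * j + j))"
    proof -
      have "D ^ (Suc i * j) = D ^ j * D ^ (i * j)" by (simp add: power_add)
      moreover have "k0 + Suc i * j = k0 + i * j + j" by simp
      ultimately show ?thesis by (simp only: power_Suc mult_ac)
    qed
    also have "\<dots> \<le> 2 ^ i * D ^ (i * j) * b (k0 + i * j)"
      using *[of "k0 + i * j"] assms(2) by (intro mult_left_mono) auto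
    finally show ?case using Suc.IH by linarith
  qed simp
  have le: "2 ^ i \<le> b k0 / (\<alpha> / D ^ k0)" for i
  proof -
    have "2 ^ i * (\<alpha> / D ^ k0) = 2 ^ i * D ^ (i * j) * (\<alpha> / D ^ (k0 + i * j))"
      using assms(2) by (simp add: power_add)
    also have "\<dots> \<le> 2 ^ i * D ^ (i * j) * b (k0 + i * j)"
      using assms by (intro mult_left_mono) auto
    also have "\<dots> \<le> b k0" by (rule ind)
    finally have "2 ^ i * (\<alpha> / D ^ k0) \<le> b k0" .
    moreover have "0 < \<alpha> / D ^ k0" using assms by simp
    ultimately show ?thesis using pos_le_divide_eq by blast
  qed
  obtain i :: nat where "b k0 / (\<alpha> / D ^ k0) < 2 ^ i"
    using real_arch_pow[of 2] by auto
  then show False using le[of i] by linarith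
qed

text \<open>\<open>K ^ n\<close> and the unit ball come from
  \<open>dist_power_le_measure_image\<close>, the middle factor from
  \<open>ex_doubling_index\<close> with \<open>D = 3 ^ n\<close> and
  \<open>j = n + 1\<close>.\<close>

definition good_const :: "real \<Rightarrow> 'n::finite itself \<Rightarrow> real" where
  "good_const K _ = K ^ CARD('n) * (2 * (3 ^ CARD('n)) ^ (CARD('n) + 1)) / measure lebesgue (ball (0 :: real ^ 'n) 1)"

text \<open>The volume of the image may decay arbitrarily fast. Adding the volume of the ball itself
  bounds the decay from below, so that some scale is doubling.\<close>

lemma ex_good_scale:
  fixes g :: "real ^ 'n::finite \<Rightarrow> real ^ 'n"
  assumes S: "open S" "continuous_on S g" "inj_on g S" "x \<in> S" and K: "1 \<le> K" and \<eta>: "0 < \<eta>" and \<delta>: "0 < \<delta>"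
    and qc: "\<And>s y z. 0 < s \<Longrightarrow> s < \<delta> \<Longrightarrow> dist x y = s \<Longrightarrow> dist x z = s \<Longrightarrow>
      dist (g y) (g x) \<le> K * dist (g z) (g x)"
  shows "\<exists>k e. cball x (CARD('n) / 3 ^ k) \<subseteq> S \<and> 0 \<le> e \<and> e \<le> \<eta> \<and>
    (\<forall>z\<in>cball x (CARD('n) / 3 ^ k). dist (g z) (g x) \<le> e) \<and>
    e ^ CARD('n) \<le> good_const K TYPE('n) *
      (measure lebesgue (g ` cball x (1 / 3 ^ k / 4)) + measure lebesgue (cball x (1 / 3 ^ k / 4)))"
proof -
  define n where "n = CARD('n)"
  have n: "1 \<le> n" by (simp add: n_def Suc_leI)
  define \<omega> where "\<omega> = measure lebesgue (ball (0 :: real ^ 'n) 1)"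
  have \<omega>: "0 < \<omega>" by (simp add: \<omega>_def content_ball_pos)
  obtain d1 where d1: "0 < d1" "cball x d1 \<subseteq> S" using S by (meson open_contains_cball)
  have "isCont g x" using S by (simp add: continuous_on_eq_continuous_at)
  then obtain d2 where d2: "0 < d2" "\<And>z. dist z x < d2 \<Longrightarrow> dist (g z) (g x) < \<eta>"
    using \<eta> unfolding continuous_at_eps_delta by meson
  define d where "d = min d1 (min d2 \<delta>)"
  have d: "0 < d" "d \<le> d1" "d \<le> d2" "d \<le> \<delta>" using d1 d2 \<delta> by (auto simp: d_def)
  \<comment> \<open>By \<open>half_open_cube_subset_cball\<close> the ball of this radius contains
    every half-open cube of side \<open>1 / 3 ^ k\<close> through \<open>x\<close>.\<close>
  define R where "R = (\<lambda>k::nat. real n / 3 ^ k)"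
  obtain k0 :: nat where "real n / d < 3 ^ k0" using real_arch_pow[of 3] by auto
  then have k0: "R k0 < d" using d by (simp add: R_def pos_divide_less_eq mult.commute)
  have R: "R k < d" if "k0 \<le> k" for k
  proof -
    have "R k \<le> R k0" using that by (simp add: R_def divide_left_mono power_increasing)
    then show ?thesis using k0 by simp
  qed
  have R0: "0 < R k" for k using n by (simp add: R_def)
  define b where "b = (\<lambda>k. measure lebesgue (g ` cball x (R k)) + measure lebesgue (cball x (R k)))"
  have vol: "measure lebesgue (cball x (R k)) = \<omega> * real n ^ n / (3 ^ n) ^ k" for k
  proof -
    have "measure lebesgue (cball x (R k)) = measure lebesgue (ball x (R k))"
      by (simp add: content_cball content_ball R0 less_imp_le)
    also have "\<dots> = R k ^ n * \<omega>"
      using content_ball_conv_unit_ball[of "R k" x] R0[of k] by (simp add: n_def \<omega>_def)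
    also have "\<dots> = \<omega> * real n ^ n / (3 ^ n) ^ k"
    proof -
      have "(3 ^ k) ^ n = ((3::real) ^ n) ^ k" by (simp only: power_mult[symmetric] mult.commute)
      then show ?thesis by (simp add: R_def power_divide)
    qed
    finally show ?thesis .
  qed
  have "\<exists>k\<ge>k0. b k \<le> 2 * (3 ^ n) ^ (n + 1) * b (k + (n + 1))"
    by (rule ex_doubling_index[of "\<omega> * real n ^ n"]) (use \<omega> n vol in \<open>auto simp: b_def\<close>)
  then obtain k where k: "k0 \<le> k" "b k \<le> 2 * (3 ^ n) ^ (n + 1) * b (k + (n + 1))" by blast
  have cont: "continuous_on (cball x (R k)) g" and inj: "inj_on g (cball x (R k))"
    and subS: "cball x (R k) \<subseteq> S"
  proof -
    show "cball x (R k) \<subseteq> S" using R[OF k(1)] d d1 by (meson less_imp_le order_trans subset_cball)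
    then show "continuous_on (cball x (R k)) g" "inj_on g (cball x (R k))"
      by (rule continuous_on_subset[OF S(2)], rule inj_on_subset[OF S(3)])
  qed
  have "compact (cball x (R k))" "cball x (R k) \<noteq> {}" using R0[of k] by auto
  moreover have "continuous_on (cball x (R k)) (\<lambda>z. dist (g z) (g x))"
    by (intro continuous_intros cont)
  ultimately obtain z where z: "z \<in> cball x (R k)" "\<And>y. y \<in> cball x (R k) \<Longrightarrow> dist (g y) (g x) \<le> dist (g z) (g x)"
    using continuous_attains_sup by metis
  define e where "e = dist (g z) (g x)"
  \<comment> \<open>The reason for \<open>j = n + 1\<close>: after so many steps the radius is at
    most a quarter of \<open>1 / 3 ^ k\<close>, the radius of the ball inside the grid cell.\<close>
  have "3 ^ (n + 1) \<ge> 4 * real n"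
  proof -
    have "4 * real m \<le> 3 ^ (m + 1)" for m :: nat
    proof (induction m)
      case (Suc m)
      have "1 \<le> (3::real) ^ m" by simp
      moreover have "4 * real m \<le> 3 * 3 ^ m" using Suc by simp
      ultimately have "4 + 4 * real m \<le> 9 * 3 ^ m" by linarith
      then show ?case by simp
    qed simp
    then show ?thesis .
  qed
  then have small: "R (k + (n + 1)) \<le> 1 / 3 ^ k / 4"
  proof -
    have "R (k + (n + 1)) = real n / 3 ^ (n + 1) / 3 ^ k"
      by (simp add: R_def power_add)
    also have "\<dots> \<le> (1 / 4) / 3 ^ k"
      using \<open>3 ^ (n + 1) \<ge> 4 * real n\<close> by (intro divide_right_mono) (simp_all add: pos_divide_le_eq)
    finally show ?thesis by simp
  qed
  have comp: "compact (g ` cball x (1 / 3 ^ k / 4))"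
  proof -
    have "(1 / 4) / 3 ^ k \<le> R k" unfolding R_def using n by (intro divide_right_mono) auto
    then have "1 / 3 ^ k / 4 \<le> R k" by simp
    then have "cball x (1 / 3 ^ k / 4) \<subseteq> cball x (R k)" by (rule subset_cball)
    then show ?thesis
      by (intro compact_continuous_image continuous_on_subset[OF cont] compact_cball)
  qed
  have le: "b (k + (n + 1)) \<le> measure lebesgue (g ` cball x (1 / 3 ^ k / 4)) + measure lebesgue (cball x (1 / 3 ^ k / 4))"
    (is "_ \<le> ?\<nu>")
  proof -
    have sub: "cball x (R (k + (n + 1))) \<subseteq> cball x (1 / 3 ^ k / 4)" using small by (rule subset_cball)
    have "compact (g ` cball x (R (k + (n + 1))))"
    proof -
      have "R (k + (n + 1)) \<le> R k"
        unfolding R_def by (intro divide_left_mono power_increasing) auto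
      then have "cball x (R (k + (n + 1))) \<subseteq> cball x (R k)" by (rule subset_cball)
      then show ?thesis
      by (intro compact_continuous_image continuous_on_subset[OF cont] compact_cball)
    qed
    then have "measure lebesgue (g ` cball x (R (k + (n + 1)))) \<le> measure lebesgue (g ` cball x (1 / 3 ^ k / 4))"
      using sub comp by (intro measure_mono_fmeasurable image_mono fmeasurableD lmeasurable_compact)
    moreover have "measure lebesgue (cball x (R (k + (n + 1)))) \<le> measure lebesgue (cball x (1 / 3 ^ k / 4))"
      using sub by (intro measure_mono_fmeasurable fmeasurableD lmeasurable_compact) auto
    ultimately show ?thesis by (simp add: b_def)
  qed
  have "e ^ n * \<omega> \<le> K ^ n * measure lebesgue (g ` cball x (R k))"
  proof -
    have "dist (g z) (g x) ^ DIM(real ^ 'n) * measure lebesgue (ball (0 :: real ^ 'n) 1)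
        \<le> K ^ DIM(real ^ 'n) * measure lebesgue (g ` cball x (R k))"
    proof (rule dist_power_le_measure_image[OF cont inj _ _ z(1)])
      show "dist (g y) (g x) \<le> K * dist (g z) (g x)"
        if "0 < s" "s \<le> R k" "dist x y = s" "dist x z = s" for s y z
        using qc[of s y z] that R[OF k(1)] d by linarith
    qed (use K in simp)
    then show ?thesis by (simp add: n_def \<omega>_def e_def)
  qed
  also have "\<dots> \<le> K ^ n * b k" using K by (intro mult_left_mono) (auto simp: b_def)
  also have "\<dots> \<le> K ^ n * (2 * (3 ^ n) ^ (n + 1) * ?\<nu>)"
  proof -
    have "2 * (3 ^ n) ^ (n + 1) * b (k + (n + 1)) \<le> 2 * (3 ^ n) ^ (n + 1) * ?\<nu>"
      using le by (intro mult_left_mono) auto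
    with k(2) have "b k \<le> 2 * (3 ^ n) ^ (n + 1) * ?\<nu>" by (rule order_trans)
    then show ?thesis using K by (intro mult_left_mono) auto
  qed
  finally have "e ^ n \<le> K ^ n * (2 * (3 ^ n) ^ (n + 1) * ?\<nu>) / \<omega>"
    using \<omega> by (simp add: pos_le_divide_eq)
  also have "\<dots> = good_const K TYPE('n) * ?\<nu>"
    by (simp add: good_const_def n_def \<omega>_def mult.assoc)
  finally have en: "e ^ n \<le> good_const K TYPE('n) * ?\<nu>" .
  have "dist z x < d2" using z(1) R[OF k(1)] d by (simp add: dist_commute)
  then have "e \<le> \<eta>" using d2(2) by (simp add: e_def less_imp_le)
  then show ?thesis
    using en z(2) subS by (intro exI[of _ k] exI[of _ e]) (simp add: e_def R_def n_def)
qed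

section \<open>Separation of continua\<close>

text \<open>The bound on the linear dilatation cleared of the limit and of the quotient, with a
  threshold depending on the point. It survives similarities and a change of sign of
  \<open>g\<close>.\<close>

definition quasiround_on :: "real \<Rightarrow> ('a::metric_space) set \<Rightarrow> ('a \<Rightarrow> 'b::metric_space) \<Rightarrow> bool" where
  "quasiround_on K S g \<longleftrightarrow> (\<forall>x\<in>S. \<exists>\<delta>>0. \<forall>s y z. 0 < s \<and> s < \<delta> \<and> dist x y = s \<and> dist x z = s \<longrightarrow>
     dist (g y) (g x) \<le> K * dist (g z) (g x))"

text \<open>The bound for one dyadic shell in \<open>loewner_separation\<close>: the overlap, the
  factor 4 of \<open>ln_clip_diff_le\<close>, the constant of a good scale, and the volumes of a
  ball of radius 4 and of \<open>cbox (-5) 5\<close>.\<close>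

definition energy_const :: "real \<Rightarrow> 'n::finite itself \<Rightarrow> real" where
  "energy_const K _ = 2 ^ CARD('n) * (4 ^ CARD('n) * good_const K TYPE('n) *
     (4 ^ CARD('n) * measure lebesgue (ball (0 :: real ^ 'n) 1) + 10 ^ CARD('n)))"

text \<open>Clipping to the range from 1 to \<open>M\<close> does not increase distances, and the
  clipped values are at least \<open>max 1 t / 2\<close>, where the logarithm has slope at most
  \<open>2 / max 1 t\<close>.\<close>

lemma ln_clip_diff_le:
  fixes M t e v w :: real
  assumes "1 \<le> M" "0 \<le> e" "e \<le> 1/4" "t \<le> 2 * M" "\<bar>v - t\<bar> \<le> e" "\<bar>w - t\<bar> \<le> e"
  shows "\<bar>ln (max 1 (min M v)) - ln (max 1 (min M w))\<bar> \<le> 4 * e / max 1 t"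
proof -
  have *: "ln (max 1 (min M v)) - ln (max 1 (min M w)) \<le> 4 * e / max 1 t"
    if "\<bar>v - t\<bar> \<le> e" "\<bar>w - t\<bar> \<le> e" for v w
  proof -
    define \<alpha> where "\<alpha> = max 1 (min M v)"
    define \<beta> where "\<beta> = max 1 (min M w)"
    have b: "max 1 t / 2 \<le> \<beta>" "1 \<le> \<beta>" "1 \<le> \<alpha>" "\<alpha> - \<beta> \<le> 2 * e"
      using that assms(1-4) by (auto simp: \<alpha>_def \<beta>_def max_def min_def)
    have "ln \<alpha> - ln \<beta> \<le> (\<alpha> - \<beta>) / \<beta>"
      using b ln_diff_le[of \<alpha> \<beta>] by simp
    also have "\<dots> \<le> (2 * e) / \<beta>" using b by (intro divide_right_mono) auto
    also have "\<dots> \<le> (2 * e) / (max 1 t / 2)"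
      using b assms(2) by (intro divide_left_mono) auto
    also have "\<dots> = 4 * e / max 1 t" by simp
    finally show ?thesis by (simp add: \<alpha>_def \<beta>_def)
  qed
  show ?thesis using *[OF assms(5,6)] *[OF assms(6,5)] by linarith
qed

text \<open>Cubes beyond level \<open>2 * M\<close> have no oscillation, which leaves at most
  \<open>m + 2\<close> dyadic shells to count.\<close>

lemma ln_clip_eq:
  fixes M t e v :: real
  assumes "1 \<le> M" "e \<le> 1/4" "2 * M < t" "\<bar>v - t\<bar> \<le> e"
  shows "ln (max 1 (min M v)) = ln M"
  using assms by (simp add: min_def max_def)

lemma half_open_cube_subset_cball:
  fixes x :: "real ^ 'n::finite" and r :: real
  assumes "x \<in> half_open_cube c r"
  shows "half_open_cube c r \<subseteq> cball x (CARD('n) * r)"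
proof
  fix y assume y: "y \<in> half_open_cube c r"
  have "\<bar>(x - y) $ j\<bar> \<le> r" for j
  proof -
    have "c $ j \<le> x $ j \<and> x $ j < c $ j + r" "c $ j \<le> y $ j \<and> y $ j < c $ j + r"
      using assms y by (simp_all add: half_open_cube_def)
    then show ?thesis by (simp add: abs_le_iff)
  qed
  then have "(\<Sum>j\<in>UNIV. \<bar>(x - y) $ j\<bar>) \<le> (\<Sum>j\<in>(UNIV::'n set). r)"
    by (intro sum_mono) auto
  then show "y \<in> cball x (CARD('n) * r)"
    using norm_le_l1_cart[of "x - y"] by (simp add: dist_norm)
qed

text \<open>The separation is asked for in each hyperplane by itself, so it suffices that the two
  sets have overlapping projections to the axis \<open>i1\<close>. The test function is the clipped
  logarithm of \<open>norm (g z)\<close>, each cube having the good scale of the point for which the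
  cover chose it.\<close>

theorem loewner_separation:
  fixes g :: "real ^ 'n::finite \<Rightarrow> real ^ 'n" and i1 i2 :: 'n and m :: nat
  assumes i12: "i1 \<noteq> i2" and S: "open S" "cbox (-5) 5 \<subseteq> S" "continuous_on S g" "inj_on g S"
    and K: "1 \<le> K" "quasiround_on K S g" and m: "1 \<le> m"
    and s01: "s0 \<le> s1"
    and sep: "\<And>s. s0 \<le> s \<Longrightarrow> s \<le> s1 \<Longrightarrow> \<exists>p q. p \<in> cbox (-1) 1 \<and> q \<in> cbox (-1) 1 \<and>
      p $ i1 = s \<and> q $ i1 = s \<and> norm (g p) \<le> 1 \<and> 2 ^ m \<le> norm (g q)"
  shows "(s1 - s0) * real m ^ (CARD('n) - 1)
    \<le> 3 * loewner_const (CARD('n)) (2 ^ CARD('n)) * 2 ^ CARD('n) * energy_const K TYPE('n)"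
proof -
  define n where "n = CARD('n)"
  have n: "1 \<le> n" by (simp add: n_def Suc_leI)
  define N :: nat where "N = 2 ^ n"
  define X where "X = (cbox (-3) 3 :: (real ^ 'n) set)"
  have X: "compact X" "X \<subseteq> S"
  proof -
    have "X \<subseteq> cbox (-5) 5"
    proof
      fix z assume "z \<in> X"
      then have 3: "-3 \<le> z $ j \<and> z $ j \<le> 3" for j by (simp add: X_def mem_box_cart)
      have "-5 \<le> z $ j \<and> z $ j \<le> 5" for j using 3[of j] by linarith
      then show "z \<in> cbox (-5) 5" by (simp add: mem_box_cart)
    qed
    then show "X \<subseteq> S" using S by blast
  qed (simp add: X_def)
  define \<nu> where "\<nu> = (\<lambda>(x, k). measure lebesgue (g ` cball x (1 / 3 ^ k / 4)) + measure lebesgue (cball x (1 / 3 ^ k / 4)))"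
  \<comment> \<open>The tolerance 1/4 is the one \<open>ln_clip_diff_le\<close> needs.\<close>
  define good where "good = (\<lambda>x k e. cball x (n / 3 ^ k) \<subseteq> S \<and> 0 \<le> e \<and> e \<le> 1/4 \<and>
    (\<forall>z\<in>cball x (n / 3 ^ k). dist (g z) (g x) \<le> e) \<and>
    e ^ n \<le> good_const K TYPE('n) * \<nu> (x, k))"
  have ex: "\<exists>k e. good x k e" if x: "x \<in> X" for x
  proof -
    have xS: "x \<in> S" using x X by blast
    obtain \<delta> where \<delta>: "0 < \<delta>" "\<And>s y z. 0 < s \<Longrightarrow> s < \<delta> \<Longrightarrow> dist x y = s \<Longrightarrow> dist x z = s \<Longrightarrow>
        dist (g y) (g x) \<le> K * dist (g z) (g x)"
      using K(2) xS unfolding quasiround_on_def by meson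
    have "(0::real) < 1/4" by simp
    from ex_good_scale[OF S(1,3,4) xS K(1) this \<delta>] show ?thesis
      by (simp add: good_def n_def \<nu>_def)
  qed
  obtain D c where D: "finite D" "\<And>i. i \<in> D \<Longrightarrow> fst i \<in> X \<and> (\<exists>e. good (fst i) (snd i) e)"
    "\<And>i. i \<in> D \<Longrightarrow> cball (fst i) (1 / 3 ^ snd i / 4) \<subseteq> half_open_cube (c i) (1 / 3 ^ snd i)"
    "X \<subseteq> (\<Union>i\<in>D. half_open_cube (c i) (1 / 3 ^ snd i))"
    "\<And>y. card {i \<in> D. y \<in> half_open_cube (c i) (1 / 3 ^ snd i)} \<le> 2 ^ CARD('n)"
  proof (rule bounded_overlap_cube_cover[OF X(1), of "\<lambda>x k. \<exists>e. good x k e"])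
    show "\<exists>k e. good x k e" if "x \<in> X" for x by (rule ex[OF that])
  next
    fix D and c :: "(real ^ 'n) \<times> nat \<Rightarrow> real ^ 'n"
    assume "finite D" "\<And>i. i \<in> D \<Longrightarrow> fst i \<in> X \<and> (\<exists>e. good (fst i) (snd i) e)"
      "\<And>i. i \<in> D \<Longrightarrow> cball (fst i) (1 / 3 ^ snd i / 4) \<subseteq> half_open_cube (c i) (1 / 3 ^ snd i)"
      "X \<subseteq> (\<Union>i\<in>D. half_open_cube (c i) (1 / 3 ^ snd i))"
      "\<And>y. card {i \<in> D. y \<in> half_open_cube (c i) (1 / 3 ^ snd i)} \<le> 2 ^ CARD('n)"
    then show thesis by (rule that)
  qed
  define e where "e = (\<lambda>i. SOME e. good (fst i) (snd i) e)"
  have e: "good (fst i) (snd i) (e i)" if "i \<in> D" for i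
    unfolding e_def by (rule someI_ex[OF conjunct2[OF D(2)[OF that]]])
  define r where "r = (\<lambda>i::(real ^ 'n) \<times> nat. 1 / 3 ^ snd i :: real)"
  define Q where "Q = (\<lambda>i. half_open_cube (c i) (r i))"
  define B where "B = (\<lambda>i::(real ^ 'n) \<times> nat. cball (fst i) (1 / 3 ^ snd i / 4))"
  have BQ: "B i \<subseteq> Q i" if "i \<in> D" for i using D(3)[OF that] by (simp add: B_def Q_def r_def)
  have xQ: "fst i \<in> Q i" if "i \<in> D" for i
    by (rule subsetD[OF BQ[OF that]]) (simp add: B_def)
  have Qe: "Q i \<subseteq> S" "\<And>z. z \<in> Q i \<Longrightarrow> dist (g z) (g (fst i)) \<le> e i" if "i \<in> D" for i
  proof -
    have "Q i \<subseteq> cball (fst i) (n / 3 ^ snd i)"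
      using half_open_cube_subset_cball[OF xQ[OF that, unfolded Q_def]] by (simp add: Q_def r_def n_def)
    moreover have "cball (fst i) (n / 3 ^ snd i) \<subseteq> S"
      and "\<forall>z\<in>cball (fst i) (n / 3 ^ snd i). dist (g z) (g (fst i)) \<le> e i"
      using e[OF that] unfolding good_def by blast+
    ultimately show "Q i \<subseteq> S" "\<And>z. z \<in> Q i \<Longrightarrow> dist (g z) (g (fst i)) \<le> e i"
      by blast+
  qed
  define M :: real where "M = 2 ^ m"
  have M: "1 \<le> M" by (simp add: M_def)
  define u where "u = (\<lambda>z. ln (max 1 (min M (norm (g z)))))"
  define t where "t = (\<lambda>i::(real ^ 'n) \<times> nat. norm (g (fst i)))"
  define a where "a = (\<lambda>i. if t i \<le> 2 * M then 4 * e i / max 1 (t i) else 0)"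
  have nt: "\<bar>norm (g z) - t i\<bar> \<le> e i" if "i \<in> D" "z \<in> Q i" for i z
    using Qe(2)[OF that] norm_triangle_ineq3[of "g z" "g (fst i)"] by (simp add: t_def dist_norm)
  have osc: "\<bar>u z - u z'\<bar> \<le> a i" if i: "i \<in> D" and z: "z \<in> Q i" "z' \<in> Q i" for i z z'
  proof -
    have ei: "0 \<le> e i" "e i \<le> 1/4" using e[OF i] by (auto simp: good_def)
    show ?thesis
    proof (cases "t i \<le> 2 * M")
      case True
      then show ?thesis
        using ln_clip_diff_le[OF M ei True nt[OF i z(1)] nt[OF i z(2)]] by (simp add: u_def a_def)
    next
      case False
      then show ?thesis
        using ln_clip_eq[OF M ei(2) _ nt[OF i z(1)]] ln_clip_eq[OF M ei(2) _ nt[OF i z(2)]]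
        by (simp add: u_def a_def)
    qed
  qed
  interpret cube_cover_oscillation D c r N i1 i2 u a
  proof
    show "i1 \<noteq> i2" by (rule i12)
    show "finite D" by (rule D(1))
    show "0 < r i \<and> r i \<le> 1" for i by (simp add: r_def)
    show "half_open_cube (c i) (r i) \<inter> cbox (-3) 3 \<noteq> {}" if "i \<in> D" for i
      using xQ[OF that] D(2)[OF that] by (auto simp: Q_def X_def)
    show "cbox (-3) 3 \<subseteq> (\<Union>i\<in>D. half_open_cube (c i) (r i))"
      using D(4) by (simp add: X_def r_def)
    show "card {i \<in> D. y \<in> half_open_cube (c i) (r i)} \<le> N" for y
      using D(5) by (simp add: r_def N_def n_def)
    show "continuous_on (cbox (-3) 3) u"
      unfolding u_def X_def[symmetric]
      by (intro continuous_intros continuous_on_subset[OF S(3) X(2)]) auto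
    show "\<bar>u z - u z'\<bar> \<le> a i" if "i \<in> D" "z \<in> half_open_cube (c i) (r i) \<inter> cbox (-3) 3"
      "z' \<in> half_open_cube (c i) (r i) \<inter> cbox (-3) 3" for i z z'
      using osc[OF that(1)] that(2,3) by (simp add: Q_def)
  qed
  have lower: "(s1 - s0) * (m * ln 2) ^ n \<le> loewner_const n N * (\<Sum>i\<in>D. a i ^ n)"
    unfolding n_def
  proof (rule discrete_loewner[OF s01])
    show "0 \<le> m * ln (2::real)" by simp
    fix s assume "s0 \<le> s" "s \<le> s1"
    from sep[OF this] obtain p q where pq: "p \<in> cbox (-1) 1" "q \<in> cbox (-1) 1" "p $ i1 = s" "q $ i1 = s"
      "norm (g p) \<le> 1" "2 ^ m \<le> norm (g q)" by blast
    have "u p = 0" using pq(5) M by (simp add: u_def min_def max_def)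
    moreover have "u q = ln M" using pq(6) M by (simp add: u_def M_def[symmetric] min_absorb1 max_absorb2)
    moreover have "ln M = m * ln 2" by (simp add: M_def ln_realpow)
    ultimately show "\<exists>p q. p \<in> cbox (-1) 1 \<and> q \<in> cbox (-1) 1 \<and> p $ i1 = s \<and> q $ i1 = s \<and> m * ln 2 \<le> \<bar>u p - u q\<bar>"
      using pq(1-4) by (intro exI[of _ p] exI[of _ q]) simp
  qed
  define \<omega> where "\<omega> = measure lebesgue (ball (0 :: real ^ 'n) 1)"
  define G where "G = good_const K TYPE('n)"
  have G: "0 \<le> G" using K by (simp add: G_def good_const_def)
  define E where "E = N * (4 ^ n * G * (4 ^ n * \<omega> + 10 ^ n))"
  \<comment> \<open>The bound does not depend on \<open>k\<close>: the images of the balls of a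
    shell lie in a ball of radius \<open>4 * 2 ^ k\<close>, whose volume cancels the
    \<open>(2 ^ k) ^ n\<close> that comes from the slope of the logarithm.\<close>
  have shell: "(\<Sum>i | i \<in> D \<and> 2 ^ k \<le> max 1 (t i) \<and> max 1 (t i) < 2 ^ Suc k. a i ^ n) \<le> E" for k :: nat
  proof -
    define J where "J = {i. i \<in> D \<and> 2 ^ k \<le> max 1 (t i) \<and> max 1 (t i) < 2 ^ Suc k}"
    have J: "finite J" "J \<subseteq> D" using D(1) by (auto simp: J_def)
    have gB: "compact (g ` B i)" if "i \<in> J" for i
      unfolding B_def
      by (intro compact_continuous_image compact_cball continuous_on_subset[OF S(3)])
        (use BQ[of i] Qe(1)[of i] J that in \<open>auto simp: B_def\<close>)
    have s1: "(\<Sum>i\<in>J. measure lebesgue (g ` B i)) \<le> real N * measure lebesgue (ball (0 :: real ^ 'n) (4 * 2 ^ k))"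
    proof (rule sum_measure_le_overlap[OF J(1)])
      show "g ` B i \<in> lmeasurable" if "i \<in> J" for i using gB[OF that] by (rule lmeasurable_compact)
      show "g ` B i \<subseteq> ball 0 (4 * 2 ^ k)" if i: "i \<in> J" for i
      proof
        fix w assume "w \<in> g ` B i"
        then obtain z where z: "z \<in> Q i" "w = g z" using BQ[of i] i J by auto
        have "\<bar>norm w - t i\<bar> \<le> e i" "e i \<le> 1/4" using nt[of i z] z i J e[of i] by (auto simp: good_def)
        moreover have "t i < 2 * 2 ^ k" using i by (simp add: J_def)
        moreover have "1 \<le> (2::real) ^ k" by simp
        ultimately have "norm w < 4 * 2 ^ k" by linarith
        then show "w \<in> ball 0 (4 * 2 ^ k)" by simp
      qed
      \<comment> \<open>Injectivity of \<open>g\<close> carries the bounded overlap over to the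
        images.\<close>
      show "card {i \<in> J. y \<in> g ` B i} \<le> N" for y
      proof (cases "\<exists>i\<in>J. y \<in> g ` B i")
        case True
        then obtain i0 z where z: "i0 \<in> J" "z \<in> B i0" "y = g z" by auto
        have zS: "z \<in> S" using z BQ Qe(1) J by blast
        have "{i \<in> J. y \<in> g ` B i} \<subseteq> {i \<in> D. z \<in> half_open_cube (c i) (1 / 3 ^ snd i)}"
        proof
          fix i assume "i \<in> {i \<in> J. y \<in> g ` B i}"
          then obtain z' where i: "i \<in> J" "z' \<in> B i" "y = g z'" by auto
          have "z' \<in> S" using i BQ Qe(1) J by blast
          then have "z' = z" using S(4) zS i(3) z(3) by (auto dest: inj_onD)
          then show "i \<in> {i \<in> D. z \<in> half_open_cube (c i) (1 / 3 ^ snd i)}"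
            using i BQ[of i] J unfolding Q_def r_def by blast
        qed
        from card_mono[OF _ this] D(1) D(5)[of z] show ?thesis by (simp add: N_def n_def)
      next
        case False
        then have "{i \<in> J. y \<in> g ` B i} = {}" by blast
        then show ?thesis by (simp only: card.empty)
      qed
    qed simp
    have s2: "(\<Sum>i\<in>J. measure lebesgue (B i)) \<le> real N * measure lebesgue (cbox (-5) (5 :: real ^ 'n))"
    proof (rule sum_measure_le_overlap[OF J(1)])
      show "B i \<in> lmeasurable" for i by (simp add: B_def)
      show "B i \<subseteq> cbox (-5) 5" if i: "i \<in> J" for i
      proof
        fix z assume z: "z \<in> B i"
        have x: "fst i \<in> cbox (-3) 3" using D(2)[of i] i J by (auto simp: X_def)
        have "1 / 3 ^ snd i \<le> (1::real)" by simp
        then have "1 / 3 ^ snd i / 4 \<le> (1::real) / 4" by (rule divide_right_mono) simp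
        then have "1 / 3 ^ snd i / 4 \<le> (1::real)" by (rule order_trans) simp
        then have "norm (fst i - z) \<le> 1" using z unfolding B_def mem_cball dist_norm by linarith
        have "-5 \<le> z $ j \<and> z $ j \<le> 5" for j
        proof -
          have "\<bar>fst i $ j - z $ j\<bar> \<le> 1"
            using component_le_norm_cart[of "fst i - z" j] \<open>norm (fst i - z) \<le> 1\<close> by simp
          moreover have "-3 \<le> fst i $ j \<and> fst i $ j \<le> 3" using x by (simp add: mem_box_cart)
          ultimately show ?thesis by linarith
        qed
        then show "z \<in> cbox (-5) 5" by (simp add: mem_box_cart)
      qed
      show "card {i \<in> J. y \<in> B i} \<le> N" for y
      proof -
        have "{i \<in> J. y \<in> B i} \<subseteq> {i \<in> D. y \<in> half_open_cube (c i) (1 / 3 ^ snd i)}"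
          using BQ J unfolding Q_def r_def by blast
        from card_mono[OF _ this] D(1) D(5)[of y] show ?thesis by (simp add: N_def n_def)
      qed
    qed simp
    have vb: "measure lebesgue (ball (0 :: real ^ 'n) (4 * 2 ^ k)) = (4 * 2 ^ k) ^ n * \<omega>"
      using content_ball_conv_unit_ball[of "4 * 2 ^ k" "0 :: real ^ 'n"] by (simp add: n_def \<omega>_def)
    have vc: "measure lebesgue (cbox (-5) (5 :: real ^ 'n)) = 10 ^ n"
    proof -
      have "cbox (-5) (5 :: real ^ 'n) \<noteq> {}" by (simp add: interval_ne_empty_cart)
      from content_cbox_cart[OF this] show ?thesis by (simp add: n_def)
    qed
    have "(\<Sum>i\<in>J. a i ^ n) \<le> (\<Sum>i\<in>J. 4 ^ n * G / (2 ^ k) ^ n * (measure lebesgue (g ` B i) + measure lebesgue (B i)))"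
    proof (rule sum_mono)
      fix i assume i: "i \<in> J"
      then have gi: "0 \<le> e i" "e i ^ n \<le> G * (measure lebesgue (g ` B i) + measure lebesgue (B i))"
        using e[of i] J by (auto simp: good_def G_def \<nu>_def B_def split_beta)
      have "a i \<le> 4 * e i / 2 ^ k"
      proof (cases "t i \<le> 2 * M")
        case True
        then show ?thesis using i gi by (auto simp: a_def J_def intro!: divide_left_mono)
      next
        case False
        then show ?thesis using gi by (simp add: a_def)
      qed
      moreover have "0 \<le> a i" using gi by (simp add: a_def)
      ultimately have "a i ^ n \<le> (4 * e i / 2 ^ k) ^ n" by (intro power_mono)
      also have "\<dots> = 4 ^ n / (2 ^ k) ^ n * e i ^ n" by (simp add: power_divide power_mult_distrib)
      also have "\<dots> \<le> 4 ^ n / (2 ^ k) ^ n * (G * (measure lebesgue (g ` B i) + measure lebesgue (B i)))"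
        using gi by (intro mult_left_mono) auto
      finally show "a i ^ n \<le> 4 ^ n * G / (2 ^ k) ^ n * (measure lebesgue (g ` B i) + measure lebesgue (B i))"
        by (simp add: mult.assoc)
    qed
    also have "\<dots> = 4 ^ n * G / (2 ^ k) ^ n * ((\<Sum>i\<in>J. measure lebesgue (g ` B i)) + (\<Sum>i\<in>J. measure lebesgue (B i)))"
      by (simp only: sum_distrib_left sum.distrib[symmetric])
    also have "\<dots> \<le> 4 ^ n * G / (2 ^ k) ^ n * (real N * ((4 * 2 ^ k) ^ n * \<omega>) + real N * 10 ^ n)"
      using s1 s2 G unfolding vb vc by (intro mult_left_mono add_mono) auto
    also have "\<dots> \<le> 4 ^ n * G / (2 ^ k) ^ n * (N * ((4 ^ n * \<omega> + 10 ^ n) * (2 ^ k) ^ n))"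
    proof (rule mult_left_mono)
      have "1 \<le> ((2::real) ^ k) ^ n" by simp
      then have "real N * 10 ^ n * 1 \<le> real N * 10 ^ n * (2 ^ k) ^ n" by (intro mult_left_mono) auto
      moreover have "real N * ((4 ^ n * \<omega> + 10 ^ n) * (2 ^ k) ^ n) = real N * ((4 * 2 ^ k) ^ n * \<omega>) + real N * 10 ^ n * (2 ^ k) ^ n"
        by (simp add: power_mult_distrib algebra_simps)
      ultimately show "real N * ((4 * 2 ^ k) ^ n * \<omega>) + real N * 10 ^ n \<le> real N * ((4 ^ n * \<omega> + 10 ^ n) * (2 ^ k) ^ n)"
        by linarith
      show "0 \<le> 4 ^ n * G / (2 ^ k) ^ n" using G by simp
    qed
    also have "\<dots> = E"
      by (simp add: E_def)
    finally show ?thesis by (simp add: J_def)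
  qed
  \<comment> \<open>Only cubes with \<open>t i\<close> at most \<open>2 * M = 2 ^ (m + 1)\<close>
    contribute, and they lie in the shells \<open>k\<close> up to \<open>m + 1\<close>.\<close>
  have upper: "(\<Sum>i\<in>D. a i ^ n) \<le> (m + 2) * E"
  proof -
    have "(\<Sum>i\<in>D. a i ^ n) \<le> (\<Sum>i\<in>D. \<Sum>k<m+2. if 2 ^ k \<le> max 1 (t i) \<and> max 1 (t i) < 2 ^ Suc k then a i ^ n else 0)"
    proof (rule sum_mono)
      fix i assume i: "i \<in> D"
      have a0: "0 \<le> a i" by (rule osc_nonneg[OF i])
      show "a i ^ n \<le> (\<Sum>k<m+2. if 2 ^ k \<le> max 1 (t i) \<and> max 1 (t i) < 2 ^ Suc k then a i ^ n else 0)"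
      proof (cases "t i \<le> 2 * M")
        case True
        have "max 1 (t i) < 2 ^ (m + 2)"
        proof -
          have "(1::real) \<le> 2 ^ m" by simp
          moreover have "t i \<le> 2 * 2 ^ m" using True by (simp add: M_def)
          ultimately have "1 < 4 * (2::real) ^ m \<and> t i < 4 * 2 ^ m" by linarith
          then show ?thesis by (simp add: power_add mult.commute)
        qed
        define k where "k = (LEAST k. max 1 (t i) < 2 ^ Suc k)"
        have ex: "max 1 (t i) < 2 ^ Suc (m + 1)" using \<open>max 1 (t i) < 2 ^ (m + 2)\<close> by simp
        have k1: "max 1 (t i) < 2 ^ Suc k" unfolding k_def by (rule LeastI[of _ "m + 1"]) (rule ex)
        have k2: "k \<le> m + 1" unfolding k_def by (rule Least_le) (rule ex)
        have k3: "2 ^ k \<le> max 1 (t i)"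
        proof (cases k)
          case (Suc l)
          then have "\<not> max 1 (t i) < 2 ^ Suc l"
            using not_less_Least[of l "\<lambda>k. max 1 (t i) < 2 ^ Suc k"] by (simp add: k_def)
          then show ?thesis using Suc by (simp only: not_less)
        qed simp
        have "a i ^ n = (if 2 ^ k \<le> max 1 (t i) \<and> max 1 (t i) < 2 ^ Suc k then a i ^ n else 0)"
          using k1 k3 by simp
        also have "\<dots> \<le> (\<Sum>k<m+2. if 2 ^ k \<le> max 1 (t i) \<and> max 1 (t i) < 2 ^ Suc k then a i ^ n else 0)"
          using k2 a0 by (intro member_le_sum) auto
        finally show ?thesis .
      next
        case False
        then have "a i ^ n = 0" using n by (simp add: a_def)
        moreover have "0 \<le> (\<Sum>k<m+2. if 2 ^ k \<le> max 1 (t i) \<and> max 1 (t i) < 2 ^ Suc k then a i ^ n else 0)"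
          using a0 by (intro sum_nonneg) auto
        ultimately show ?thesis by linarith
      qed
    qed
    also have "\<dots> = (\<Sum>k<m+2. \<Sum>i\<in>D. if 2 ^ k \<le> max 1 (t i) \<and> max 1 (t i) < 2 ^ Suc k then a i ^ n else 0)"
      by (rule sum.swap)
    also have "\<dots> = (\<Sum>k<m+2. \<Sum>i | i \<in> D \<and> 2 ^ k \<le> max 1 (t i) \<and> max 1 (t i) < 2 ^ Suc k. a i ^ n)"
      by (rule sum.cong[OF refl]) (rule sum.inter_filter[OF D(1), symmetric])
    also have "\<dots> \<le> (\<Sum>k<m+2. E)" by (intro sum_mono shell)
    also have "\<dots> = (m + 2) * E" by simp
    finally show ?thesis .
  qed
  define L where "L = loewner_const n N"
  have L: "0 \<le> L"
    unfolding L_def loewner_const_def n_def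
    by (intro mult_nonneg_nonneg zero_le_power add_nonneg_nonneg path_const_nonneg shell_const_nonneg) auto
  have E0: "0 \<le> E" using G by (simp add: E_def \<omega>_def)
  have "(s1 - s0) * (real m * (1/2)) ^ n \<le> (s1 - s0) * (m * ln 2) ^ n"
  proof (intro mult_left_mono power_mono)
    show "1 / 2 \<le> ln (2::real)" using ln_ge_iff[of "2::real" "1/2"] exp_half_le2 by simp
  qed (use s01 in auto)
  also have "\<dots> \<le> L * ((m + 2) * E)"
    using lower mult_left_mono[OF upper L] by (simp add: L_def)
  also have "\<dots> \<le> L * (3 * m * E)"
    using m E0 L by (intro mult_left_mono mult_right_mono) auto
  finally have fin: "(s1 - s0) * (real m * (1/2)) ^ n \<le> L * (3 * m * E)" .
  have "(s1 - s0) * real m ^ (n - 1) * (m / 2 ^ n) = (s1 - s0) * (real m * (1/2)) ^ n"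
  proof -
    have "real m ^ n = real m ^ (n - 1) * m" using n by (cases n) auto
    moreover have "(real m * (1 / 2)) ^ n = real m ^ n * (1 / 2 ^ n)"
      unfolding power_mult_distrib by (simp only: power_one_over)
    ultimately show ?thesis by (simp only: mult.assoc) simp
  qed
  also have "\<dots> \<le> 3 * L * (2 ^ n * E) * (m / 2 ^ n)"
  proof -
    have "3 * L * (2 ^ n * E) * (m / 2 ^ n) = L * (3 * m * E)" by simp
    then show ?thesis using fin by (simp only:)
  qed
  finally have "(s1 - s0) * real m ^ (n - 1) \<le> 3 * L * (2 ^ n * E)"
    by (rule mult_right_le_imp_le) (use m in simp)
  also have "\<dots> = 3 * L * 2 ^ n * energy_const K TYPE('n)"
    by (simp add: E_def energy_const_def G_def \<omega>_def n_def N_def mult_ac)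
  finally show ?thesis by (simp add: L_def n_def N_def)
qed

section \<open>The distortion estimate along an arc\<close>

lemma quasiround_on_similarity:
  fixes f :: "'a::metric_space \<Rightarrow> 'b::real_normed_vector" and A :: "'c::metric_space \<Rightarrow> 'a"
  assumes "quasiround_on K S f" "0 < \<rho>" "\<And>u v. dist (A u) (A v) = \<rho> * dist u v" "0 < l"
  shows "quasiround_on K (A -` S) (\<lambda>u. (1 / l) *\<^sub>R (f (A u) - c))"
  unfolding quasiround_on_def
proof
  fix x assume "x \<in> A -` S"
  then have "A x \<in> S" by simp
  then obtain \<delta> where \<delta>: "0 < \<delta>" "\<And>s y z. 0 < s \<Longrightarrow> s < \<delta> \<Longrightarrow> dist (A x) y = s \<Longrightarrow> dist (A x) z = s \<Longrightarrow>
      dist (f y) (f (A x)) \<le> K * dist (f z) (f (A x))"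
    using assms(1) unfolding quasiround_on_def by meson
  have d: "dist ((1 / l) *\<^sub>R (f (A u) - c)) ((1 / l) *\<^sub>R (f (A v) - c)) = dist (f (A u)) (f (A v)) / l" for u v
    using assms(4) by (simp add: dist_norm flip: scaleR_diff_right)
  show "\<exists>\<delta>>0. \<forall>s y z. 0 < s \<and> s < \<delta> \<and> dist x y = s \<and> dist x z = s \<longrightarrow>
      dist ((1 / l) *\<^sub>R (f (A y) - c)) ((1 / l) *\<^sub>R (f (A x) - c))
      \<le> K * dist ((1 / l) *\<^sub>R (f (A z) - c)) ((1 / l) *\<^sub>R (f (A x) - c))"
  proof (intro exI[of _ "\<delta> / \<rho>"] conjI allI impI)
    show "0 < \<delta> / \<rho>" using \<delta> assms(2) by simp
    fix s y z assume s: "0 < s \<and> s < \<delta> / \<rho> \<and> dist x y = s \<and> dist x z = s"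
    have "dist (f (A y)) (f (A x)) \<le> K * dist (f (A z)) (f (A x))"
    proof (rule \<delta>(2)[of "\<rho> * s"])
      show "0 < \<rho> * s" using s assms(2) by simp
      show "\<rho> * s < \<delta>" using s assms(2) by (simp add: pos_less_divide_eq mult.commute)
      show "dist (A x) (A y) = \<rho> * s" "dist (A x) (A z) = \<rho> * s" using s assms(3) by simp_all
    qed
    then have "dist (f (A y)) (f (A x)) / l \<le> K * dist (f (A z)) (f (A x)) / l"
      using assms(4) by (intro divide_right_mono) auto
    then show "dist ((1 / l) *\<^sub>R (f (A y) - c)) ((1 / l) *\<^sub>R (f (A x) - c))
      \<le> K * dist ((1 / l) *\<^sub>R (f (A z) - c)) ((1 / l) *\<^sub>R (f (A x) - c))"
      unfolding d by simp
  qed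
qed

section \<open>Continua and their projections to a line\<close>

lemma connected_inner_value:
  fixes E :: "'a::real_inner set"
  assumes "connected E" "p \<in> E" "q \<in> E" "\<theta> \<bullet> (p - x) \<le> s" "s \<le> \<theta> \<bullet> (q - x)"
  shows "\<exists>z\<in>E. \<theta> \<bullet> (z - x) = s"
proof -
  have "connected ((\<lambda>z. \<theta> \<bullet> (z - x)) ` E)"
    using assms(1) by (intro connected_continuous_image continuous_intros)
  then have "{\<theta> \<bullet> (p - x)..\<theta> \<bullet> (q - x)} \<subseteq> (\<lambda>z. \<theta> \<bullet> (z - x)) ` E"
    using assms(2,3) by (intro connected_contains_Icc imageI)
  then have "s \<in> (\<lambda>z. \<theta> \<bullet> (z - x)) ` E" using assms(4,5) by auto
  then show ?thesis by auto
qed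

text \<open>Used to find a line to which both the arc and the escaping continuum project well. It
  bisects the angle of \<open>e\<close> with \<open>w\<close> or \<open>- w\<close>, whichever is at
  most a right angle; the cosine of 45 degrees exceeds 7/10.\<close>

lemma ex_bisecting_direction:
  fixes e w :: "'a::real_inner"
  assumes "norm e = 1" "w \<noteq> 0"
  obtains \<theta> where "norm \<theta> = 1" "7/10 \<le> \<theta> \<bullet> e" "7/10 * norm w \<le> \<bar>\<theta> \<bullet> w\<bar>"
proof -
  define v where "v = (1 / norm w) *\<^sub>R w"
  define \<sigma> :: real where "\<sigma> = (if 0 \<le> e \<bullet> v then 1 else -1)"
  have nv: "norm v = 1" using assms(2) by (simp add: v_def)
  have \<sigma>: "\<sigma> * \<sigma> = 1" "0 \<le> \<sigma> * (e \<bullet> v)" "\<bar>\<sigma>\<bar> = 1" by (auto simp: \<sigma>_def)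
  define m where "m = e + \<sigma> *\<^sub>R v"
  have ee: "e \<bullet> e = 1" "v \<bullet> v = 1" using assms(1) nv by (simp_all add: norm_eq_1)
  have me: "m \<bullet> e = 1 + \<sigma> * (e \<bullet> v)" "m \<bullet> v = \<sigma> * (1 + \<sigma> * (e \<bullet> v))"
    using ee \<sigma>(1) by (simp_all add: m_def inner_add_left inner_commute algebra_simps mult.assoc[symmetric])
  define b where "b = 1 + \<sigma> * (e \<bullet> v)"
  have b: "1 \<le> b" using \<sigma> by (simp add: b_def)
  have "m \<bullet> m = m \<bullet> e + \<sigma> * (m \<bullet> v)"
    by (subst (2) m_def) (simp add: inner_add_right)
  also have "\<dots> = b + \<sigma> * \<sigma> * b" unfolding me b_def[symmetric] by simp
  finally have mm: "norm m ^ 2 = 2 * b" unfolding \<sigma>(1) by (simp add: power2_norm_eq_inner)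
  have m0: "0 < norm m" using mm b by (cases "norm m = 0") auto
  define k where "k = b / norm m"
  have k0: "0 \<le> k" using b m0 by (simp add: k_def)
  have k2: "k ^ 2 = b / 2" unfolding k_def power_divide mm using b by (simp add: power2_eq_square)
  have k: "7/10 \<le> k"
  proof (rule power2_le_imp_le[OF _ k0])
    show "(7/10)\<^sup>2 \<le> k ^ 2" unfolding k2 using b by (simp add: power2_eq_square)
  qed
  define \<theta> where "\<theta> = (1 / norm m) *\<^sub>R m"
  have "norm \<theta> = 1" using m0 by (simp add: \<theta>_def)
  moreover have "\<theta> \<bullet> e = k" by (simp add: \<theta>_def me k_def b_def)
  moreover have "\<bar>\<theta> \<bullet> w\<bar> = k * norm w"
  proof -
    have "w = norm w *\<^sub>R v" using assms(2) by (simp add: v_def)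
    then have "\<theta> \<bullet> w = norm w * (\<theta> \<bullet> v)" by (metis inner_scaleR_right)
    also have "\<theta> \<bullet> v = \<sigma> * k" by (simp add: \<theta>_def me k_def b_def)
    finally show ?thesis using \<sigma>(3) k0 by (simp add: abs_mult)
  qed
  moreover have "7/10 * norm w \<le> k * norm w" using k by (rule mult_right_mono) simp
  ultimately show thesis using that[of \<theta>] k by simp
qed

text \<open>The set is the preimage of the ray from \<open>f y\<close> pointing away from \<open>f x\<close>, up to its exit from
  \<open>f ` cball x \<rho>\<close>.\<close>

lemma ex_escaping_continuum:
  fixes f :: "'a::euclidean_space \<Rightarrow> 'a"
  assumes "continuous_on (cball x \<rho>) f" "inj_on f (cball x \<rho>)" "dist x y < \<rho>" "y \<noteq> x"
  obtains F z where "connected F" "F \<subseteq> cball x \<rho>" "y \<in> F" "z \<in> F" "dist x z = \<rho>"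
    "\<And>q. q \<in> F \<Longrightarrow> dist (f y) (f x) \<le> dist (f q) (f x)"
proof -
  have yb: "y \<in> ball x \<rho>" using assms(3) by simp
  define \<phi> where "\<phi> = (\<lambda>\<tau>::real. f y + \<tau> *\<^sub>R (f y - f x))"
  have c\<phi>: "continuous_on A \<phi>" for A unfolding \<phi>_def by (intro continuous_intros)
  have "x \<in> cball x \<rho>" using yb by (auto intro: order_trans[OF zero_le_dist less_imp_le])
  then have ne: "f y \<noteq> f x" using inj_onD[OF assms(2), of y x] yb assms(4) by auto
  have d\<phi>: "dist (\<phi> \<tau>) (f x) = (1 + \<tau>) * dist (f y) (f x)" if "0 \<le> \<tau>" for \<tau>
  proof -
    have "\<phi> \<tau> - f x = (1 + \<tau>) *\<^sub>R (f y - f x)" by (simp add: \<phi>_def scaleR_add_left)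
    then show ?thesis using that by (simp add: dist_norm)
  qed
  define V where "V = f ` ball x \<rho>"
  define C where "C = f ` cball x \<rho>"
  have V: "open V"
    unfolding V_def
    by (rule invariance_of_domain[OF continuous_on_subset[OF assms(1) ball_subset_cball] open_ball
          inj_on_subset[OF assms(2) ball_subset_cball]])
  have C: "compact C" unfolding C_def by (rule compact_continuous_image[OF assms(1) compact_cball])
  have VC: "V \<subseteq> C" unfolding V_def C_def by (rule image_mono[OF ball_subset_cball])
  obtain R where R: "\<And>v. v \<in> C \<Longrightarrow> dist v (f x) \<le> R"
    using compact_imp_bounded[OF C] unfolding bounded_any_center[where a = "f x"] by (metis dist_commute)
  \<comment> \<open>The infimum of \<open>Z\<close> is the first parameter at which the ray is
    outside the image of the open ball. Up to there the ray stays in the closure of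
    \<open>V\<close>, hence in \<open>C\<close>, where the inverse of \<open>f\<close> is
    continuous.\<close>
  define Z where "Z = {0..} \<inter> \<phi> -` (- V)"
  have clZ: "closed Z"
    unfolding Z_def using V by (intro continuous_closed_preimage[OF c\<phi>]) auto
  have Zne: "Z \<noteq> {}"
  proof -
    define \<tau> where "\<tau> = (\<bar>R\<bar> + 1) / dist (f y) (f x)"
    have "0 \<le> \<tau>" by (simp add: \<tau>_def)
    moreover have "(1 + \<tau>) * dist (f y) (f x) > R"
    proof -
      have "\<tau> * dist (f y) (f x) = \<bar>R\<bar> + 1" using ne by (simp add: \<tau>_def)
      then have "(1 + \<tau>) * dist (f y) (f x) = dist (f y) (f x) + (\<bar>R\<bar> + 1)"
        by (simp only: distrib_right mult_1_left)
      moreover have "0 \<le> dist (f y) (f x)" by (rule zero_le_dist)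
      ultimately show ?thesis by linarith
    qed
    ultimately have "\<phi> \<tau> \<notin> C" using R[of "\<phi> \<tau>"] d\<phi>[of \<tau>] by fastforce
    then show ?thesis using \<open>0 \<le> \<tau>\<close> VC by (auto simp: Z_def)
  qed
  have bZ: "bdd_below Z" by (rule bdd_belowI[of _ 0]) (simp add: Z_def)
  define T where "T = Inf Z"
  have TZ: "T \<in> Z" unfolding T_def by (rule closed_contains_Inf[OF Zne bZ clZ])
  have T0: "0 \<le> T" using TZ by (simp add: Z_def)
  have before: "\<phi> \<tau> \<in> V" if "0 \<le> \<tau>" "\<tau> < T" for \<tau>
  proof (rule ccontr)
    assume "\<phi> \<tau> \<notin> V"
    then have "\<tau> \<in> Z" using that by (simp add: Z_def)
    then have "T \<le> \<tau>" unfolding T_def by (rule cInf_lower[OF _ bZ])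
    then show False using that by simp
  qed
  have "\<phi> 0 \<in> V" using yb by (simp add: \<phi>_def V_def)
  then have "T \<noteq> 0" using TZ by (auto simp: Z_def)
  then have Tpos: "0 < T" using T0 by simp
  have "\<phi> ` {0..T} \<subseteq> closure V"
  proof -
    have "{0..T} = closure {0..<T}" using Tpos by simp
    moreover have "\<phi> ` closure {0..<T} \<subseteq> closure V"
    proof (rule image_closure_subset[OF c\<phi>])
      show "\<phi> ` {0..<T} \<subseteq> closure V" using before closure_subset[of V] by auto
    qed simp
    ultimately show ?thesis by simp
  qed
  also have "closure V \<subseteq> C" by (rule closure_minimal[OF VC compact_imp_closed[OF C]])
  finally have sub: "\<phi> ` {0..T} \<subseteq> C" .
  define g where "g = inv_into (cball x \<rho>) f"
  have gf: "g (f u) = u" if "u \<in> cball x \<rho>" for u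
    unfolding g_def by (rule inv_into_f_f[OF assms(2) that])
  have fg: "f (g v) = v" "g v \<in> cball x \<rho>" if "v \<in> C" for v
    using that unfolding g_def C_def by (rule f_inv_into_f, rule inv_into_into)
  have cg: "continuous_on C g"
    unfolding C_def using gf by (intro continuous_on_inv[OF assms(1) compact_cball]) blast
  define F where "F = g ` \<phi> ` {0..T}"
  have F1: "connected F"
    unfolding F_def
    by (intro connected_continuous_image continuous_on_subset[OF cg sub] c\<phi>) simp
  have F2: "F \<subseteq> cball x \<rho>" unfolding F_def using fg(2) sub by blast
  have F3: "y \<in> F"
  proof -
    have "g (\<phi> 0) = y" using gf[of y] yb by (simp add: \<phi>_def)
    moreover have "g (\<phi> 0) \<in> F" unfolding F_def using T0 by (intro imageI) simp
    ultimately show ?thesis by simp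
  qed
  have F4: "g (\<phi> T) \<in> F" unfolding F_def using T0 by (intro imageI) simp
  have \<phi>T: "\<phi> T \<in> C" "\<phi> T \<notin> V" using sub T0 TZ by (auto simp: Z_def)
  have F5: "dist x (g (\<phi> T)) = \<rho>"
  proof (rule ccontr)
    assume "dist x (g (\<phi> T)) \<noteq> \<rho>"
    then have "g (\<phi> T) \<in> ball x \<rho>" using fg(2)[OF \<phi>T(1)] by simp
    then have "f (g (\<phi> T)) \<in> V" unfolding V_def by (rule imageI)
    then show False using fg(1)[OF \<phi>T(1)] \<phi>T(2) by simp
  qed
  have F6: "dist (f y) (f x) \<le> dist (f q) (f x)" if q: "q \<in> F" for q
  proof -
    obtain \<tau> where "\<tau> \<in> {0..T}" "q = g (\<phi> \<tau>)" using q unfolding F_def by blast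
    then have \<tau>: "0 \<le> \<tau>" "\<tau> \<le> T" "q = g (\<phi> \<tau>)" by auto
    then have "\<phi> \<tau> \<in> C" using sub by auto
    then have "dist (f q) (f x) = (1 + \<tau>) * dist (f y) (f x)" using fg(1) \<tau> d\<phi> by simp
    then show ?thesis using \<tau>(1) by (simp add: distrib_right)
  qed
  show thesis by (rule that[OF F1 F2 F3 F4 F5 F6])
qed

section \<open>Variation along a trajectory\<close>

lemma vector_mean_value_bound:
  fixes w :: "real \<Rightarrow> 'a::real_normed_vector"
  assumes "s \<le> t" "\<And>\<tau>. s \<le> \<tau> \<Longrightarrow> \<tau> \<le> t \<Longrightarrow> (w has_vector_derivative w' \<tau>) (at \<tau>)"
    and "\<And>\<tau>. s \<le> \<tau> \<Longrightarrow> \<tau> \<le> t \<Longrightarrow> norm (w' \<tau>) \<le> B"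
  shows "norm (w t - w s) \<le> B * (t - s)"
proof -
  have "norm (w t - w s) \<le> B * norm (t - s)"
  proof (rule differentiable_bound[of "{s..t}" w "\<lambda>\<tau> h. h *\<^sub>R w' \<tau>"])
    show "(w has_derivative (\<lambda>h. h *\<^sub>R w' \<tau>)) (at \<tau> within {s..t})" if "\<tau> \<in> {s..t}" for \<tau>
      using assms(2)[of \<tau>] that has_derivative_at_withinI unfolding has_vector_derivative_def by fastforce
    show "onorm (\<lambda>h. h *\<^sub>R w' \<tau>) \<le> B" if "\<tau> \<in> {s..t}" for \<tau>
      using assms(3)[of \<tau>] that by (intro onorm_le) (auto simp: mult.commute[of B] intro: mult_left_mono)
  qed (use assms(1) in auto)
  then show ?thesis using assms(1) by simp
qed

text \<open>Steps of length \<open>h\<close> are as long as the shift in \<open>V\<close>, so the increments of \<open>V\<close> telescope.\<close>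

lemma shifted_increment_bound:
  fixes w :: "real \<Rightarrow> 'a::real_normed_vector" and V :: "real \<Rightarrow> real"
  assumes h: "0 < h" "2 * h \<le> t1" and M: "0 \<le> M"
    and der: "\<And>\<tau>. 2 * h \<le> \<tau> \<Longrightarrow> \<tau> \<le> t1 \<Longrightarrow> (w has_vector_derivative w' \<tau>) (at \<tau>)"
    and bd: "\<And>\<tau>. 2 * h \<le> \<tau> \<Longrightarrow> \<tau> \<le> t1 \<Longrightarrow> norm (w' \<tau>) \<le> M * (V (\<tau> + h) - V (\<tau> - h))"
    and mono: "\<And>p q. h \<le> p \<Longrightarrow> p \<le> q \<Longrightarrow> V p \<le> V q"
    and small: "\<And>p q. h \<le> p \<Longrightarrow> p \<le> q \<Longrightarrow> V q - V p \<le> \<kappa>"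
  shows "norm (w t1 - w (2 * h)) \<le> M * h * (3 * \<kappa>)"
proof -
  define v where "v = (\<lambda>k::nat. V (k * h))"
  \<comment> \<open>Cutting off at \<open>t1\<close> makes all later steps trivial.\<close>
  define \<tau> where "\<tau> = (\<lambda>k::nat. min (real (k + 2) * h) t1)"
  have step: "norm (w (\<tau> (Suc k)) - w (\<tau> k)) \<le> M * h * (v (k + 4) - v (k + 1))" for k
  proof -
    have vle: "v (k + 1) \<le> v (k + 4)"
      unfolding v_def using h by (intro mono) auto
    define L where "L = M * (v (k + 4) - v (k + 1))"
    have L: "0 \<le> L" using vle M by (simp add: L_def)
    have "norm (w (\<tau> (Suc k)) - w (\<tau> k)) \<le> L * h"
    proof (cases "real (k + 2) * h \<le> t1")
      case True
      then have \<tau>k: "\<tau> k = real (k + 2) * h" by (simp only: \<tau>_def min_absorb1)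
      have k1: "real (Suc k + 2) * h = real (k + 2) * h + h" by (simp add: algebra_simps)
      have ord: "\<tau> k \<le> \<tau> (Suc k)" "\<tau> (Suc k) - \<tau> k \<le> h"
        using h True k1 unfolding \<tau>k by (auto simp: \<tau>_def)
      have "norm (w (\<tau> (Suc k)) - w (\<tau> k)) \<le> L * (\<tau> (Suc k) - \<tau> k)"
      proof (rule vector_mean_value_bound[OF ord(1)])
        fix \<sigma> assume \<sigma>: "\<tau> k \<le> \<sigma>" "\<sigma> \<le> \<tau> (Suc k)"
        have kh: "0 \<le> real k * h" "real (k + 2) * h = real k * h + 2 * h"
          "real (k + 4) * h = real k * h + 4 * h" "real (k + 1) * h = real k * h + h"
          "real (Suc k + 2) * h = real k * h + 3 * h"
          using h by (simp_all add: distrib_right)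
        have "\<tau> (Suc k) \<le> real (Suc k + 2) * h" "\<tau> (Suc k) \<le> t1" by (simp_all add: \<tau>_def)
        then have s2: "\<sigma> \<le> real k * h + 3 * h" "\<sigma> \<le> t1"
          using \<sigma>(2) unfolding kh(5) by (blast intro: order_trans)+
        have s1: "real k * h + 2 * h \<le> \<sigma>" using \<sigma>(1) unfolding \<tau>k kh(2) .
        then have "2 * h \<le> \<sigma>" using kh(1) by linarith
        note s = this s2(2) s1 s2(1)
        show "(w has_vector_derivative w' \<sigma>) (at \<sigma>)" by (rule der[OF s(1,2)])
        have "V (\<sigma> + h) \<le> v (k + 4)" "v (k + 1) \<le> V (\<sigma> - h)"
          unfolding v_def kh(3,4) by (rule mono; use h s kh(1) in linarith)+
        then have "M * (V (\<sigma> + h) - V (\<sigma> - h)) \<le> L"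
          unfolding L_def using M by (intro mult_left_mono) auto
        then show "norm (w' \<sigma>) \<le> L" using bd[OF s(1,2)] by linarith
      qed
      also have "\<dots> \<le> L * h" using ord L by (intro mult_left_mono)
      finally show ?thesis .
    next
      case False
      moreover have "real (k + 2) * h \<le> real (Suc k + 2) * h" using h by (intro mult_right_mono) auto
      ultimately have "\<tau> (Suc k) = t1" "\<tau> k = t1" unfolding \<tau>_def by linarith+
      then show ?thesis using L h by simp
    qed
    then show ?thesis by (simp add: L_def mult_ac)
  qed
  \<comment> \<open>Each increment of \<open>v\<close> spans three steps, so the sum telescopes into
    three chains; hence the 3 in the conclusion.\<close>
  have ind: "norm (w (\<tau> k) - w (\<tau> 0)) \<le> M * h * (v (k + 3) + v (k + 2) + v (k + 1) - (v 3 + v 2 + v 1))" for k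
  proof (induction k)
    case (Suc k)
    have "norm (w (\<tau> (Suc k)) - w (\<tau> 0)) \<le> norm (w (\<tau> (Suc k)) - w (\<tau> k)) + norm (w (\<tau> k) - w (\<tau> 0))"
      using norm_triangle_ineq[of "w (\<tau> (Suc k)) - w (\<tau> k)" "w (\<tau> k) - w (\<tau> 0)"] by simp
    also have "\<dots> \<le> M * h * (v (k + 4) - v (k + 1))
        + M * h * (v (k + 3) + v (k + 2) + v (k + 1) - (v 3 + v 2 + v 1))"
      using step[of k] Suc.IH by (rule add_mono)
    also have "\<dots> = M * h * (v (k + 4) + v (k + 3) + v (k + 2) - (v 3 + v 2 + v 1))"
      by (simp only: distrib_left[symmetric]) simp
    also have "\<dots> = M * h * (v (Suc k + 3) + v (Suc k + 2) + v (Suc k + 1) - (v 3 + v 2 + v 1))"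
    proof -
      have "Suc k + 3 = k + 4" "Suc k + 2 = k + 3" "Suc k + 1 = k + 2" by simp_all
      then show ?thesis by (simp only:)
    qed
    finally show ?case .
  qed (simp add: numeral_2_eq_2 numeral_3_eq_3)
  obtain K :: nat where "t1 / h \<le> real K" using real_arch_simple by blast
  then have "t1 \<le> real K * h" using h by (simp add: pos_divide_le_eq)
  then have "t1 \<le> real (K + 2) * h" using h by (simp add: distrib_right)
  then have K: "\<tau> K = t1" "\<tau> 0 = 2 * h" using h unfolding \<tau>_def by (simp_all add: min_def)
  have sm: "v (K + j) - v j \<le> \<kappa>" if "1 \<le> j" for j
    unfolding v_def
  proof (rule small)
    show "h \<le> real j * h" using that h by simp
    show "real j * h \<le> real (K + j) * h" using h by (intro mult_right_mono) auto
  qed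
  have "v (K + 3) + v (K + 2) + v (K + 1) - (v 3 + v 2 + v 1) \<le> 3 * \<kappa>"
    using sm[of 3] sm[of 2] sm[of 1] by simp
  then have "M * h * (v (K + 3) + v (K + 2) + v (K + 1) - (v 3 + v 2 + v 1)) \<le> M * h * (3 * \<kappa>)"
    using M h by (intro mult_left_mono) auto
  then show ?thesis using ind[of K] unfolding K by linarith
qed

section \<open>The variation as a function of time\<close>

definition path_partition :: "real \<Rightarrow> nat \<Rightarrow> (nat \<Rightarrow> real) \<Rightarrow> bool" where
  "path_partition t N p \<longleftrightarrow> p 0 = 0 \<and> p N = t \<and> (\<forall>\<nu><N. p \<nu> < p (Suc \<nu>))"

definition partition_sum :: "(real \<Rightarrow> 'a::metric_space) \<Rightarrow> nat \<Rightarrow> (nat \<Rightarrow> real) \<Rightarrow> real" where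
  "partition_sum \<phi> N p = (\<Sum>\<nu><N. diameter (\<phi> ` {p \<nu>..p (Suc \<nu>)}))"

definition variation_fun :: "(real \<Rightarrow> 'a::metric_space) \<Rightarrow> real \<Rightarrow> real" where
  "variation_fun \<phi> t = Sup {partition_sum \<phi> N p | N p. path_partition t N p}"

lemma path_partition_extend:
  assumes "path_partition s N p" "s < t"
  shows "path_partition t (Suc N) (p(Suc N := t))"
    and "partition_sum \<phi> (Suc N) (p(Suc N := t)) = partition_sum \<phi> N p + diameter (\<phi> ` {s..t})"
  using assms by (auto simp: path_partition_def partition_sum_def less_Suc_eq)

lemma ex_path_partition: "0 \<le> t \<Longrightarrow> \<exists>N p. path_partition t N p"
proof (cases "t = 0")
  case True
  then show ?thesis by (intro exI[of _ 0] exI[of _ "\<lambda>_. 0"]) (simp add: path_partition_def)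
next
  case False
  assume "0 \<le> t"
  then show ?thesis using False
    by (intro exI[of _ 1] exI[of _ "\<lambda>k. if k = 0 then 0 else t"]) (simp add: path_partition_def)
qed

text \<open>Appending \<open>{s..t}\<close> to a partition of \<open>{0..s}\<close> gives one of
  \<open>{0..t}\<close>. Since \<open>W\<close> bounds only partitions of the whole interval, those
  of a shorter one are bounded by appending the rest up to \<open>T\<close>.\<close>

lemma variation_fun_superadditive:
  fixes \<phi> :: "real \<Rightarrow> 'a::metric_space"
  assumes W: "\<And>N p. path_partition T N p \<Longrightarrow> partition_sum \<phi> N p \<le> W"
    and cpt: "\<And>s t. 0 \<le> s \<Longrightarrow> t \<le> T \<Longrightarrow> bounded (\<phi> ` {s..t})"
    and st: "0 \<le> s" "s \<le> t" "t \<le> T"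
  shows "variation_fun \<phi> s + diameter (\<phi> ` {s..t}) \<le> variation_fun \<phi> t"
proof -
  have bdd: "bdd_above {partition_sum \<phi> N p | N p. path_partition t N p}" if t: "0 \<le> t" "t \<le> T" for t
  proof (rule bdd_aboveI)
    fix v assume "v \<in> {partition_sum \<phi> N p | N p. path_partition t N p}"
    then obtain N p where p: "v = partition_sum \<phi> N p" "path_partition t N p" by blast
    show "v \<le> W"
    proof (cases "t = T")
      case True
      then show ?thesis using W p by simp
    next
      case False
      then have "t < T" using t by simp
      note ext = path_partition_extend[OF p(2) this]
      have "0 \<le> diameter (\<phi> ` {t..T})" by (intro diameter_ge_0 cpt) (use t in auto)
      then show ?thesis using W[OF ext(1)] ext(2)[of \<phi>] p(1) by linarith
    qed
  qed
  show ?thesis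
  proof (cases "s = t")
    case True
    have "diameter (\<phi> ` {s..t}) = 0" by (simp add: True)
    then show ?thesis using True by simp
  next
    case False
    then have lt: "s < t" using st by simp
    have "variation_fun \<phi> s \<le> variation_fun \<phi> t - diameter (\<phi> ` {s..t})"
      unfolding variation_fun_def[of \<phi> s]
    proof (rule cSup_least)
      show "{partition_sum \<phi> N p | N p. path_partition s N p} \<noteq> {}"
        using ex_path_partition[OF st(1)] by blast
      fix v assume "v \<in> {partition_sum \<phi> N p | N p. path_partition s N p}"
      then obtain N p where p: "v = partition_sum \<phi> N p" "path_partition s N p" by blast
      note ext = path_partition_extend[OF p(2) lt]
      have "partition_sum \<phi> (Suc N) (p(Suc N := t)) \<le> variation_fun \<phi> t"
        unfolding variation_fun_def using ext(1) bdd[of t] st by (intro cSup_upper) auto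
      then show "v \<le> variation_fun \<phi> t - diameter (\<phi> ` {s..t})"
        using ext(2)[of \<phi>] p(1) by simp
    qed
    then show ?thesis by simp
  qed
qed

text \<open>A monotone function has a right limit at 0, even if the variation jumps there.\<close>

lemma ex_small_increment:
  fixes V :: "real \<Rightarrow> real"
  assumes "0 < T" "0 < \<kappa>" and mono: "\<And>s t. 0 \<le> s \<Longrightarrow> s \<le> t \<Longrightarrow> t \<le> T \<Longrightarrow> V s \<le> V t"
  obtains s where "0 < s" "s \<le> T" "\<And>p q. 0 < p \<Longrightarrow> p \<le> q \<Longrightarrow> q \<le> s \<Longrightarrow> V q - V p \<le> \<kappa>"
proof -
  define V0 where "V0 = Inf (V ` {0<..T})"
  have ne: "V ` {0<..T} \<noteq> {}" using assms(1) by auto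
  have bdd: "bdd_below (V ` {0<..T})"
    using mono[of 0] by (intro bdd_belowI[of _ "V 0"]) auto
  have "V0 < V0 + \<kappa>" using assms(2) by simp
  then obtain s where s: "0 < s" "s \<le> T" "V s < V0 + \<kappa>"
    using cInf_lessD[OF ne, of "V0 + \<kappa>"] unfolding V0_def by auto
  show thesis
  proof (rule that[OF s(1,2)])
    fix p q assume pq: "0 < p" "p \<le> q" "q \<le> s"
    have "V0 \<le> V p" unfolding V0_def using pq s bdd by (intro cInf_lower) auto
    moreover have "V q \<le> V s" using pq s by (intro mono) auto
    ultimately show "V q - V p \<le> \<kappa>" using s(3) by linarith
  qed
qed

text \<open>\<open>arc_partition\<close> admits any parametrization of the arc, in particular the
  trajectory itself.\<close>

lemma partition_sum_le_variation:
  fixes f :: "real ^ 'n::finite \<Rightarrow> real ^ 'n"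
  assumes "C1_arc_param x 0 T" "path_partition T N p" "arc_variation f (x ` {0..T}) < \<infinity>"
  shows "partition_sum (f \<circ> x) N p \<le> real_of_ereal (arc_variation f (x ` {0..T}))"
proof -
  define \<gamma>s where "\<gamma>s = map (\<lambda>\<nu>. x ` {p \<nu>..p (Suc \<nu>)}) [0..<N]"
  have "arc_partition (x ` {0..T}) \<gamma>s"
    unfolding arc_partition_def
    using assms(1,2)
    by (intro exI[of _ x] exI[of _ 0] exI[of _ T] exI[of _ p]) (simp add: \<gamma>s_def path_partition_def)
  then have "ereal (\<Sum>\<gamma>\<leftarrow>\<gamma>s. diameter (f ` \<gamma>)) \<le> arc_variation f (x ` {0..T})"
    unfolding arc_variation_def by (intro SUP_upper) simp
  moreover have "(\<Sum>\<gamma>\<leftarrow>\<gamma>s. diameter (f ` \<gamma>)) = partition_sum (f \<circ> x) N p"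
    by (simp add: \<gamma>s_def partition_sum_def image_comp comp_def interv_sum_list_conv_sum_set_nat atLeast0LessThan)
  ultimately show ?thesis
    using assms(3) by (cases "arc_variation f (x ` {0..T})") auto
qed

section \<open>Distortion bounded by the image of an arc\<close>

lemma inner_zero_imp_zero_of_card_one:
  fixes e v :: "real ^ 'n::finite"
  assumes "CARD('n) = 1" "e \<noteq> 0" "e \<bullet> v = 0"
  shows "v = 0"
proof -
  obtain i :: 'n where i: "UNIV = {i}" using assms(1) by (rule card_1_singletonE)
  have all: "j = i" for j using UNIV_I[of j] unfolding i by simp
  have "e $ i \<noteq> 0"
  proof
    assume "e $ i = 0"
    then have "e = 0" using all by (metis vec_eq_iff zero_index)
    then show False using assms(2) by simp
  qed
  moreover have "e $ i * v $ i = 0" using assms(3) by (simp add: inner_vec_def i)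
  ultimately have "v $ i = 0" by simp
  then show ?thesis using all by (metis vec_eq_iff zero_index)
qed

text \<open>The numbers are \<open>4 * 7/10 - 4/10 = 24/10\<close>. A connected set through
  \<open>p\<close> and \<open>q\<close> then projects onto all values between \<open>- 2 * r\<close>
  and \<open>2 * r\<close>, where the escaping continuum is to be met.\<close>

lemma arc_inner_bounds:
  fixes e :: "'a::real_inner"
  assumes "norm \<theta> = 1" "7/10 \<le> \<theta> \<bullet> e" "0 \<le> r"
    and "norm (p - x + (4 * r) *\<^sub>R e) \<le> 4/10 * r" "norm (q - x - (4 * r) *\<^sub>R e) \<le> 4/10 * r"
  shows "\<theta> \<bullet> (p - x) \<le> - (24/10 * r)" "24/10 * r \<le> \<theta> \<bullet> (q - x)"
proof -
  have a: "28/10 * r \<le> 4 * r * (\<theta> \<bullet> e)" using mult_left_mono[OF assms(2), of "4 * r"] assms(3) by simp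
  have "\<bar>\<theta> \<bullet> (p - x + (4 * r) *\<^sub>R e)\<bar> \<le> 4/10 * r"
    using Cauchy_Schwarz_ineq2[of \<theta> "p - x + (4 * r) *\<^sub>R e"] assms(1,4) by simp
  moreover have "\<theta> \<bullet> (p - x + (4 * r) *\<^sub>R e) = \<theta> \<bullet> (p - x) + 4 * r * (\<theta> \<bullet> e)"
    by (simp only: inner_add_right inner_scaleR_right)
  ultimately show "\<theta> \<bullet> (p - x) \<le> - (24/10 * r)" using a by linarith
  have "\<bar>\<theta> \<bullet> (q - x - (4 * r) *\<^sub>R e)\<bar> \<le> 4/10 * r"
    using Cauchy_Schwarz_ineq2[of \<theta> "q - x - (4 * r) *\<^sub>R e"] assms(1,5) by simp
  moreover have "\<theta> \<bullet> (q - x - (4 * r) *\<^sub>R e) = \<theta> \<bullet> (q - x) - 4 * r * (\<theta> \<bullet> e)"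
    by (simp only: inner_diff_right[of \<theta> "q - x"] inner_scaleR_right)
  ultimately show "24/10 * r \<le> \<theta> \<bullet> (q - x)" using a by linarith
qed

text \<open>If the estimate failed, the arc, where \<open>f\<close> is within \<open>l\<close> of
  \<open>f x\<close>, and the continuum escaping from \<open>y\<close>, where it is more than
  \<open>2 ^ m * l\<close> away, would project onto a common interval of length \<open>r\<close>. By
  \<open>mC\<close> this contradicts \<open>loewner_separation\<close>.\<close>

lemma arc_estimate_card_ge_2:
  fixes f :: "real ^ 'n::finite \<Rightarrow> real ^ 'n" and i1 i2 :: 'n and m :: nat
  assumes i12: "i1 \<noteq> i2" and K: "1 \<le> K" and m: "1 \<le> m"
    and mC: "5 * (3 * loewner_const (CARD('n)) (2 ^ CARD('n)) * 2 ^ CARD('n) * energy_const K TYPE('n)) < m"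
    and S: "open S" "continuous_on S f" "inj_on f S" "quasiround_on K S f"
    and xy: "y \<noteq> x" "cball x (25 * real CARD('n) * dist x y) \<subseteq> S"
    and E: "norm e = 1" "connected E" "E \<subseteq> cball x (5 * dist x y)" "p \<in> E" "q \<in> E"
      "norm (p - x + (4 * dist x y) *\<^sub>R e) \<le> 4/10 * dist x y"
      "norm (q - x - (4 * dist x y) *\<^sub>R e) \<le> 4/10 * dist x y"
    and l: "0 < l" "\<And>z. z \<in> E \<Longrightarrow> dist (f z) (f x) \<le> l"
  shows "dist (f y) (f x) \<le> 2 ^ m * l"
proof (rule ccontr)
  assume "\<not> dist (f y) (f x) \<le> 2 ^ m * l"
  then have big: "2 ^ m * l < dist (f y) (f x)" by simp
  define r where "r = dist x y"
  have r: "0 < r" using xy(1) by (simp add: r_def)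
  define n where "n = CARD('n)"
  have n1: "1 \<le> real n" by (simp add: n_def Suc_leI)
  have n2: "2 \<le> n"
  proof -
    have "card {i1, i2} \<le> CARD('n)" by (intro card_mono) auto
    then show ?thesis using i12 by (simp add: n_def)
  qed
  have "3 * r \<le> 25 * real n * r" using n1 r by (intro mult_right_mono) auto
  then have "cball x (3 * r) \<subseteq> cball x (25 * real n * r)" by (rule subset_cball)
  then have sub3: "cball x (3 * r) \<subseteq> S" using xy(2) unfolding r_def n_def by (rule order_trans)
  have "dist x y < 3 * r" using r by (simp add: r_def)
  from ex_escaping_continuum[OF continuous_on_subset[OF S(2) sub3] inj_on_subset[OF S(3) sub3] this xy(1)]
  obtain F z where F: "connected F" "F \<subseteq> cball x (3 * r)" "y \<in> F" "z \<in> F" "dist x z = 3 * r"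
    "\<And>q. q \<in> F \<Longrightarrow> dist (f y) (f x) \<le> dist (f q) (f x)" by blast
  have zy: "2 * r \<le> norm (z - y)"
    using F(5) dist_triangle[of x z y] by (simp add: r_def dist_norm norm_minus_commute)
  then have "z - y \<noteq> 0" using r by auto
  from ex_bisecting_direction[OF E(1) this] obtain \<theta> where
    \<theta>: "norm \<theta> = 1" "7/10 \<le> \<theta> \<bullet> e" "7/10 * norm (z - y) \<le> \<bar>\<theta> \<bullet> (z - y)\<bar>" by blast
  have wr: "r \<le> \<bar>\<theta> \<bullet> (z - y)\<bar>" using \<theta>(3) zy r by linarith
  have eb: "\<theta> \<bullet> (p - x) \<le> - (24/10 * r)" "24/10 * r \<le> \<theta> \<bullet> (q - x)"
    using arc_inner_bounds[OF \<theta>(1,2) _ E(6,7)] r by (simp_all add: r_def)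
  have yb: "\<bar>\<theta> \<bullet> (y - x)\<bar> \<le> r"
    using Cauchy_Schwarz_ineq2[of \<theta> "y - x"] \<theta>(1) by (simp add: r_def dist_norm norm_minus_commute)
  \<comment> \<open>The projection of \<open>F\<close> contains the interval of length
    \<open>r\<close> that starts or ends at the value of \<open>y\<close>, depending on the side of
    \<open>z\<close>. This value is at most \<open>r\<close> in modulus, so the interval lies
    between \<open>- 2 * r\<close> and \<open>2 * r\<close>.\<close>
  define t0 where "t0 = (if 0 \<le> \<theta> \<bullet> (z - y) then \<theta> \<bullet> (y - x) else \<theta> \<bullet> (y - x) - r)"
  have Fval: "\<exists>w\<in>F. \<theta> \<bullet> (w - x) = s" if "t0 \<le> s" "s \<le> t0 + r" for s
  proof (cases "0 \<le> \<theta> \<bullet> (z - y)")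
    case True
    have "\<theta> \<bullet> (z - x) = \<theta> \<bullet> (z - y) + \<theta> \<bullet> (y - x)" by (simp add: inner_diff_right)
    then show ?thesis using that wr True
      by (intro connected_inner_value[OF F(1,3,4)]) (auto simp: t0_def)
  next
    case False
    have "\<theta> \<bullet> (z - x) = \<theta> \<bullet> (z - y) + \<theta> \<bullet> (y - x)" by (simp add: inner_diff_right)
    then show ?thesis using that wr False
      by (intro connected_inner_value[OF F(1,4,3)]) (auto simp: t0_def)
  qed
  have Eval: "\<exists>w\<in>E. \<theta> \<bullet> (w - x) = s" if "t0 \<le> s" "s \<le> t0 + r" for s
  proof (rule connected_inner_value[OF E(2,4,5)])
    have "- (2 * r) \<le> t0" "t0 + r \<le> 2 * r" using yb r by (auto simp: t0_def abs_le_iff)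
    then show "\<theta> \<bullet> (p - x) \<le> s" "s \<le> \<theta> \<bullet> (q - x)" using eb that r by linarith+
  qed
  \<comment> \<open>\<open>E\<close> and \<open>F\<close> lie within \<open>5 * r\<close> of
    \<open>x\<close>, so they pull back into the unit ball, while \<open>cbox (-5) 5\<close> is
    mapped into the ball of radius \<open>25 * n * r\<close> of the hypothesis.\<close>
  define \<rho> where "\<rho> = 5 * r"
  have \<rho>: "0 < \<rho>" using r by (simp add: \<rho>_def)
  \<comment> \<open>Turning the axis \<open>i1\<close> into \<open>\<theta>\<close> makes the
    hyperplanes of \<open>loewner_separation\<close> those orthogonal to
    \<open>\<theta>\<close>.\<close>
  have "norm (axis i1 (1::real) :: real ^ 'n) = norm \<theta>" using \<theta>(1) by simp
  then obtain T :: "real ^ 'n \<Rightarrow> real ^ 'n" where T: "orthogonal_transformation T" "T (axis i1 1) = \<theta>"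
    by (rule orthogonal_transformation_exists)
  define A where "A = (\<lambda>u. x + \<rho> *\<^sub>R T u)"
  have lin: "linear T" using T(1) by (rule orthogonal_transformation_linear)
  have dA: "dist (A u) (A v) = \<rho> * dist u v" for u v
  proof -
    have "A u - A v = \<rho> *\<^sub>R T (u - v)" by (simp add: A_def linear_diff[OF lin] scaleR_diff_right)
    then show ?thesis using \<rho> orthogonal_transformation_norm[OF T(1)] by (simp add: dist_norm)
  qed
  have A0: "A 0 = x" by (simp add: A_def linear_0[OF lin])
  have Aco: "\<theta> \<bullet> (A u - x) = \<rho> * u $ i1" for u
  proof -
    have "\<theta> \<bullet> T u = axis i1 1 \<bullet> u"
      using T unfolding orthogonal_transformation_def by metis
    also have "\<dots> = u $ i1" by (simp add: inner_axis')
    finally show ?thesis by (simp add: A_def)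
  qed
  have Asurj: "\<exists>u. A u = w \<and> norm u = dist w x / \<rho>" for w
  proof -
    obtain u where u: "T u = (1 / \<rho>) *\<^sub>R (w - x)"
      using orthogonal_transformation_surj[OF T(1)] by (metis surjD)
    have "A u = w" using \<rho> by (simp add: A_def u)
    moreover have "norm u = dist w x / \<rho>"
      using orthogonal_transformation_norm[OF T(1), of u] \<rho> by (simp add: u dist_norm)
    ultimately show ?thesis by blast
  qed
  have contA: "continuous_on B A" for B
    unfolding A_def by (intro continuous_intros linear_continuous_on linear_conv_bounded_linear[THEN iffD1] lin)
  define g where "g = (\<lambda>u. (1 / l) *\<^sub>R (f (A u) - f x))"
  have ng: "norm (g u) = dist (f (A u)) (f x) / l" for u using l by (simp add: g_def dist_norm)
  have conc: "((t0 + r) / \<rho> - t0 / \<rho>) * real m ^ (CARD('n) - 1)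
      \<le> 3 * loewner_const (CARD('n)) (2 ^ CARD('n)) * 2 ^ CARD('n) * energy_const K TYPE('n)"
  proof (rule loewner_separation[OF i12 _ _ _ _ K _ m, of "A -` S" g])
    show "open (A -` S)" using S(1) contA[of UNIV] by (simp add: continuous_on_open_vimage)
    show "cbox (-5) 5 \<subseteq> A -` S"
    proof
      fix u :: "real ^ 'n" assume u: "u \<in> cbox (-5) 5"
      have "\<bar>u $ j\<bar> \<le> 5" for j
      proof -
        have "(-5) $ j \<le> u $ j \<and> u $ j \<le> 5 $ j" using u unfolding mem_box_cart by blast
        then show ?thesis by (simp add: abs_le_iff)
      qed
      then have "(\<Sum>j\<in>UNIV. \<bar>u $ j\<bar>) \<le> (\<Sum>j\<in>(UNIV::'n set). 5)" by (intro sum_mono) auto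
      then have "norm u \<le> 5 * real n" using norm_le_l1_cart[of u] by (simp add: n_def)
      then have "\<rho> * norm u \<le> 25 * real n * r" using mult_left_mono[of "norm u" "5 * real n" \<rho>] \<rho>
        by (simp add: \<rho>_def mult_ac)
      then have "dist x (A u) \<le> 25 * real n * r" using dA[of 0 u] by (simp add: A0)
      then have "A u \<in> S" using xy(2) unfolding r_def n_def by (auto simp: mem_cball)
      then show "u \<in> A -` S" by simp
    qed
    show "continuous_on (A -` S) g"
      unfolding g_def
      by (intro continuous_intros continuous_on_compose2[OF S(2) contA]) auto
    show "inj_on g (A -` S)"
    proof (rule inj_onI)
      fix u v assume uv: "u \<in> A -` S" "v \<in> A -` S" "g u = g v"
      then have "f (A u) = f (A v)" using l by (simp add: g_def)
      then have "A u = A v" using inj_onD[OF S(3)] uv by simp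
      then show "u = v" using dA[of u v] \<rho> by simp
    qed
    show "quasiround_on K (A -` S) g"
      unfolding g_def by (rule quasiround_on_similarity[OF S(4) \<rho> dA l(1)])
    show "t0 / \<rho> \<le> (t0 + r) / \<rho>" using r \<rho> by (intro divide_right_mono) auto
    fix s assume s: "t0 / \<rho> \<le> s" "s \<le> (t0 + r) / \<rho>"
    then have s': "t0 \<le> \<rho> * s" "\<rho> * s \<le> t0 + r"
      using \<rho> by (simp_all add: pos_divide_le_eq pos_le_divide_eq mult.commute)
    have pt: "\<exists>u. u \<in> cbox (-1) 1 \<and> u $ i1 = s \<and> A u = w" if "dist w x \<le> \<rho>" "\<theta> \<bullet> (w - x) = \<rho> * s" for w
    proof -
      obtain u where u: "A u = w" "norm u = dist w x / \<rho>" using Asurj by blast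
      have "norm u \<le> 1" using u(2) that(1) \<rho> by simp
      then have "\<bar>u $ j\<bar> \<le> 1" for j using component_le_norm_cart[of u j] by linarith
      then have "u \<in> cbox (-1) 1" by (simp add: mem_box_cart abs_le_iff minus_le_iff)
      moreover have "u $ i1 = s" using Aco[of u] that(2) \<rho> by (simp add: u(1))
      ultimately show ?thesis using u(1) by blast
    qed
    obtain w1 where w1: "w1 \<in> E" "\<theta> \<bullet> (w1 - x) = \<rho> * s" using Eval[OF s'] by blast
    obtain w2 where w2: "w2 \<in> F" "\<theta> \<bullet> (w2 - x) = \<rho> * s" using Fval[OF s'] by blast
    have "dist w1 x \<le> \<rho>" using w1(1) E(3) by (auto simp: \<rho>_def r_def dist_commute)
    from pt[OF this w1(2)] obtain u1 where u1: "u1 \<in> cbox (-1) 1" "u1 $ i1 = s" "A u1 = w1" by blast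
    have "dist x w2 \<le> 3 * r" using w2(1) F(2) by auto
    then have "dist w2 x \<le> \<rho>" using r by (simp add: \<rho>_def dist_commute)
    from pt[OF this w2(2)] obtain u2 where u2: "u2 \<in> cbox (-1) 1" "u2 $ i1 = s" "A u2 = w2" by blast
    have "norm (g u1) \<le> 1" using l(2)[OF w1(1)] l(1) by (simp add: ng u1(3))
    moreover have "2 ^ m \<le> norm (g u2)"
      using F(6)[OF w2(1)] big l(1) by (simp add: ng u2(3) pos_le_divide_eq)
    ultimately show "\<exists>p q. p \<in> cbox (-1) 1 \<and> q \<in> cbox (-1) 1 \<and> p $ i1 = s \<and> q $ i1 = s \<and>
        norm (g p) \<le> 1 \<and> 2 ^ m \<le> norm (g q)"
      using u1 u2 by blast
  qed
  \<comment> \<open>The source of the factor 5 in \<open>mC\<close>.\<close>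
  have "(t0 + r) / \<rho> - t0 / \<rho> = 1 / 5" using r by (simp add: \<rho>_def flip: diff_divide_distrib)
  note conc = conc[unfolded this]
  have "real m \<le> real m ^ (CARD('n) - 1)"
  proof -
    have "real m ^ 1 \<le> real m ^ (CARD('n) - 1)" using m n2 by (intro power_increasing) (auto simp: n_def)
    then show ?thesis by simp
  qed
  then show False using conc mC by linarith
qed

text \<open>\<open>M\<close> depends only on \<open>K\<close> and the dimension, so the same
  constant serves at all times and all distances along the trajectories. In dimension 1 the arc has
  a point with the same projection as \<open>y\<close>, which is \<open>y\<close> itself.\<close>

lemma arc_estimate:
  fixes K :: real
  assumes K: "1 \<le> K"
  obtains M :: real where "1 \<le> M"
    "\<And>S (f :: real ^ 'n::finite \<Rightarrow> real ^ 'n) x y e E p q l.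
      open S \<Longrightarrow> continuous_on S f \<Longrightarrow> inj_on f S \<Longrightarrow> quasiround_on K S f \<Longrightarrow>
      y \<noteq> x \<Longrightarrow> cball x (25 * real CARD('n) * dist x y) \<subseteq> S \<Longrightarrow>
      norm e = 1 \<Longrightarrow> connected E \<Longrightarrow> E \<subseteq> cball x (5 * dist x y) \<Longrightarrow> p \<in> E \<Longrightarrow> q \<in> E \<Longrightarrow>
      norm (p - x + (4 * dist x y) *\<^sub>R e) \<le> 4/10 * dist x y \<Longrightarrow>
      norm (q - x - (4 * dist x y) *\<^sub>R e) \<le> 4/10 * dist x y \<Longrightarrow>
      0 < l \<Longrightarrow> (\<And>z. z \<in> E \<Longrightarrow> dist (f z) (f x) \<le> l) \<Longrightarrow> dist (f y) (f x) \<le> M * l"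
proof (cases "CARD('n) = 1")
  case True
  show thesis
  proof (rule that[of 1])
    fix S and f :: "real ^ 'n \<Rightarrow> real ^ 'n" and x y e E p q and l :: real
    assume e: "norm e = 1" and E: "connected E" "p \<in> E" "q \<in> E"
      "norm (p - x + (4 * dist x y) *\<^sub>R e) \<le> 4/10 * dist x y"
      "norm (q - x - (4 * dist x y) *\<^sub>R e) \<le> 4/10 * dist x y"
      and l: "\<And>z. z \<in> E \<Longrightarrow> dist (f z) (f x) \<le> l"
    have ee: "7/10 \<le> e \<bullet> e" using e by (simp add: norm_eq_1)
    have b: "e \<bullet> (p - x) \<le> - (24/10 * dist x y)" "24/10 * dist x y \<le> e \<bullet> (q - x)"
      using arc_inner_bounds[OF e ee zero_le_dist E(4,5)] by blast+
    have "\<bar>e \<bullet> (y - x)\<bar> \<le> dist x y"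
      using Cauchy_Schwarz_ineq2[of e "y - x"] e by (simp add: dist_norm norm_minus_commute)
    then have "e \<bullet> (p - x) \<le> e \<bullet> (y - x)" "e \<bullet> (y - x) \<le> e \<bullet> (q - x)"
      using b zero_le_dist[of x y] by linarith+
    from connected_inner_value[OF E(1-3) this] obtain z where z: "z \<in> E" "e \<bullet> (z - x) = e \<bullet> (y - x)"
      by blast
    then have "e \<bullet> (z - y) = 0" by (simp add: inner_diff_right)
    moreover have "e \<noteq> 0" using e by auto
    ultimately have "z - y = 0" using inner_zero_imp_zero_of_card_one[OF True] by blast
    then show "dist (f y) (f x) \<le> 1 * l" using l[OF z(1)] by simp
  qed simp
next
  case False
  then have "\<not> CARD('n) \<le> Suc 0" using zero_less_card_finite[where 'a='n] by linarith
  then obtain i1 i2 :: 'n where i12: "i1 \<noteq> i2"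
    using card_le_Suc0_iff_eq[of "UNIV :: 'n set"] by auto
  obtain m0 :: nat where m0: "5 * (3 * loewner_const (CARD('n)) (2 ^ CARD('n)) * 2 ^ CARD('n) * energy_const K TYPE('n)) < real m0"
    using reals_Archimedean2 by blast
  define m where "m = Suc m0"
  have m: "1 \<le> m" "5 * (3 * loewner_const (CARD('n)) (2 ^ CARD('n)) * 2 ^ CARD('n) * energy_const K TYPE('n)) < real m"
    using m0 by (simp_all add: m_def)
  show thesis
  proof (rule that[of "2 ^ m"])
    fix S and f :: "real ^ 'n \<Rightarrow> real ^ 'n" and x y e E p q and l :: real
    assume "open S" "continuous_on S f" "inj_on f S" "quasiround_on K S f"
      "y \<noteq> x" "cball x (25 * real CARD('n) * dist x y) \<subseteq> S"
      "norm e = 1" "connected E" "E \<subseteq> cball x (5 * dist x y)" "p \<in> E" "q \<in> E"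
      "norm (p - x + (4 * dist x y) *\<^sub>R e) \<le> 4/10 * dist x y"
      "norm (q - x - (4 * dist x y) *\<^sub>R e) \<le> 4/10 * dist x y"
      "0 < l" "\<And>z. z \<in> E \<Longrightarrow> dist (f z) (f x) \<le> l"
    then show "dist (f y) (f x) \<le> 2 ^ m * l"
      by (rule arc_estimate_card_ge_2[OF i12 K m])
  qed simp
qed

section \<open>Uniqueness of solutions\<close>

lemma solution_displacement:
  fixes f :: "'a::real_normed_vector \<Rightarrow> 'a"
  assumes "s \<le> t" "\<And>\<tau>. s \<le> \<tau> \<Longrightarrow> \<tau> \<le> t \<Longrightarrow> (x has_vector_derivative f (x \<tau>)) (at \<tau>)"
    and "\<And>\<tau>. s \<le> \<tau> \<Longrightarrow> \<tau> \<le> t \<Longrightarrow> norm (f (x \<tau>) - v) \<le> \<kappa>"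
  shows "norm (x t - x s - (t - s) *\<^sub>R v) \<le> \<kappa> * (t - s)"
proof -
  define w where "w = (\<lambda>\<tau>. x \<tau> - \<tau> *\<^sub>R v)"
  have "norm (w t - w s) \<le> \<kappa> * (t - s)"
  proof (rule vector_mean_value_bound[OF assms(1)])
    fix \<tau> assume \<tau>: "s \<le> \<tau>" "\<tau> \<le> t"
    show "(w has_vector_derivative f (x \<tau>) - v) (at \<tau>)"
      unfolding w_def by (auto intro!: derivative_eq_intros assms(2)[OF \<tau>])
    show "norm (f (x \<tau>) - v) \<le> \<kappa>" by (rule assms(3)[OF \<tau>])
  qed
  moreover have "w t - w s = x t - x s - (t - s) *\<^sub>R v"
    by (simp add: w_def algebra_simps)
  ultimately show ?thesis by simp
qed

text \<open>At the time \<open>t1\<close> of maximal distance \<open>D\<close> the bounds combine to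
  \<open>D \<le> D / 2 + D / 4\<close>. The velocities stay within \<open>\<mu> / 32\<close> of
  \<open>f a\<close>, so the solutions separate at rate at most \<open>\<mu> / 16\<close>, which
  gives \<open>D / 2\<close> at time \<open>2 * h\<close>; the variation gives \<open>D / 4\<close>
  for the growth from there to \<open>t1\<close>.\<close>

lemma forward_uniqueness:
  fixes f :: "real ^ 'n::finite \<Rightarrow> real ^ 'n" and x y :: "real \<Rightarrow> real ^ 'n"
  assumes \<Omega>: "open \<Omega>" "continuous_on \<Omega> f" "inj_on f \<Omega>" "quasiround_on K \<Omega> f" and K: "1 \<le> K"
    and bv: "bv_on_C1_curves \<Omega> f" and a: "a \<in> \<Omega>" "f a \<noteq> 0" and T: "0 < T"
    and x: "x 0 = a" "\<And>t. 0 \<le> t \<Longrightarrow> t \<le> T \<Longrightarrow> x t \<in> \<Omega>"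
      "\<And>t. 0 \<le> t \<Longrightarrow> t \<le> T \<Longrightarrow> (x has_vector_derivative f (x t)) (at t)"
    and y: "y 0 = a" "\<And>t. 0 \<le> t \<Longrightarrow> t \<le> T \<Longrightarrow> y t \<in> \<Omega>"
      "\<And>t. 0 \<le> t \<Longrightarrow> t \<le> T \<Longrightarrow> (y has_vector_derivative f (y t)) (at t)"
  shows "\<exists>\<epsilon>>0. \<forall>t. 0 \<le> t \<and> t \<le> \<epsilon> \<longrightarrow> x t = y t"
proof -
  define \<mu> where "\<mu> = norm (f a)"
  have \<mu>: "0 < \<mu>" using a by (simp add: \<mu>_def)
  define e where "e = (1 / \<mu>) *\<^sub>R f a"
  have e: "norm e = 1" "f a = \<mu> *\<^sub>R e" using \<mu> by (simp_all add: e_def \<mu>_def)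
  define n where "n = real CARD('n)"
  have n: "1 \<le> n" by (simp add: n_def Suc_leI)
  obtain M where M: "1 \<le> M" and arc: "\<And>S (f :: real ^ 'n \<Rightarrow> real ^ 'n) x y e E p q l.
      open S \<Longrightarrow> continuous_on S f \<Longrightarrow> inj_on f S \<Longrightarrow> quasiround_on K S f \<Longrightarrow>
      y \<noteq> x \<Longrightarrow> cball x (25 * n * dist x y) \<subseteq> S \<Longrightarrow>
      norm e = 1 \<Longrightarrow> connected E \<Longrightarrow> E \<subseteq> cball x (5 * dist x y) \<Longrightarrow> p \<in> E \<Longrightarrow> q \<in> E \<Longrightarrow>
      norm (p - x + (4 * dist x y) *\<^sub>R e) \<le> 4/10 * dist x y \<Longrightarrow>
      norm (q - x - (4 * dist x y) *\<^sub>R e) \<le> 4/10 * dist x y \<Longrightarrow>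
      0 < l \<Longrightarrow> (\<And>z. z \<in> E \<Longrightarrow> dist (f z) (f x) \<le> l) \<Longrightarrow> dist (f y) (f x) \<le> M * l"
    using arc_estimate[OF K, where 'n='n] unfolding n_def by metis
  obtain R1 where R1: "0 < R1" "cball a R1 \<subseteq> \<Omega>" using \<Omega>(1) a(1) by (meson open_contains_cball)
  have "isCont f a" using \<Omega>(1,2) a(1) by (simp add: continuous_on_eq_continuous_at)
  then obtain R2 where R2: "0 < R2" "\<And>z. dist z a < R2 \<Longrightarrow> dist (f z) (f a) < \<mu> / 32"
    using \<mu> unfolding continuous_at_eps_delta by (metis divide_pos_pos zero_less_numeral)
  \<comment> \<open>Two points within \<open>R\<close> of \<open>a\<close> have distance
    \<open>r\<close> at most \<open>2 * R\<close>, and the ball of radius \<open>25 * n * r\<close>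
    that \<open>arc_estimate\<close> asks for then stays in the ball of radius
    \<open>R1\<close>.\<close>
  define R where "R = min R1 (R2 / 2) / (100 * n)"
  have R0: "0 < R" using R1 R2 n by (simp add: R_def)
  have Rn: "100 * n * R \<le> R1" "R \<le> R2 / 2"
  proof -
    have eq: "100 * n * R = min R1 (R2 / 2)" using n by (simp add: R_def)
    then show "100 * n * R \<le> R1" by simp
    have "1 * R \<le> 100 * n * R" using n R0 by (intro mult_right_mono) auto
    then show "R \<le> R2 / 2" using eq by simp
  qed
  have near: "norm (f z - f a) \<le> \<mu> / 32" if "dist z a \<le> R" for z
    using R2(2)[of z] that Rn(2) R2(1) by (simp add: dist_norm)
  have ball: "cball z (25 * n * r) \<subseteq> \<Omega>" if "dist z a \<le> R" "r \<le> 2 * R" for z r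
  proof -
    have "25 * n * r \<le> 25 * n * (2 * R)" using that(2) n by (intro mult_left_mono) auto
    also have "\<dots> = 50 * (n * R)" by simp
    finally have nr: "25 * n * r \<le> 50 * (n * R)" .
    have "1 * R \<le> n * R" using n R0 by (intro mult_right_mono) auto
    moreover have "100 * (n * R) \<le> R1" using Rn(1) by (simp only: mult.assoc)
    ultimately have le: "dist a z + 25 * n * r \<le> R1"
      using that(1) nr R0 unfolding dist_commute[of a z] by linarith
    have "cball z (25 * n * r) \<subseteq> cball a R1"
    proof
      fix w assume "w \<in> cball z (25 * n * r)"
      then show "w \<in> cball a R1" using le dist_triangle[of a w z] by simp
    qed
    then show ?thesis using R1(2) by blast
  qed
  have ex_close: "\<exists>d>0. \<forall>t. \<bar>t\<bar> < d \<longrightarrow> dist (z t) a \<le> R"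
    if "(z has_vector_derivative v) (at 0)" "z 0 = a" for z :: "real \<Rightarrow> real ^ 'n" and v
  proof -
    have "isCont z 0" using has_vector_derivative_continuous[OF that(1)] .
    then obtain d where "0 < d" "\<And>t. dist t 0 < d \<Longrightarrow> dist (z t) (z 0) < R"
      using R0 unfolding continuous_at_eps_delta by meson
    then show ?thesis using that(2) by (intro exI[of _ d]) (auto simp: less_imp_le)
  qed
  obtain d1 where d1: "0 < d1" "\<And>t. \<bar>t\<bar> < d1 \<Longrightarrow> dist (x t) a \<le> R"
    using ex_close[OF x(3)[of 0] x(1)] T by auto
  obtain d2 where d2: "0 < d2" "\<And>t. \<bar>t\<bar> < d2 \<Longrightarrow> dist (y t) a \<le> R"
    using ex_close[OF y(3)[of 0] y(1)] T by auto
  define \<tau>0 where "\<tau>0 = min T (min d1 d2 / 2)"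
  have \<tau>0: "0 < \<tau>0" "\<tau>0 \<le> T" using T d1 d2 by (auto simp: \<tau>0_def)
  have xR: "dist (x t) a \<le> R" and yR: "dist (y t) a \<le> R" if "0 \<le> t" "t \<le> \<tau>0" for t
    using d1 d2 that by (auto simp: \<tau>0_def)
  have xd: "(x has_vector_derivative f (x t)) (at t)" and yd: "(y has_vector_derivative f (y t)) (at t)"
    if "0 \<le> t" "t \<le> \<tau>0" for t using x(3) y(3) that \<tau>0 by auto
  have disp: "norm (x t - x s - (t - s) *\<^sub>R f a) \<le> \<mu> / 32 * (t - s)"
    if "0 \<le> s" "s \<le> t" "t \<le> \<tau>0" for s t
  proof (rule solution_displacement[where f = f, OF that(2)])
    fix \<tau> assume "s \<le> \<tau>" "\<tau> \<le> t"
    then have \<tau>: "0 \<le> \<tau>" "\<tau> \<le> \<tau>0" using that by auto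
    show "(x has_vector_derivative f (x \<tau>)) (at \<tau>)" by (rule xd[OF \<tau>])
    show "norm (f (x \<tau>) - f a) \<le> \<mu> / 32" by (rule near[OF xR[OF \<tau>]])
  qed
  have cx: "continuous_on {s..t} x" if "0 \<le> s" "t \<le> \<tau>0" for s t
  proof (intro continuous_at_imp_continuous_on ballI)
    fix \<tau> assume "\<tau> \<in> {s..t}"
    then show "isCont x \<tau>" using that by (intro has_vector_derivative_continuous[OF xd]) auto
  qed
  have xarc: "C1_arc_param x 0 \<tau>0"
  proof -
    have inj: "inj_on x {0..\<tau>0}"
    proof (rule linorder_inj_onI)
      fix s t assume st: "s < t" "s \<in> {0..\<tau>0}" "t \<in> {0..\<tau>0}"
      show "x s \<noteq> x t"
      proof
        assume "x s = x t"
        then have "norm ((t - s) *\<^sub>R f a) \<le> \<mu> / 32 * (t - s)" using disp[of s t] st by simp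
        then have "(t - s) * \<mu> \<le> \<mu> / 32 * (t - s)" using st by (simp add: \<mu>_def)
        moreover have "0 < (t - s) * \<mu>" using st \<mu> by simp
        ultimately show False by (simp add: mult.commute)
      qed
    qed auto
    have xsub: "x ` {0..\<tau>0} \<subseteq> \<Omega>" using x(2) \<tau>0 by auto
    have "continuous_on {0..\<tau>0} (\<lambda>t. f (x t))"
      by (rule continuous_on_compose2[OF \<Omega>(2) cx xsub]) simp_all
    moreover have "f (x t) \<noteq> 0" if "t \<in> {0..\<tau>0}" for t
    proof
      assume "f (x t) = 0"
      then have "\<mu> \<le> \<mu> / 32" using near[OF xR[of t]] that by (simp add: \<mu>_def)
      then show False using \<mu> by simp
    qed
    ultimately show ?thesis
      unfolding C1_arc_param_def using inj \<tau>0 xd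
      by (intro conjI exI[of _ "\<lambda>t. f (x t)"]) (auto intro: has_vector_derivative_at_within)
  qed
  have cfx: "compact ((f \<circ> x) ` {s..t})" if "0 \<le> s" "t \<le> \<tau>0" for s t
  proof -
    have "x ` {s..t} \<subseteq> \<Omega>" using x(2) that \<tau>0 by auto
    then have "continuous_on {s..t} (f \<circ> x)"
      by (intro continuous_on_compose cx that continuous_on_subset[OF \<Omega>(2)])
    then show ?thesis by (rule compact_continuous_image) simp
  qed
  define W where "W = real_of_ereal (arc_variation f (x ` {0..\<tau>0}))"
  have W: "partition_sum (f \<circ> x) N p \<le> W" if "path_partition \<tau>0 N p" for N p
  proof -
    have "C1_arc (x ` {0..\<tau>0})" using xarc unfolding C1_arc_def by blast
    moreover have "x ` {0..\<tau>0} \<subseteq> \<Omega>" using x(2) \<tau>0 by auto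
    ultimately have "arc_variation f (x ` {0..\<tau>0}) < \<infinity>" using bv unfolding bv_on_C1_curves_def by blast
    then show ?thesis unfolding W_def using partition_sum_le_variation[OF xarc that] by blast
  qed
  define V where "V = variation_fun (f \<circ> x)"
  have Vdiam: "V s + diameter ((f \<circ> x) ` {s..t}) \<le> V t" if "0 \<le> s" "s \<le> t" "t \<le> \<tau>0" for s t
    unfolding V_def by (rule variation_fun_superadditive[OF W compact_imp_bounded[OF cfx] that])
  have Vmono: "V s \<le> V t" if "0 \<le> s" "s \<le> t" "t \<le> \<tau>0" for s t
    using Vdiam[OF that] diameter_ge_0[OF compact_imp_bounded[OF cfx[OF that(1,3)]]] by linarith
  \<comment> \<open>With \<open>h = 4 * D / \<mu>\<close> this makes
    \<open>M * h * (3 * \<kappa>)\<close> equal to \<open>D / 4\<close>.\<close>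
  define \<kappa> where "\<kappa> = \<mu> / (48 * M)"
  have \<kappa>: "0 < \<kappa>" using \<mu> M by (simp add: \<kappa>_def)
  obtain s0 where s0: "0 < s0" "s0 \<le> \<tau>0"
    and small: "\<And>p q. 0 < p \<Longrightarrow> p \<le> q \<Longrightarrow> q \<le> s0 \<Longrightarrow> V q - V p \<le> \<kappa>"
    using ex_small_increment[of \<tau>0 \<kappa> V] \<tau>0(1) \<kappa> Vmono by metis
  define w where "w = (\<lambda>t. x t - y t)"
  have wd: "(w has_vector_derivative f (x t) - f (y t)) (at t)" if "0 \<le> t" "t \<le> \<tau>0" for t
    unfolding w_def using xd[OF that] yd[OF that] by (rule has_vector_derivative_diff)
  have wsmall: "norm (w t) \<le> \<mu> / 16 * t" if "0 \<le> t" "t \<le> \<tau>0" for t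
  proof -
    have "norm (w t - w 0) \<le> \<mu> / 16 * (t - 0)"
    proof (rule vector_mean_value_bound[OF that(1)])
      fix \<tau> assume \<tau>: "0 \<le> \<tau>" "\<tau> \<le> t"
      then have \<tau>': "0 \<le> \<tau>" "\<tau> \<le> \<tau>0" using that by auto
      show "(w has_vector_derivative f (x \<tau>) - f (y \<tau>)) (at \<tau>)" by (rule wd[OF \<tau>'])
      have "f (x \<tau>) - f (y \<tau>) = (f (x \<tau>) - f a) - (f (y \<tau>) - f a)" by simp
      then show "norm (f (x \<tau>) - f (y \<tau>)) \<le> \<mu> / 16"
        using norm_triangle_ineq4[of "f (x \<tau>) - f a" "f (y \<tau>) - f a"]
          near[OF xR[OF \<tau>']] near[OF yR[OF \<tau>']] by simp
    qed
    then show ?thesis using x(1) y(1) by (simp add: w_def)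
  qed
  have key: "norm (f (x t) - f (y t)) \<le> M * (V (t + h) - V (t - h))"
    if h: "4 / \<mu> * norm (w t) \<le> h" "h \<le> t" "t + h \<le> \<tau>0" for t h
  proof (cases "w t = 0")
    case True
    then have "0 \<le> h" "x t = y t" using h(1) by (auto simp: w_def)
    then have "V (t - h) \<le> V (t + h)" using h by (intro Vmono) auto
    then show ?thesis using \<open>x t = y t\<close> M by simp
  next
    case False
    define r where "r = dist (x t) (y t)"
    have r: "0 < r" "norm (w t) = r" using False by (auto simp: r_def w_def dist_norm)
    \<comment> \<open>The time in which speed \<open>\<mu>\<close> covers the length
      \<open>4 * r\<close>. Over this time the trajectory deviates from a straight line by at most
      \<open>r / 8\<close>.\<close>
    define k where "k = 4 * r / \<mu>"
    have k: "0 < k" "k \<le> h" using r \<mu> h(1) by (simp_all add: k_def)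
    have k\<mu>: "k * \<mu> = 4 * r" using \<mu> by (simp add: k_def)
    have t: "0 \<le> t - k" "t + k \<le> \<tau>0" "0 \<le> t" "t \<le> \<tau>0" using k h by auto
    define E where "E = x ` {t - k..t + k}"
    define l where "l = diameter ((f \<circ> x) ` {t - k..t + k})"
    have cpt: "compact ((f \<circ> x) ` {t - k..t + k})" by (rule cfx[OF t(1,2)])
    have dl: "dist (f z) (f (x t)) \<le> l" if "z \<in> E" for z
    proof -
      have "f z \<in> (f \<circ> x) ` {t - k..t + k}" using that by (auto simp: E_def)
      moreover have "f (x t) \<in> (f \<circ> x) ` {t - k..t + k}" using k by (auto intro!: image_eqI[of _ _ t])
      ultimately show ?thesis unfolding l_def by (rule diameter_bounded_bound[OF compact_imp_bounded[OF cpt]])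
    qed
    have after: "norm (x s - x t - (s - t) *\<^sub>R f a) \<le> \<mu> / 32 * \<bar>s - t\<bar>" if "t - k \<le> s" "s \<le> t + k" for s
    proof (cases "t \<le> s")
      case True
      then show ?thesis using disp[of t s] that t by simp
    next
      case False
      then have "norm (x t - x s - (t - s) *\<^sub>R f a) \<le> \<mu> / 32 * (t - s)" using disp[of s t] that t by simp
      moreover have "x t - x s - (t - s) *\<^sub>R f a = - (x s - x t - (s - t) *\<^sub>R f a)"
        by (simp add: algebra_simps)
      ultimately show ?thesis using False by (simp only: norm_minus_cancel) simp
    qed
    have kr: "\<mu> / 32 * k \<le> 4/10 * r" using k\<mu> r by (simp add: mult.commute)
    have pt: "norm (x (t - k) - x t + (4 * r) *\<^sub>R e) \<le> 4/10 * r" "norm (x (t + k) - x t - (4 * r) *\<^sub>R e) \<le> 4/10 * r"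
    proof -
      have "k *\<^sub>R f a = (4 * r) *\<^sub>R e" by (simp add: e(2) k\<mu>)
      then show "norm (x (t - k) - x t + (4 * r) *\<^sub>R e) \<le> 4/10 * r" "norm (x (t + k) - x t - (4 * r) *\<^sub>R e) \<le> 4/10 * r"
        using after[of "t - k"] after[of "t + k"] kr k by simp_all
    qed
    have Esub: "E \<subseteq> cball (x t) (5 * r)"
    proof
      fix z assume "z \<in> E"
      then obtain s where s: "t - k \<le> s" "s \<le> t + k" "z = x s" by (auto simp: E_def)
      have sk: "\<bar>s - t\<bar> \<le> k" using s by (auto simp: abs_le_iff)
      have "norm (x s - x t) \<le> norm (x s - x t - (s - t) *\<^sub>R f a) + norm ((s - t) *\<^sub>R f a)"
        using norm_triangle_ineq[of "x s - x t - (s - t) *\<^sub>R f a" "(s - t) *\<^sub>R f a"] by simp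
      also have "\<dots> \<le> \<mu> / 32 * k + k * \<mu>"
      proof (rule add_mono)
        have "\<mu> / 32 * \<bar>s - t\<bar> \<le> \<mu> / 32 * k" using sk \<mu> by (intro mult_left_mono) auto
        then show "norm (x s - x t - (s - t) *\<^sub>R f a) \<le> \<mu> / 32 * k" using after[OF s(1,2)] by linarith
        show "norm ((s - t) *\<^sub>R f a) \<le> k * \<mu>"
          using mult_right_mono[OF sk, of \<mu>] \<mu> by (simp add: \<mu>_def)
      qed
      also have "\<dots> \<le> 5 * r" using kr k\<mu> r by linarith
      finally show "z \<in> cball (x t) (5 * r)" using s(3) by (simp add: dist_norm norm_minus_commute)
    qed
    have lpos: "0 < l"
    proof -
      have p: "x (t + k) \<in> E" using k by (simp add: E_def)
      have "inj_on x {0..\<tau>0}" using xarc by (simp add: C1_arc_param_def)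
      then have "x (t + k) \<noteq> x t" using t k inj_onD[of x "{0..\<tau>0}" "t + k" t] by auto
      moreover have "x (t + k) \<in> \<Omega>" "x t \<in> \<Omega>" using x(2) t \<tau>0 k by auto
      ultimately have "f (x (t + k)) \<noteq> f (x t)" using inj_onD[OF \<Omega>(3)] by blast
      then show ?thesis using dl[OF p] zero_less_dist_iff[of "f (x (t + k))" "f (x t)"] by linarith
    qed
    have rR: "r \<le> 2 * R"
      using dist_triangle2[of "x t" "y t" a] xR[OF t(3,4)] yR[OF t(3,4)] by (simp add: r_def)
    have "dist (f (y t)) (f (x t)) \<le> M * l"
    proof (rule arc[OF \<Omega>])
      show "y t \<noteq> x t" using False by (auto simp: w_def)
      show "cball (x t) (25 * n * dist (x t) (y t)) \<subseteq> \<Omega>" using ball[OF xR[OF t(3,4)] rR] by (simp add: r_def)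
      show "norm e = 1" by (rule e)
      show "connected E" unfolding E_def by (intro connected_continuous_image cx t) simp
      show "E \<subseteq> cball (x t) (5 * dist (x t) (y t))" using Esub by (simp add: r_def)
      show "x (t - k) \<in> E" "x (t + k) \<in> E" using k by (auto simp: E_def)
      show "norm (x (t - k) - x t + (4 * dist (x t) (y t)) *\<^sub>R e) \<le> 4/10 * dist (x t) (y t)"
        using pt(1) by (simp only: r_def)
      show "norm (x (t + k) - x t - (4 * dist (x t) (y t)) *\<^sub>R e) \<le> 4/10 * dist (x t) (y t)"
        using pt(2) by (simp only: r_def)
      show "0 < l" by (rule lpos)
      show "dist (f z) (f (x t)) \<le> l" if "z \<in> E" for z by (rule dl[OF that])
    qed
    also have "\<dots> \<le> M * (V (t + k) - V (t - k))"
      using Vdiam[of "t - k" "t + k"] t k M by (intro mult_left_mono) (auto simp: l_def)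
    also have "\<dots> \<le> M * (V (t + h) - V (t - h))"
      using Vmono[of "t - h" "t - k"] Vmono[of "t + k" "t + h"] t k h M by (intro mult_left_mono) auto
    finally show ?thesis by (simp add: dist_norm norm_minus_commute)
  qed
  have "x t2 = y t2" if t2: "0 \<le> t2" "t2 \<le> s0 / 2" for t2
  proof (rule ccontr)
    assume ne: "x t2 \<noteq> y t2"
    have "continuous_on {0..t2} (\<lambda>t. norm (w t))"
    proof (intro continuous_at_imp_continuous_on ballI continuous_norm)
      fix t assume "t \<in> {0..t2}"
      then show "isCont w t" using t2 s0 by (intro has_vector_derivative_continuous[OF wd]) auto
    qed
    then obtain t1 where t1: "0 \<le> t1" "t1 \<le> t2" and max: "\<And>t. 0 \<le> t \<Longrightarrow> t \<le> t2 \<Longrightarrow> norm (w t) \<le> norm (w t1)"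
      using continuous_attains_sup[of "{0..t2}" "\<lambda>t. norm (w t)"] t2 by auto
    define D where "D = norm (w t1)"
    have "0 < norm (w t2)" using ne by (simp add: w_def)
    then have D: "0 < D" using max[OF t2(1) order_refl] unfolding D_def by linarith
    define h where "h = 4 / \<mu> * D"
    have h: "0 < h" using D \<mu> by (simp add: h_def)
    have t1': "t1 \<le> \<tau>0" "t1 \<le> s0 / 2" using t1 t2 s0 by auto
    have h\<mu>: "h * \<mu> = 4 * D" using \<mu> by (simp add: h_def)
    have "4 / \<mu> * D \<le> 4 / \<mu> * (\<mu> / 16 * t1)"
      using wsmall[OF t1(1) t1'(1)] \<mu> by (intro mult_left_mono) (auto simp: D_def)
    \<comment> \<open>So the starting time \<open>2 * h\<close> comes before \<open>t1\<close>, and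
      \<open>\<tau> + h\<close> stays below \<open>s0\<close> for all times up to
      \<open>t1\<close>.\<close>
    then have ht: "h \<le> t1 / 4" using \<mu> by (simp add: h_def)
    \<comment> \<open>\<open>shifted_increment_bound\<close> asks for monotonicity and small
      increments at all later times; freezing \<open>V\<close> at \<open>s0\<close> provides
      both.\<close>
    define Vc where "Vc = (\<lambda>t. V (min t s0))"
    have Vc: "Vc t = V t" if "t \<le> s0" for t using that by (simp add: Vc_def)
    have "norm (w t1 - w (2 * h)) \<le> M * h * (3 * \<kappa>)"
    proof (rule shifted_increment_bound[of h t1 M w "\<lambda>t. f (x t) - f (y t)" Vc \<kappa>])
      show "0 < h" "2 * h \<le> t1" "0 \<le> M" using h ht M t1 by auto
      show "(w has_vector_derivative f (x \<tau>) - f (y \<tau>)) (at \<tau>)" if "2 * h \<le> \<tau>" "\<tau> \<le> t1" for \<tau>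
        using wd that h t1' by simp
      show "norm (f (x \<tau>) - f (y \<tau>)) \<le> M * (Vc (\<tau> + h) - Vc (\<tau> - h))" if \<tau>: "2 * h \<le> \<tau>" "\<tau> \<le> t1" for \<tau>
      proof -
        have le: "\<tau> + h \<le> s0" "\<tau> - h \<le> s0" using \<tau> ht t1' h s0 by linarith+
        have "norm (f (x \<tau>) - f (y \<tau>)) \<le> M * (V (\<tau> + h) - V (\<tau> - h))"
        proof (rule key)
          have "norm (w \<tau>) \<le> D" unfolding D_def using \<tau> h t1 by (intro max) auto
          then show "4 / \<mu> * norm (w \<tau>) \<le> h" unfolding h_def using \<mu> by (intro mult_left_mono) auto
          show "h \<le> \<tau>" "\<tau> + h \<le> \<tau>0" using \<tau> h le s0 by auto
        qed
        then show ?thesis using Vc[OF le(1)] Vc[OF le(2)] by simp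
      qed
      show "Vc p \<le> Vc q" if "h \<le> p" "p \<le> q" for p q
        unfolding Vc_def using that h s0 by (intro Vmono) auto
      show "Vc q - Vc p \<le> \<kappa>" if "h \<le> p" "p \<le> q" for p q
        unfolding Vc_def using that h s0 by (intro small) auto
    qed
    also have "M * h * (3 * \<kappa>) = D / 4"
    proof -
      have "M * h * (3 * \<kappa>) = h * \<mu> / 16" using M by (simp add: \<kappa>_def)
      then show ?thesis by (simp add: h\<mu>)
    qed
    finally have "norm (w t1 - w (2 * h)) \<le> D / 4" .
    moreover have "norm (w (2 * h)) \<le> \<mu> / 16 * (2 * h)" using h ht t1 t1' by (intro wsmall) auto
    moreover have "\<mu> / 16 * (2 * h) = D / 2" using h\<mu> by (simp add: mult.commute)
    moreover have "D \<le> norm (w t1 - w (2 * h)) + norm (w (2 * h))"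
      unfolding D_def using norm_triangle_ineq[of "w t1 - w (2 * h)" "w (2 * h)"] by simp
    ultimately show False using D by linarith
  qed
  then show ?thesis using s0 by (intro exI[of _ "s0 / 2"]) auto
qed

section \<open>Reduction to forward uniqueness\<close>

text \<open>An upper limit at most \<open>K\<close> bounds the quotient by \<open>K + 1\<close> for
  small radii. Compactness of the sphere and injectivity make the denominator positive, so it can be
  cleared.\<close>

lemma quasiconformal_on_imp_quasiround_on:
  fixes f :: "real ^ 'n::finite \<Rightarrow> real ^ 'n"
  assumes \<Omega>: "open \<Omega>" "continuous_on \<Omega> f" "inj_on f \<Omega>"
    and H: "\<And>a. a \<in> \<Omega> \<Longrightarrow> linear_dilatation f a \<le> ereal K"
  shows "quasiround_on (K + 1) \<Omega> f"
  unfolding quasiround_on_def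
proof
  fix a assume a: "a \<in> \<Omega>"
  define L where "L = (\<lambda>\<epsilon>. SUP x\<in>sphere a \<epsilon>. norm (f x - f a))"
  define l where "l = (\<lambda>\<epsilon>. INF y\<in>sphere a \<epsilon>. norm (f y - f a))"
  have "Limsup (at_right 0) (\<lambda>\<epsilon>. ereal (L \<epsilon> / l \<epsilon>)) < ereal (K + 1)"
  proof -
    have "linear_dilatation f a = Limsup (at_right 0) (\<lambda>\<epsilon>. ereal (L \<epsilon> / l \<epsilon>))"
      by (simp only: linear_dilatation_def L_def l_def)
    moreover have "linear_dilatation f a < ereal (K + 1)" by (rule le_less_trans[OF H[OF a]]) simp
    ultimately show ?thesis by (simp only:)
  qed
  then have "\<forall>\<^sub>F \<epsilon> in at_right 0. ereal (L \<epsilon> / l \<epsilon>) < ereal (K + 1)" by (rule Limsup_lessD)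
  then obtain \<delta>1 where \<delta>1: "0 < \<delta>1" "\<And>\<epsilon>. 0 < \<epsilon> \<Longrightarrow> \<epsilon> < \<delta>1 \<Longrightarrow> L \<epsilon> / l \<epsilon> < K + 1"
    unfolding eventually_at_right_field by auto
  obtain \<delta>2 where \<delta>2: "0 < \<delta>2" "cball a \<delta>2 \<subseteq> \<Omega>" using \<Omega>(1) a by (meson open_contains_cball)
  show "\<exists>\<delta>>0. \<forall>s y z. 0 < s \<and> s < \<delta> \<and> dist a y = s \<and> dist a z = s \<longrightarrow>
      dist (f y) (f a) \<le> (K + 1) * dist (f z) (f a)"
  proof (intro exI[of _ "min \<delta>1 \<delta>2"] conjI allI impI)
    show "0 < min \<delta>1 \<delta>2" using \<delta>1 \<delta>2 by simp
    fix s y z assume s: "0 < s \<and> s < min \<delta>1 \<delta>2 \<and> dist a y = s \<and> dist a z = s"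
    have sub: "sphere a s \<subseteq> \<Omega>"
    proof -
      have "sphere a s \<subseteq> cball a \<delta>2" using s by auto
      then show ?thesis using \<delta>2(2) by (rule order_trans)
    qed
    have mem: "y \<in> sphere a s" "z \<in> sphere a s" using s by auto
    define N where "N = (\<lambda>x. norm (f x - f a)) ` sphere a s"
    have "continuous_on (sphere a s) (\<lambda>x. norm (f x - f a))"
      by (intro continuous_intros continuous_on_subset[OF \<Omega>(2) sub])
    then have N: "compact N" unfolding N_def by (rule compact_continuous_image) simp
    have "N \<noteq> {}" using mem by (auto simp: N_def)
    have bd: "bdd_above N" "bdd_below N" using compact_imp_bounded[OF N]
      by (simp_all add: bounded_imp_bdd_above bounded_imp_bdd_below)
    have "l s \<in> N"
      using closed_contains_Inf[OF \<open>N \<noteq> {}\<close> bd(2) compact_imp_closed[OF N]] by (simp add: l_def N_def)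
    then obtain v where v: "v \<in> sphere a s" "l s = norm (f v - f a)" by (auto simp: N_def)
    have "v \<noteq> a" using v(1) s by auto
    then have "f v \<noteq> f a" using inj_onD[OF \<Omega>(3), of v a] v(1) sub a by blast
    then have l0: "0 < l s" using v(2) by simp
    have "norm (f y - f a) \<le> L s" using cSup_upper[OF _ bd(1)] mem by (simp add: L_def N_def)
    also have "\<dots> \<le> (K + 1) * l s" using \<delta>1(2)[of s] s l0 by (simp add: pos_divide_less_eq less_imp_le)
    also have "\<dots> \<le> (K + 1) * norm (f z - f a)"
    proof (rule mult_left_mono)
      show "l s \<le> norm (f z - f a)" using cInf_lower[OF _ bd(2)] mem by (simp add: l_def N_def)
      have "0 \<le> L s" using \<open>norm (f y - f a) \<le> L s\<close> norm_ge_zero order_trans by blast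
      then have "0 \<le> L s / l s" using l0 by simp
      then show "0 \<le> K + 1" using \<delta>1(2)[of s] s by simp
    qed
    finally show "dist (f y) (f a) \<le> (K + 1) * dist (f z) (f a)" by (simp add: dist_norm)
  qed
qed

lemma diameter_uminus_image: "diameter (uminus ` A) = diameter A"
  for A :: "'a::real_normed_vector set"
proof -
  have "case_prod dist ` (uminus ` A \<times> uminus ` A) = case_prod dist ` (A \<times> A)"
  proof (intro equalityI subsetI)
    fix d assume "d \<in> case_prod dist ` (uminus ` A \<times> uminus ` A)"
    then obtain x y where "x \<in> A" "y \<in> A" "d = dist (- x) (- y)" by auto
    then show "d \<in> case_prod dist ` (A \<times> A)" by (auto simp: dist_minus)
  next
    fix d assume "d \<in> case_prod dist ` (A \<times> A)"
    then obtain x y where "x \<in> A" "y \<in> A" "d = dist (- x) (- y)" by (auto simp: dist_minus)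
    then show "d \<in> case_prod dist ` (uminus ` A \<times> uminus ` A)"
      by (intro image_eqI[of _ _ "(- x, - y)"]) auto
  qed
  then show ?thesis by (simp only: diameter_def image_is_empty)
qed

text \<open>For the reversal of time: \<open>x (- t)\<close> solves the equation with the field
  \<open>- f\<close>.\<close>

lemma bv_on_C1_curves_uminus:
  assumes "bv_on_C1_curves \<Omega> f"
  shows "bv_on_C1_curves \<Omega> (\<lambda>z. - f z)"
proof -
  have "diameter ((\<lambda>z. - f z) ` \<gamma>) = diameter (f ` \<gamma>)" for \<gamma>
    using diameter_uminus_image[of "f ` \<gamma>"] by (simp only: image_image)
  then have "arc_variation (\<lambda>z. - f z) = arc_variation f"
    unfolding arc_variation_def by (simp only:)
  then show ?thesis using assms by (simp only: bv_on_C1_curves_def)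
qed

theorem theorem1p11:
  fixes \<Omega> :: "(real ^ 'n::finite) set"
    and f :: "real ^ 'n \<Rightarrow> real ^ 'n"
    and K :: real
    and a :: "real ^ 'n"
    and x y :: "real \<Rightarrow> real ^ 'n"
    and I J :: "real set"
  assumes "open \<Omega>" and "connected \<Omega>" and "\<Omega> \<noteq> {}"
    and "1 \<le> K"
    and "quasiconformal_on K \<Omega> f"
    and "bv_on_C1_curves \<Omega> f"
    and "a \<in> \<Omega>" and "f a \<noteq> 0"
    and "local_solution \<Omega> f a I x"
    and "local_solution \<Omega> f a J y"
  shows "\<exists>\<epsilon>>0. {-\<epsilon><..<\<epsilon>} \<subseteq> I \<inter> J \<and> (\<forall>t. -\<epsilon> < t \<and> t < \<epsilon> \<longrightarrow> x t = y t)"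
proof -
  obtain g where g: "homeomorphism \<Omega> (f ` \<Omega>) f g"
    using assms(5) unfolding quasiconformal_on_def by blast
  have f: "continuous_on \<Omega> f" using g by (simp add: homeomorphism_def)
  have inj: "inj_on f \<Omega>" using g by (intro inj_on_inverseI[of _ g]) (simp add: homeomorphism_def)
  have qr: "quasiround_on (K + 1) \<Omega> f"
    using assms(5) unfolding quasiconformal_on_def
    by (intro quasiconformal_on_imp_quasiround_on assms(1) f inj) blast
  have K: "1 \<le> K + 1" using assms(4) by simp
  have x: "x 0 = a" "\<And>t. t \<in> I \<Longrightarrow> x t \<in> \<Omega>" "\<And>t. t \<in> I \<Longrightarrow> (x has_vector_derivative f (x t)) (at t)"
    and y: "y 0 = a" "\<And>t. t \<in> J \<Longrightarrow> y t \<in> \<Omega>" "\<And>t. t \<in> J \<Longrightarrow> (y has_vector_derivative f (y t)) (at t)"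
    using assms(9,10) unfolding local_solution_def by blast+
  have "open (I \<inter> J)" "0 \<in> I \<inter> J" using assms(9,10) unfolding local_solution_def by blast+
  then obtain T where T: "0 < T" "cball 0 T \<subseteq> I \<inter> J" by (meson open_contains_cball)
  have IJ: "t \<in> I" "t \<in> J" if "\<bar>t\<bar> \<le> T" for t using T(2) that by (auto simp: subset_iff)
  have "\<exists>\<epsilon>>0. \<forall>t. 0 \<le> t \<and> t \<le> \<epsilon> \<longrightarrow> x t = y t"
  proof (rule forward_uniqueness[where x = x and y = y and \<Omega> = \<Omega> and f = f and T = T,
        OF assms(1) f inj qr K assms(6,7,8) T(1) x(1) _ _ y(1)])
    fix t assume t: "0 \<le> t" "t \<le> T"
    then have t': "t \<in> I" "t \<in> J" using IJ[of t] by auto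
    show "x t \<in> \<Omega>" "y t \<in> \<Omega>" using x(2) y(2) t' by blast+
    show "(x has_vector_derivative f (x t)) (at t)" by (rule x(3)[OF t'(1)])
    show "(y has_vector_derivative f (y t)) (at t)" by (rule y(3)[OF t'(2)])
  qed
  then obtain \<epsilon>1 where \<epsilon>1: "0 < \<epsilon>1" "\<And>t. 0 \<le> t \<Longrightarrow> t \<le> \<epsilon>1 \<Longrightarrow> x t = y t" by blast
  have flow: "((\<lambda>t. z (- t)) has_vector_derivative - f (z (- t))) (at t)"
    if "(z has_vector_derivative f (z (- t))) (at (- t))" for z :: "real \<Rightarrow> real ^ 'n" and t
  proof -
    have "(uminus has_vector_derivative (-1 :: real)) (at t)" by (auto intro!: derivative_eq_intros)
    from vector_diff_chain_at[OF this that] show ?thesis by (simp add: comp_def)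
  qed
  have qr': "quasiround_on (K + 1) \<Omega> (\<lambda>z. - f z)"
    using qr by (simp add: quasiround_on_def dist_minus)
  have inj': "inj_on (\<lambda>z. - f z) \<Omega>" using inj by (simp add: inj_on_def)
  have f': "continuous_on \<Omega> (\<lambda>z. - f z)" using f by (rule continuous_on_minus)
  have fa': "- f a \<noteq> 0" using assms(8) by simp
  have z0: "x (- 0) = a" "y (- 0) = a" using x(1) y(1) by simp_all
  have "\<exists>\<epsilon>>0. \<forall>t. 0 \<le> t \<and> t \<le> \<epsilon> \<longrightarrow> x (- t) = y (- t)"
  proof (rule forward_uniqueness[where x = "\<lambda>t. x (- t)" and y = "\<lambda>t. y (- t)" and \<Omega> = \<Omega>
        and f = "\<lambda>z. - f z" and T = T, OF assms(1) f' inj' qr' K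
        bv_on_C1_curves_uminus[OF assms(6)] assms(7) fa' T(1) z0(1) _ _ z0(2)])
    fix t assume t: "0 \<le> t" "t \<le> T"
    then have t': "- t \<in> I" "- t \<in> J" using IJ[of "- t"] by auto
    show "x (- t) \<in> \<Omega>" "y (- t) \<in> \<Omega>" using x(2) y(2) t' by blast+
    show "((\<lambda>t. x (- t)) has_vector_derivative - f (x (- t))) (at t)" by (rule flow[OF x(3)[OF t'(1)]])
    show "((\<lambda>t. y (- t)) has_vector_derivative - f (y (- t))) (at t)" by (rule flow[OF y(3)[OF t'(2)]])
  qed
  then obtain \<epsilon>2 where \<epsilon>2: "0 < \<epsilon>2" "\<And>t. 0 \<le> t \<Longrightarrow> t \<le> \<epsilon>2 \<Longrightarrow> x (- t) = y (- t)" by blast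
  define \<epsilon> where "\<epsilon> = min T (min \<epsilon>1 \<epsilon>2)"
  show ?thesis
  proof (intro exI[of _ \<epsilon>] conjI allI impI)
    show "0 < \<epsilon>" using T \<epsilon>1 \<epsilon>2 by (simp add: \<epsilon>_def)
    show "{-\<epsilon><..<\<epsilon>} \<subseteq> I \<inter> J"
    proof
      fix t assume "t \<in> {-\<epsilon><..<\<epsilon>}"
      then have "\<bar>t\<bar> \<le> T" by (auto simp: \<epsilon>_def)
      then show "t \<in> I \<inter> J" using IJ by blast
    qed
    fix t assume t: "- \<epsilon> < t \<and> t < \<epsilon>"
    show "x t = y t"
    proof (cases "0 \<le> t")
      case True
      then show ?thesis using \<epsilon>1(2)[of t] t by (simp add: \<epsilon>_def)
    next
      case False
      have "\<epsilon> \<le> \<epsilon>2" by (simp add: \<epsilon>_def)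
      then have "x (- (- t)) = y (- (- t))" using False t by (intro \<epsilon>2(2)) auto
      then show ?thesis by simp
    qed
  qed
qed

end
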